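(* Let Assumptions (A1), (A2), (A3), (A4) of the context hold, let $s_{\max}\ge 1$, and let $\kappa_d,\kappa_\Psi,\kappa_q$ be the constants described in the context. Define $$A_{\min}:=\frac{\xi_{\min}\tau_{\min}}{\tau_{\min}L+\Gamma},\qquad A_{\max}:=\frac{\xi_{-1}\tau_{-1}}{\tau_{-1}L+\Gamma},$$ suppose that $\beta_k=\beta$ for all $k\in[k_{\max}]$, where $\beta:=\gamma/\sqrt{k_{\max}+1}$ for some $\gamma\in\big(0,\frac{A_{\min}}{A_{\max}+\theta}\big]$, and define $$\begin{aligned} \overline M:=\;&\tfrac14(A_{\max}+\theta\beta)(\tau_{-1}+\tau_{\min})\zeta^{-1}M\\ &+\tfrac12(A_{\max}+\theta\beta)(\tau_{-1}-\tau_{\min})\big(\kappa_d\sqrt M(2\kappa_g+\sqrt M)+\kappa_H\kappa_d^2(M+\tfrac32\kappa_g^2)\big)+\theta\tau_{-1}\kappa_g\kappa_d\sqrt M,\\ \kappa_{E_3}:=\;&((A_{\max}+\theta\beta)\tau_{-1}-A_{\min}\tau_{\min})\kappa_g\kappa_dM_\tau,\\ \kappa_{\Delta q,1}:=\;&((A_{\max}+\theta\beta)\tau_{-1}-A_{\min}\tau_{\min})\kappa_d\kappa_g^2(1+\tfrac12\kappa_H\kappa_d),\\ \kappa_{\Delta q,2}:=\;&((A_{\max}+\theta\beta)\tau_{-1}-A_{\min}\tau_{\min})\kappa_d(1+\tfrac12\kappa_H\kappa_d)(M+\kappa_g^2). \end{aligned}$$ For $\delta\in(0,1)$ and $s\in\mathbb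 N$ set $$\hat\delta:=\frac{\delta}{\sum_{j=0}^{\max\{s_{\max}-1,0\}}\binom{k_{\max}}{j}},\qquad \ell(s,\bar\delta):=s+\log(1/\bar\delta)+\sqrt{\log(1/\bar\delta)^2+2s\log(1/\bar\delta)}\quad(\bar\delta\in(0,1)).$$ Let $K^*$ have the discrete uniform distribution over $[k_{\max}]$. Then for any $\delta\in(0,1)$ it holds with probability at least $1-\delta$ that $$\begin{aligned} &\mathbb E\left[\frac{\|\nabla f(X_{K^*})+J_{K^*}^\top Y_{K^*}^{\mathrm{true}}\|^2}{\kappa_H^2}+\|c(X_{K^*})\|_1\,\Big|\,E\right]\\ &\le 2(\kappa_\Psi+1)\left(\frac{\tau_{-1}(f_0-f_{\mathrm{low}})+\|c_0\|_1+\overline M\gamma^2}{\kappa_q\tau_{\min}A_{\min}\gamma\sqrt{k_{\max}+1}}\right) +2(\kappa_\Psi+1)\left(\frac{\kappa_{E_3}\gamma(\ell(s_{\max},\hat\delta/2)+1)}{\kappa_q\tau_{\min}A_{\min}\gamma\sqrt{k_{\max}+1}}\right)\\ &\quad+(\kappa_\Psi+1)\left(\frac{2(\kappa_{\Delta q,1}\gamma+\kappa_{\Delta q,2}\gamma^2/\sqrt{k_{\max}+1})}{\kappa_q\tau_{\min}A_{\min}\gamma(k_{\max}+1)}\right)\left\lceil\frac{\ell(s_{\max},\hat\delta/2)+1}{p_\tau}\right\rceil . \end{aligned}$$ Hence (for $k_{\max}\ge2$), with probability at least $1-\delta$, $$\begin{aligned} &\mathbb E\big[\|\nabla f(X_{K^*})+J_{K^*}^\top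 Y_{K^*}^{\mathrm{true}}\|^2+\|c(X_{K^*})\|_1\,\big|\,E\big]\\ &=\mathcal O\left(\frac{\tau_{-1}(f_0-f_{\mathrm{low}})+\|c_0\|_1+M}{\sqrt{k_{\max}+1}}+\frac{(\tau_{-1}-\tau_{\min})(s_{\max}\log(k_{\max})+\log(1/\delta))}{\sqrt{k_{\max}+1}}\right), \end{aligned}$$ where the hidden constant does not depend on $k_{\max}$, $s_{\max}$, or $\delta$.
   Context: Notation: $\|\cdot\|$ is the $\ell_2$-norm for vectors and the induced norm for matrices; $\mathbb N=\{0,1,2,\dots\}$; $[k]=\{0,\dots,k\}$; $v_{[k]}=\{v_0,\dots,v_k\}$; $\mathbb S^n$ is the set of real symmetric $n\times n$ matrices. A subscript $k$ on $f,c,J$ denotes evaluation at $x_k$. $\phi=\mathcal O(\varphi)$ means $|\phi|\le C\varphi$ for some constant $C\in(0,\infty)$. Problem: $\min_{x\in\mathbb R^n} f(x)$ subject to $c(x)=0$, where $f(x)=\mathbb E[F(x,\omega)]$, $c:\mathbb R^n\to\mathbb R^m$, $m\le n$, $J(x):=\nabla c(x)^\top\in\mathbb R^{m\times n}$. (A1) $\mathcal X\subseteq\mathbb R^n$ is an open convex set containing the iterates $\{x_k\}$ for all realizations of the algorithm below. Over $\mathcal X$: $f$ is continuously differentiable and bounded below by $f_{\mathrm{low}}\in\mathbb R$; $\nabla f$ is bounded and Lipschitz with constant $L\in(0,\infty)$; $c$ and $J$ are bounded; each $\nabla c_i$ is Lipschitz with constant $\gamma_i$; the singular values of $J$ are bounded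 below away from zero. $\kappa_g>0$ denotes a constant with $\|\nabla f(x_k)\|\le\kappa_g$ for all $k$ in any realization. (A2) $H_k\in\mathbb S^n$ is chosen independently from the stochastic gradient $g_k$; $\|H_k\|\le\kappa_H$ with $\kappa_H>0$; and there is $\zeta>0$ such that $u^\top H_ku\ge\zeta\|u\|^2$ for all $u$ with $J_ku=0$, for all $k\in[k_{\max}]$. For $d$ with $c(x)+J(x)d=0$ let $\Delta q(x,\tau,g,H,d):=-\tau(g^\top d+\tfrac12\max\{d^\top Hd,0\})+\|c(x)\|_1$. Algorithm. Inputs: $x_0\in\mathbb R^n$, $k_{\max}\in\mathbb N$, $\tau_{-1}>0$, $\epsilon_\tau,\epsilon_\xi,\sigma\in(0,1)$, $\xi_{-1}>0$, $\{\beta_k\}\subset(0,1]$, $\theta\ge0$, the Lipschitz constant $L$, and $\Gamma\ge\sum_{i=1}^m\gamma_i$ (with $\gamma_i\in(0,\infty)$). For $k=0,\dots,k_{\max}$: given a stochastic gradient $g_k$, let $(d_k,y_k)$ solve $$\begin{bmatrix} H_k & J_k^\top \\ J_k & 0 \end{bmatrix}\begin{bmatrix} d_k \\ y_k \end{bmatrix}=-\begin{bmatrix} g_k \\ c_k \end{bmatrix}.$$ If $d_k=0$: $\tau_k=\tau_{k-1}$, $\xi_k=\xi_{k-1}$, $\alpha_k=1$. Otherwise: $\tau_k^{\mathrm{trial}}=\infty$ if $g_k^\top d_k+\max\{d_k^\top H_kd_k,0\}\le0$ and $\tau_k^{\mathrm{trial}}=\frac{(1-\sigma)\|c_k\|_1}{g_k^\top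 d_k+\max\{d_k^\top H_kd_k,0\}}$ otherwise; $\tau_k=\tau_{k-1}$ if $\tau_{k-1}\le\tau_k^{\mathrm{trial}}$, else $\tau_k=(1-\epsilon_\tau)\tau_k^{\mathrm{trial}}$; $\xi_k^{\mathrm{trial}}=\Delta q(x_k,\tau_k,g_k,H_k,d_k)/(\tau_k\|d_k\|^2)$; $\xi_k=\xi_{k-1}$ if $\xi_{k-1}\le\xi_k^{\mathrm{trial}}$, else $\xi_k=(1-\epsilon_\xi)\xi_k^{\mathrm{trial}}$; $\hat\alpha_{k,\mathrm{init}}=\frac{\beta_k\Delta q(x_k,\tau_k,g_k,H_k,d_k)}{(\tau_kL+\Gamma)\|d_k\|^2}$, $\tilde\alpha_{k,\mathrm{init}}=\hat\alpha_{k,\mathrm{init}}-\frac{4\|c_k\|_1}{(\tau_kL+\Gamma)\|d_k\|^2}$; $\hat\alpha_k,\tilde\alpha_k$ are the projections of these onto $\big[\frac{\beta_k\xi_k\tau_k}{\tau_kL+\Gamma},\frac{\beta_k\xi_k\tau_k}{\tau_kL+\Gamma}+\theta\beta_k^2\big]$; $\alpha_k=\hat\alpha_k$ if $\hat\alpha_k<1$, $\alpha_k=1$ if $\tilde\alpha_k\le1\le\hat\alpha_k$, $\alpha_k=\tilde\alpha_k$ if $\tilde\alpha_k>1$. In all cases $x_{k+1}=x_k+\alpha_kd_k$. Finally an index $k^*\in[k_{\max}]$ is sampled with $\mathbb P[k^*=k]=\beta_k/\sum_{j=0}^{k_{\max}}\beta_j$ (independently of the rest; uniform when $\beta_k$ is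 constant) and $x_{k^*}$ is returned. Random variables are written $X_k,G_k,D_k,Y_k,\mathcal T_k,\Xi_k,\mathcal A_k$, with realizations $x_k,g_k,d_k,y_k,\tau_k,\xi_k,\alpha_k$; conditioned on $G_{[k-1]}=g_{[k-1]}$ the values $x_k,\tau_{k-1},\xi_{k-1}$ are determined. "True" quantities: $(d_k^{\mathrm{true}},y_k^{\mathrm{true}})$ solves the linear system above with $g_k$ replaced by $\nabla f(x_k)$; $\tau_k^{\mathrm{trial,true}}$ is defined by the formula for $\tau_k^{\mathrm{trial}}$ with $(g_k,d_k)$ replaced by $(\nabla f(x_k),d_k^{\mathrm{true}})$; as random variables these are $D_k^{\mathrm{true}},Y_k^{\mathrm{true}},\mathcal T_k^{\mathrm{trial,true}}$. Decompose $d_k^{\mathrm{true}}=u_k^{\mathrm{true}}+v_k$ with $u_k^{\mathrm{true}}\in\mathrm{Null}(J_k)$, $v_k\in\mathrm{Range}(J_k^\top)$. Event $E=E(k_{\max},s_{\max},\tau_{\min},\xi_{\min})$, for given $(k_{\max},s_{\max},\tau_{\min},\xi_{\min})\in\mathbb N\times\mathbb N\times\mathbb R_{>0}\times\mathbb R_{>0}$: for all $k\in[k_{\max}]$, $\tau_k\ge\tau_{\min}$, $\tau_k^{\mathrm{trial,true}}\ge\tau_{\min}$ and $\xi_k=\xi_{\min}$; and $|\{k\in[k_{\max}]:\tau_k<\tau_{k-1}\}|\le s_{\max}$. Write $\mathbb P_k[\cdot]=\mathbb P[\cdot\mid E,G_{[k-1]}=g_{[k-1]}]$ and $\mathbb E_k[\cdot]=\mathbb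 E[\cdot\mid E,G_{[k-1]}=g_{[k-1]}]$. (A3) There are $M>0$, $M_\tau>0$ such that for all $k\in[k_{\max}]$ and all realizations $g_{[k-1]}$: $\mathbb E_k[G_k]=\nabla f(x_k)$, $\mathbb E_k[\|G_k-\nabla f(x_k)\|^2]\le M$, and either $\mathbb P_k[\nabla f(x_k)^\top(D_k-d_k^{\mathrm{true}})<0,\ \mathcal T_k<\tau_{k-1}]=0$ or $\mathbb E_k[\|G_k-\nabla f(x_k)\|\mid\nabla f(x_k)^\top(D_k-d_k^{\mathrm{true}})<0,\ \mathcal T_k<\tau_{k-1}]\le M_\tau$. (A4) There is $p_\tau\in(0,1]$ such that for all $k\in[k_{\max}]$ and all realizations $g_{[k-1]}$: $\mathbb P_k[G_k^\top D_k+\max\{D_k^\top H_kD_k,0\}\ge\nabla f(x_k)^\top d_k^{\mathrm{true}}+\max\{(d_k^{\mathrm{true}})^\top H_kd_k^{\mathrm{true}},0\}]\ge p_\tau$. Constant $\kappa_d>0$: a constant such that, for all $k\in[k_{\max}]$ and all realizations, $\|d_k^{\mathrm{true}}\|\le\kappa_d\|\nabla f(x_k)\|\le\kappa_d\kappa_g$ and $\|D_k-d_k^{\mathrm{true}}\|\le\kappa_d\|G_k-\nabla f(x_k)\|$; consequently $\mathbb E_k[\|D_k-d_k^{\mathrm{true}}\|]\le\kappa_d\sqrt M$ and $\mathbb E_k[\|D_k-d_k^{\mathrm{true}}\|\mid\nabla f(x_k)^\top(D_k-d_k^{\mathrm{true}})<0,\mathcal T_k<\tau_{k-1}]\le\kappa_dM_\tau$.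 Constants $\kappa_{uv},\kappa_\Psi,\kappa_q>0$ (their existence under (A1), (A2) is known from prior work): $\kappa_{uv}$ is such that, for all $k\in[k_{\max}]$, $\|u_k^{\mathrm{true}}\|^2\ge\kappa_{uv}\|v_k\|^2$ implies $\tfrac12(d_k^{\mathrm{true}})^\top H_kd_k^{\mathrm{true}}\ge\tfrac14\zeta\|u_k^{\mathrm{true}}\|^2$. With $\Psi_k:=\|u_k^{\mathrm{true}}\|^2+\|c_k\|$ if $\|u_k^{\mathrm{true}}\|^2\ge\kappa_{uv}\|v_k\|^2$ and $\Psi_k:=\|c_k\|$ otherwise, $\kappa_\Psi$ is such that $\|d_k^{\mathrm{true}}\|^2+\|c_k\|_1\le(\kappa_\Psi+1)\Psi_k$ for all $k\in[k_{\max}]$, and $\kappa_q$ is such that $\Delta q(x_k,\tau,\nabla f(x_k),H_k,d_k^{\mathrm{true}})\ge\kappa_q\tau\Psi_k$ for all $k\in[k_{\max}]$ and all $\tau\le\tau_k^{\mathrm{trial,true}}$.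
   Formalization: The explicit bound additionally assumes that on E, for all k ≤ k_max, β_k ξ_k τ_k/(τ_k L+Γ) ≤ 1 (left end of the step-size interval at most 1); without it the bound fails, e.g. c(x)=x, H_k=1, θ=0, step size 3. P(E)>0 is assumed. The O-bound needs no such step condition. *)

theory Defs
  imports "HOL-Probability.Probability"
begin

record ('n, 'm) sqp_problem =
  obj :: "real ^ ('n::finite) \<Rightarrow> real"
  con :: "real ^ 'n \<Rightarrow> real ^ ('m::finite)"
  region :: "(real ^ 'n) set"         \<comment> \<open>the open convex set containing the iterates\<close>
  f_low :: real
  lip_obj :: real                     \<comment> \<open>\<open>L\<close>\<close>
  lip_con :: "'m \<Rightarrow> real"             \<comment> \<open>\<open>\<gamma>\<^sub>i\<close>\<close>

record 'n sqp_params =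
  x_init :: "real ^ ('n::finite)"
  tau_init :: real                    \<comment> \<open>\<open>\<tau>\<close> with index \<open>-1\<close>\<close>
  xi_init :: real                     \<comment> \<open>\<open>\<xi>\<close> with index \<open>-1\<close>\<close>
  eps_tau :: real
  eps_xi :: real
  sig :: real
  theta :: real
  Gam :: real

record sqp_consts =
  kap_g :: real
  kap_H :: real
  zeta_c :: real
  tau_min :: real
  xi_min :: real
  M_var :: real
  M_tau :: real
  p_tau :: real
  kap_d :: real
  kap_uv :: real
  kap_Psi :: real
  kap_q :: real

record ('w, 'n, 'm) sqp_process =
  pspace :: "'w measure"
  rG :: "nat \<Rightarrow> 'w \<Rightarrow> real ^ ('n::finite)"
  rH :: "nat \<Rightarrow> 'w \<Rightarrow> real ^ 'n ^ 'n"
  rX :: "nat \<Rightarrow> 'w \<Rightarrow> real ^ 'n"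
  rD :: "nat \<Rightarrow> 'w \<Rightarrow> real ^ 'n"
  rY :: "nat \<Rightarrow> 'w \<Rightarrow> real ^ ('m::finite)"
  rTau :: "nat \<Rightarrow> 'w \<Rightarrow> real"
  rXi :: "nat \<Rightarrow> 'w \<Rightarrow> real"
  rAlpha :: "nat \<Rightarrow> 'w \<Rightarrow> real"
  rDtrue :: "nat \<Rightarrow> 'w \<Rightarrow> real ^ 'n"
  rYtrue :: "nat \<Rightarrow> 'w \<Rightarrow> real ^ 'm"
  rKstar :: "'w \<Rightarrow> nat"

definition gradient :: "(real ^ 'n \<Rightarrow> real) \<Rightarrow> real ^ 'n \<Rightarrow> real ^ 'n" where
  "gradient f x = (THE g. GDERIV f x :> g)"

definition Jac :: "('n::finite, 'm::finite) sqp_problem \<Rightarrow> real ^ 'n \<Rightarrow> real ^ 'n ^ 'm" where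
  "Jac P x = jacobian (con P) (at x)"

definition norm1 :: "real ^ 'm \<Rightarrow> real" where
  "norm1 v = (\<Sum>i\<in>UNIV. \<bar>v $ i\<bar>)"

text \<open>The matrix norm induced by the Euclidean norm; \<open>norm\<close> on matrices is the Frobenius norm.\<close>

definition mat_norm :: "real ^ 'n ^ 'n \<Rightarrow> real" where
  "mat_norm B = onorm (\<lambda>v. B *v v)"

text \<open>Singular values of a matrix with at most as many rows as columns: the square roots of the
  eigenvalues of the (positive semidefinite) product of the matrix and its transpose.\<close>

definition singular_values :: "real ^ 'n ^ 'm \<Rightarrow> real set" where
  "singular_values B =
     {sqrt \<mu> | \<mu>. \<exists>v. v \<noteq> 0 \<and> (B ** transpose B) *v v = \<mu> *\<^sub>R v}"

definition stochastic_objective ::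
    "'s measure \<Rightarrow> (real ^ 'n \<Rightarrow> 's \<Rightarrow> real) \<Rightarrow> (real ^ 'n \<Rightarrow> real) \<Rightarrow> bool" where
  "stochastic_objective S F f \<longleftrightarrow>
     prob_space S \<and> (\<forall>x. integrable S (F x) \<and> f x = (\<integral>s. F x s \<partial>S))"

text \<open>The part of the smoothness assumption that does not refer to a run of the algorithm.\<close>

definition smooth_problem :: "('n::finite, 'm::finite) sqp_problem \<Rightarrow> bool" where
  "smooth_problem P \<longleftrightarrow>
     open (region P) \<and> convex (region P) \<and>
     (\<forall>x\<in>region P. obj P differentiable (at x)) \<and>
     continuous_on (region P) (gradient (obj P)) \<and>
     (\<forall>x\<in>region P. f_low P \<le> obj P x) \<and>
     bounded (gradient (obj P) ` region P) \<and>
     0 < lip_obj P \<and> (lip_obj P)-lipschitz_on (region P) (gradient (obj P)) \<and>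
     (\<forall>x\<in>region P. con P differentiable (at x)) \<and>
     bounded (con P ` region P) \<and> bounded (Jac P ` region P) \<and>
     (\<forall>i. 0 < lip_con P i \<and>
          (lip_con P i)-lipschitz_on (region P) (gradient (\<lambda>x. con P x $ i))) \<and>
     (\<exists>s>0. \<forall>x\<in>region P. \<forall>t\<in>singular_values (Jac P x). s \<le> t)"

definition admissible_params :: "('n::finite, 'm::finite) sqp_problem \<Rightarrow> 'n sqp_params \<Rightarrow> bool" where
  "admissible_params P A \<longleftrightarrow>
     0 < tau_init A \<and> 0 < xi_init A \<and>
     0 < eps_tau A \<and> eps_tau A < 1 \<and> 0 < eps_xi A \<and> eps_xi A < 1 \<and>
     0 < sig A \<and> sig A < 1 \<and> 0 \<le> theta A \<and> (\<Sum>i\<in>UNIV. lip_con P i) \<le> Gam A"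

definition admissible_consts :: "sqp_consts \<Rightarrow> bool" where
  "admissible_consts C \<longleftrightarrow>
     0 < kap_g C \<and> 0 < kap_H C \<and> 0 < zeta_c C \<and> 0 < tau_min C \<and> 0 < xi_min C \<and>
     0 < M_var C \<and> 0 < M_tau C \<and> 0 < p_tau C \<and> p_tau C \<le> 1 \<and>
     0 < kap_d C \<and> 0 < kap_uv C \<and> 0 < kap_Psi C \<and> 0 < kap_q C"

definition kkt ::
    "real ^ 'n ^ 'n \<Rightarrow> real ^ 'n ^ 'm \<Rightarrow> real ^ 'n \<Rightarrow> real ^ 'm \<Rightarrow> real ^ 'n \<Rightarrow> real ^ 'm \<Rightarrow> bool" where
  "kkt H J g c d y \<longleftrightarrow> H *v d + transpose J *v y = - g \<and> J *v d = - c"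

definition delta_q ::
    "real ^ 'm \<Rightarrow> real \<Rightarrow> real ^ 'n \<Rightarrow> real ^ 'n ^ 'n \<Rightarrow> real ^ 'n \<Rightarrow> real" where
  "delta_q c \<tau> g H d = - \<tau> * (g \<bullet> d + 1/2 * max (d \<bullet> (H *v d)) 0) + norm1 c"

definition tau_trial ::
    "real \<Rightarrow> real ^ 'm \<Rightarrow> real ^ 'n \<Rightarrow> real ^ 'n ^ 'n \<Rightarrow> real ^ 'n \<Rightarrow> ereal" where
  "tau_trial s c g H d =
     (let q = g \<bullet> d + max (d \<bullet> (H *v d)) 0
      in if q \<le> 0 then \<infinity> else ereal ((1 - s) * norm1 c / q))"

definition tau_update :: "real \<Rightarrow> real \<Rightarrow> ereal \<Rightarrow> real" where
  "tau_update \<epsilon> \<tau> t = (if ereal \<tau> \<le> t then \<tau> else (1 - \<epsilon>) * real_of_ereal t)"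

definition xi_update :: "real \<Rightarrow> real \<Rightarrow> real \<Rightarrow> real" where
  "xi_update \<epsilon> \<xi> t = (if \<xi> \<le> t then \<xi> else (1 - \<epsilon>) * t)"

text \<open>The arguments are \<open>L\<close>, \<open>\<Gamma>\<close>, \<open>\<theta>\<close>, \<open>\<beta>\<^sub>k\<close>, \<open>\<tau>\<^sub>k\<close>, \<open>\<xi>\<^sub>k\<close>, \<open>c\<^sub>k\<close>, the model decrease and \<open>d\<^sub>k\<close>.\<close>

definition step_size ::
    "real \<Rightarrow> real \<Rightarrow> real \<Rightarrow> real \<Rightarrow> real \<Rightarrow> real \<Rightarrow> real ^ 'm \<Rightarrow> real \<Rightarrow> real ^ 'n \<Rightarrow> real" where
  "step_size L \<Gamma> \<theta> \<beta> \<tau> \<xi> c q d =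
     (let hat_init = \<beta> * q / ((\<tau> * L + \<Gamma>) * (norm d)^2);
          tilde_init = hat_init - 4 * norm1 c / ((\<tau> * L + \<Gamma>) * (norm d)^2);
          lo = \<beta> * \<xi> * \<tau> / (\<tau> * L + \<Gamma>);
          I = {lo .. lo + \<theta> * \<beta>^2};
          hat = closest_point I hat_init;
          tilde = closest_point I tilde_init
      in if hat < 1 then hat else if tilde \<le> 1 then 1 else tilde)"

text \<open>Value preceding index \<open>k\<close> of a sequence that starts at index \<open>-1\<close> with value \<open>s0\<close>.\<close>

definition prev :: "real \<Rightarrow> (nat \<Rightarrow> real) \<Rightarrow> nat \<Rightarrow> real" where
  "prev s0 s k = (case k of 0 \<Rightarrow> s0 | Suc j \<Rightarrow> s j)"

definition sqp_run ::
    "('n::finite, 'm::finite) sqp_problem \<Rightarrow> 'n sqp_params \<Rightarrow> nat \<Rightarrow> (nat \<Rightarrow> real) \<Rightarrow>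
     (nat \<Rightarrow> real ^ 'n) \<Rightarrow> (nat \<Rightarrow> real ^ 'n ^ 'n) \<Rightarrow> (nat \<Rightarrow> real ^ 'n) \<Rightarrow> (nat \<Rightarrow> real ^ 'n) \<Rightarrow>
     (nat \<Rightarrow> real ^ 'm) \<Rightarrow> (nat \<Rightarrow> real) \<Rightarrow> (nat \<Rightarrow> real) \<Rightarrow> (nat \<Rightarrow> real) \<Rightarrow> bool" where
  "sqp_run P A kmax \<beta> g H x d y \<tau> \<xi> \<alpha> \<longleftrightarrow>
     x 0 = x_init A \<and>
     (\<forall>k\<le>kmax.
        kkt (H k) (Jac P (x k)) (g k) (con P (x k)) (d k) (y k) \<and>
        (if d k = 0 then
           \<tau> k = prev (tau_init A) \<tau> k \<and> \<xi> k = prev (xi_init A) \<xi> k \<and> \<alpha> k = 1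
         else
           (let c = con P (x k);
                q = delta_q c (\<tau> k) (g k) (H k) (d k)
            in \<tau> k = tau_update (eps_tau A) (prev (tau_init A) \<tau> k)
                        (tau_trial (sig A) c (g k) (H k) (d k)) \<and>
               \<xi> k = xi_update (eps_xi A) (prev (xi_init A) \<xi> k) (q / (\<tau> k * (norm (d k))^2)) \<and>
               \<alpha> k = step_size (lip_obj P) (Gam A) (theta A) (\<beta> k) (\<tau> k) (\<xi> k) c q (d k))) \<and>
        x (Suc k) = x k + \<alpha> k *\<^sub>R d k)"

definition tau_before :: "'n sqp_params \<Rightarrow> ('w, 'n::finite, 'm::finite) sqp_process \<Rightarrow> nat \<Rightarrow> 'w \<Rightarrow> real"
  where "tau_before A R k \<omega> = prev (tau_init A) (\<lambda>j. rTau R j \<omega>) k"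

definition grad_at ::
    "('n::finite, 'm::finite) sqp_problem \<Rightarrow> ('w, 'n, 'm) sqp_process \<Rightarrow> nat \<Rightarrow> 'w \<Rightarrow> real ^ 'n" where
  "grad_at P R k \<omega> = gradient (obj P) (rX R k \<omega>)"

definition tau_trial_true ::
    "('n::finite, 'm::finite) sqp_problem \<Rightarrow> 'n sqp_params \<Rightarrow> ('w, 'n, 'm) sqp_process \<Rightarrow>
     nat \<Rightarrow> 'w \<Rightarrow> ereal" where
  "tau_trial_true P A R k \<omega> =
     tau_trial (sig A) (con P (rX R k \<omega>)) (grad_at P R k \<omega>) (rH R k \<omega>) (rDtrue R k \<omega>)"

text \<open>The sigma-algebra generated by the stochastic gradients with indices below \<open>k\<close>.\<close>

definition hist :: "('w, 'n::finite, 'm::finite) sqp_process \<Rightarrow> nat \<Rightarrow> 'w measure" where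
  "hist R k = vimage_algebra (space (pspace R)) (\<lambda>\<omega>. \<lambda>i\<in>{..<k}. rG R i \<omega>)
                (\<Pi>\<^sub>M i\<in>{..<k}. borel)"

definition event_E ::
    "('n::finite, 'm::finite) sqp_problem \<Rightarrow> 'n sqp_params \<Rightarrow> sqp_consts \<Rightarrow> nat \<Rightarrow> nat \<Rightarrow>
     ('w, 'n, 'm) sqp_process \<Rightarrow> 'w set" where
  "event_E P A C kmax smax R =
     {\<omega> \<in> space (pspace R).
        (\<forall>k\<le>kmax. tau_min C \<le> rTau R k \<omega> \<and> ereal (tau_min C) \<le> tau_trial_true P A R k \<omega> \<and>
                   rXi R k \<omega> = xi_min C) \<and>
        card {k. k \<le> kmax \<and> rTau R k \<omega> < tau_before A R k \<omega>} \<le> smax}"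

definition cond_on ::
    "('n::finite, 'm::finite) sqp_problem \<Rightarrow> 'n sqp_params \<Rightarrow> sqp_consts \<Rightarrow> nat \<Rightarrow> nat \<Rightarrow>
     ('w, 'n, 'm) sqp_process \<Rightarrow> 'w measure" where
  "cond_on P A C kmax smax R = uniform_measure (pspace R) (event_E P A C kmax smax R)"

definition bad_event ::
    "('n::finite, 'm::finite) sqp_problem \<Rightarrow> 'n sqp_params \<Rightarrow> ('w, 'n, 'm) sqp_process \<Rightarrow>
     nat \<Rightarrow> 'w set" where
  "bad_event P A R k =
     {\<omega> \<in> space (pspace R).
        grad_at P R k \<omega> \<bullet> (rD R k \<omega> - rDtrue R k \<omega>) < 0 \<and> rTau R k \<omega> < tau_before A R k \<omega>}"

definition sqp_process_spec ::
    "('n::finite, 'm::finite) sqp_problem \<Rightarrow> 'n sqp_params \<Rightarrow> nat \<Rightarrow> (nat \<Rightarrow> real) \<Rightarrow>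
     ('w, 'n, 'm) sqp_process \<Rightarrow> bool" where
  "sqp_process_spec P A kmax \<beta> R \<longleftrightarrow>
     prob_space (pspace R) \<and>
     (\<forall>k\<le>kmax. 0 < \<beta> k \<and> \<beta> k \<le> 1) \<and>
     (\<forall>k\<le>kmax. rG R k \<in> borel_measurable (pspace R)) \<and>
     (\<forall>\<omega>\<in>space (pspace R).
        sqp_run P A kmax \<beta> (\<lambda>k. rG R k \<omega>) (\<lambda>k. rH R k \<omega>) (\<lambda>k. rX R k \<omega>) (\<lambda>k. rD R k \<omega>)
          (\<lambda>k. rY R k \<omega>) (\<lambda>k. rTau R k \<omega>) (\<lambda>k. rXi R k \<omega>) (\<lambda>k. rAlpha R k \<omega>) \<and>
        (\<forall>k\<le>kmax. kkt (rH R k \<omega>) (Jac P (rX R k \<omega>)) (grad_at P R k \<omega>) (con P (rX R k \<omega>))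
                      (rDtrue R k \<omega>) (rYtrue R k \<omega>)))"

text \<open>The returned index is uniform on \<open>{..kmax}\<close> and independent of the stochastic gradients,
  hence of the whole run.\<close>

definition uniform_index :: "nat \<Rightarrow> ('w, 'n::finite, 'm::finite) sqp_process \<Rightarrow> bool" where
  "uniform_index kmax R \<longleftrightarrow>
     rKstar R \<in> measurable (pspace R) (count_space UNIV) \<and>
     distr (pspace R) (count_space UNIV) (rKstar R) = measure_pmf (pmf_of_set {..kmax}) \<and>
     prob_space.indep_set (pspace R) (sets (hist R (Suc kmax)))
       (sets (vimage_algebra (space (pspace R)) (rKstar R) (count_space UNIV)))"

text \<open>Every iterate produced, \<open>X\<close> with index \<open>Suc kmax\<close> included, lies in the region.\<close>

definition A1_run ::
    "('n::finite, 'm::finite) sqp_problem \<Rightarrow> sqp_consts \<Rightarrow> nat \<Rightarrow> ('w, 'n, 'm) sqp_process \<Rightarrow> bool"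
  where
  "A1_run P C kmax R \<longleftrightarrow>
     (\<forall>\<omega>\<in>space (pspace R).
        (\<forall>k\<le>Suc kmax. rX R k \<omega> \<in> region P) \<and>
        (\<forall>k\<le>kmax. norm (grad_at P R k \<omega>) \<le> kap_g C))"

text \<open>Since the iterate with index \<open>k + 1\<close> is determined by the first \<open>k + 1\<close> stochastic
  gradients, a matrix \<open>H\<^sub>k\<close> chosen independently from \<open>g\<^sub>k\<close> is a function of the first \<open>k\<close> of them.\<close>

definition A2 :: "('n::finite, 'm::finite) sqp_problem \<Rightarrow> sqp_consts \<Rightarrow> nat \<Rightarrow>
    ('w, 'n, 'm) sqp_process \<Rightarrow> bool" where
  "A2 P C kmax R \<longleftrightarrow>
     (\<forall>k\<le>kmax.
        rH R k \<in> borel_measurable (hist R k) \<and>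
        (\<forall>\<omega>\<in>space (pspace R).
           transpose (rH R k \<omega>) = rH R k \<omega> \<and> mat_norm (rH R k \<omega>) \<le> kap_H C \<and>
           (\<forall>u. Jac P (rX R k \<omega>) *v u = 0 \<longrightarrow> zeta_c C * (norm u)^2 \<le> u \<bullet> (rH R k \<omega> *v u))))"

text \<open>Statements for all realizations of the first \<open>k\<close> stochastic gradients are statements about
  (almost every value of) the conditional expectation with respect to \<open>hist R k\<close>. The expectation
  conditioned additionally on \<open>bad_event\<close> is the quotient in the last clause.\<close>

definition A3 :: "('n::finite, 'm::finite) sqp_problem \<Rightarrow> 'n sqp_params \<Rightarrow> sqp_consts \<Rightarrow> nat \<Rightarrow> nat \<Rightarrow>
    ('w, 'n, 'm) sqp_process \<Rightarrow> bool" where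
  "A3 P A C kmax smax R \<longleftrightarrow>
     (let ME = cond_on P A C kmax smax R;
          err = (\<lambda>k \<omega>. norm (rG R k \<omega> - grad_at P R k \<omega>))
      in \<forall>k\<le>kmax. AE \<omega> in ME.
        (\<forall>i. real_cond_exp ME (hist R k) (\<lambda>\<omega>. rG R k \<omega> $ i) \<omega> = grad_at P R k \<omega> $ i) \<and>
        nn_cond_exp ME (hist R k) (\<lambda>\<omega>. ennreal ((err k \<omega>)^2)) \<omega> \<le> ennreal (M_var C) \<and>
        (let p = nn_cond_exp ME (hist R k) (indicator (bad_event P A R k)) \<omega>
         in p = 0 \<or>
            nn_cond_exp ME (hist R k)
              (\<lambda>\<omega>. ennreal (err k \<omega>) * indicator (bad_event P A R k) \<omega>) \<omega> / p
              \<le> ennreal (M_tau C)))"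

definition A4 :: "('n::finite, 'm::finite) sqp_problem \<Rightarrow> 'n sqp_params \<Rightarrow> sqp_consts \<Rightarrow> nat \<Rightarrow> nat \<Rightarrow>
    ('w, 'n, 'm) sqp_process \<Rightarrow> bool" where
  "A4 P A C kmax smax R \<longleftrightarrow>
     (let ME = cond_on P A C kmax smax R;
          q = (\<lambda>k \<omega> g d. g \<bullet> d + max (d \<bullet> (rH R k \<omega> *v d)) 0)
      in \<forall>k\<le>kmax. AE \<omega> in ME.
        ennreal (p_tau C) \<le>
          nn_cond_exp ME (hist R k)
            (indicator {\<omega> \<in> space (pspace R).
               q k \<omega> (grad_at P R k \<omega>) (rDtrue R k \<omega>) \<le> q k \<omega> (rG R k \<omega>) (rD R k \<omega>)}) \<omega>)"

definition Psi :: "real \<Rightarrow> real ^ 'n \<Rightarrow> real ^ 'n \<Rightarrow> real ^ 'm \<Rightarrow> real" where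
  "Psi \<kappa> u v c = (if (norm u)^2 \<ge> \<kappa> * (norm v)^2 then (norm u)^2 + norm c else norm c)"

text \<open>The properties of the constants \<open>\<kappa>\<^sub>d\<close>, \<open>\<kappa>\<^sub>u\<^sub>v\<close>, \<open>\<kappa>\<^sub>\<Psi>\<close> and \<open>\<kappa>\<^sub>q\<close>. The vectors \<open>u\<close> and \<open>v\<close> are the
  components of the true direction in the null space of the Jacobian and the range of its transpose.\<close>

definition kappa_spec ::
    "('n::finite, 'm::finite) sqp_problem \<Rightarrow> 'n sqp_params \<Rightarrow> sqp_consts \<Rightarrow> nat \<Rightarrow>
     ('w, 'n, 'm) sqp_process \<Rightarrow> bool" where
  "kappa_spec P A C kmax R \<longleftrightarrow>
     (\<forall>k\<le>kmax. \<forall>\<omega>\<in>space (pspace R).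
        (let c = con P (rX R k \<omega>); J = Jac P (rX R k \<omega>); H = rH R k \<omega>;
             gf = grad_at P R k \<omega>; d = rDtrue R k \<omega>
         in norm d \<le> kap_d C * norm gf \<and>
            norm (rD R k \<omega> - d) \<le> kap_d C * norm (rG R k \<omega> - gf) \<and>
            (\<forall>u v. d = u + v \<and> J *v u = 0 \<and> v \<in> range (\<lambda>w. transpose J *v w) \<longrightarrow>
               ((norm u)^2 \<ge> kap_uv C * (norm v)^2 \<longrightarrow>
                  1/2 * (d \<bullet> (H *v d)) \<ge> 1/4 * zeta_c C * (norm u)^2) \<and>
               (norm d)^2 + norm1 c \<le> (kap_Psi C + 1) * Psi (kap_uv C) u v c \<and>
               (\<forall>\<tau>>0. ereal \<tau> \<le> tau_trial_true P A R k \<omega> \<longrightarrow>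
                  delta_q c \<tau> gf H d \<ge> kap_q C * \<tau> * Psi (kap_uv C) u v c))))"

text \<open>Everything assumed about a run. Positivity of the probability makes conditioning on the
  event meaningful.\<close>

definition sqp_setting ::
    "('n::finite, 'm::finite) sqp_problem \<Rightarrow> 'n sqp_params \<Rightarrow> sqp_consts \<Rightarrow> nat \<Rightarrow> nat \<Rightarrow>
     (nat \<Rightarrow> real) \<Rightarrow> ('w, 'n, 'm) sqp_process \<Rightarrow> bool" where
  "sqp_setting P A C kmax smax \<beta> R \<longleftrightarrow>
     sqp_process_spec P A kmax \<beta> R \<and> uniform_index kmax R \<and>
     A1_run P C kmax R \<and> A2 P C kmax R \<and> A3 P A C kmax smax R \<and> A4 P A C kmax smax R \<and>
     kappa_spec P A C kmax R \<and>
     0 < measure (pspace R) (event_E P A C kmax smax R)"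

text \<open>On the event, the left end of the interval onto which trial step sizes are projected does
  not exceed the unit step. Without this the iterates can diverge: with one variable,
  \<open>c x = x\<close>, \<open>H\<^sub>k = 1\<close>, \<open>\<theta> = 0\<close> and left end \<open>3\<close>, every step gives \<open>x\<^sub>k\<^sub>+\<^sub>1 = - 2 * x\<^sub>k\<close>.\<close>

definition unit_step_interval ::
    "('n::finite, 'm::finite) sqp_problem \<Rightarrow> 'n sqp_params \<Rightarrow> sqp_consts \<Rightarrow> nat \<Rightarrow> nat \<Rightarrow>
     (nat \<Rightarrow> real) \<Rightarrow> ('w, 'n, 'm) sqp_process \<Rightarrow> bool" where
  "unit_step_interval P A C kmax smax \<beta> R \<longleftrightarrow>
     (\<forall>\<omega>\<in>event_E P A C kmax smax R. \<forall>k\<le>kmax.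
        \<beta> k * rXi R k \<omega> * rTau R k \<omega> / (rTau R k \<omega> * lip_obj P + Gam A) \<le> 1)"

definition A_min :: "('n::finite, 'm::finite) sqp_problem \<Rightarrow> 'n sqp_params \<Rightarrow> sqp_consts \<Rightarrow> real" where
  "A_min P A C = xi_min C * tau_min C / (tau_min C * lip_obj P + Gam A)"

definition A_max :: "('n::finite, 'm::finite) sqp_problem \<Rightarrow> 'n sqp_params \<Rightarrow> real" where
  "A_max P A = xi_init A * tau_init A / (tau_init A * lip_obj P + Gam A)"

definition M_bar ::
    "('n::finite, 'm::finite) sqp_problem \<Rightarrow> 'n sqp_params \<Rightarrow> sqp_consts \<Rightarrow> real \<Rightarrow> real" where
  "M_bar P A C b =
     1/4 * (A_max P A + theta A * b) * (tau_init A + tau_min C) * inverse (zeta_c C) * M_var C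
     + 1/2 * (A_max P A + theta A * b) * (tau_init A - tau_min C) *
         (kap_d C * sqrt (M_var C) * (2 * kap_g C + sqrt (M_var C))
          + kap_H C * (kap_d C)^2 * (M_var C + 3/2 * (kap_g C)^2))
     + theta A * tau_init A * kap_g C * kap_d C * sqrt (M_var C)"

definition kap_E3 ::
    "('n::finite, 'm::finite) sqp_problem \<Rightarrow> 'n sqp_params \<Rightarrow> sqp_consts \<Rightarrow> real \<Rightarrow> real" where
  "kap_E3 P A C b =
     ((A_max P A + theta A * b) * tau_init A - A_min P A C * tau_min C)
     * kap_g C * kap_d C * M_tau C"

definition kap_dq1 ::
    "('n::finite, 'm::finite) sqp_problem \<Rightarrow> 'n sqp_params \<Rightarrow> sqp_consts \<Rightarrow> real \<Rightarrow> real" where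
  "kap_dq1 P A C b =
     ((A_max P A + theta A * b) * tau_init A - A_min P A C * tau_min C)
     * kap_d C * (kap_g C)^2 * (1 + 1/2 * kap_H C * kap_d C)"

definition kap_dq2 ::
    "('n::finite, 'm::finite) sqp_problem \<Rightarrow> 'n sqp_params \<Rightarrow> sqp_consts \<Rightarrow> real \<Rightarrow> real" where
  "kap_dq2 P A C b =
     ((A_max P A + theta A * b) * tau_init A - A_min P A C * tau_min C)
     * kap_d C * (1 + 1/2 * kap_H C * kap_d C) * (M_var C + (kap_g C)^2)"

text \<open>Truncated subtraction gives \<open>smax - 1 = max {smax - 1, 0}\<close>.\<close>

definition delta_hat :: "nat \<Rightarrow> nat \<Rightarrow> real \<Rightarrow> real" where
  "delta_hat kmax smax \<delta> = \<delta> / (\<Sum>j=0..smax - 1. real (kmax choose j))"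

definition ell :: "nat \<Rightarrow> real \<Rightarrow> real" where
  "ell s \<delta> = real s + ln (1/\<delta>) + sqrt ((ln (1/\<delta>))^2 + 2 * real s * ln (1/\<delta>))"

text \<open>\<open>cond_mean P A C kmax smax R Z\<close> is the expectation, conditioned on the event, of \<open>Z\<close>
  evaluated at the returned index; conditioning on an event yields a number.\<close>

definition cond_mean ::
    "('n::finite, 'm::finite) sqp_problem \<Rightarrow> 'n sqp_params \<Rightarrow> sqp_consts \<Rightarrow> nat \<Rightarrow> nat \<Rightarrow>
     ('w, 'n, 'm) sqp_process \<Rightarrow> (nat \<Rightarrow> 'w \<Rightarrow> real) \<Rightarrow> real" where
  "cond_mean P A C kmax smax R Z = (\<integral>\<omega>. Z (rKstar R \<omega>) \<omega> \<partial>(cond_on P A C kmax smax R))"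

definition stationarity ::
    "('n::finite, 'm::finite) sqp_problem \<Rightarrow> ('w, 'n, 'm) sqp_process \<Rightarrow> nat \<Rightarrow> 'w \<Rightarrow> real" where
  "stationarity P R k \<omega> =
     norm (grad_at P R k \<omega> + transpose (Jac P (rX R k \<omega>)) *v rYtrue R k \<omega>)"

definition infeasibility ::
    "('n::finite, 'm::finite) sqp_problem \<Rightarrow> ('w, 'n, 'm) sqp_process \<Rightarrow> nat \<Rightarrow> 'w \<Rightarrow> real" where
  "infeasibility P R k \<omega> = norm1 (con P (rX R k \<omega>))"

end

theory Submission
  imports Defs
begin

text \<open>
  The conditional mean on the left-hand side is a number, so each of the two bounds has to be
  shown outright, for every \<open>\<delta>\<close>. On the event, smoothness gives a decrease of the merit function
  \<open>\<tau> f + \<parallel>c\<parallel>\<^sub>1\<close> in each step, up to three errors. The sampling error enters to first order only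
  through its inner product with a vector determined by the past, which has conditional mean
  zero, and otherwise at order \<open>\<beta>\<^sup>2\<close>. A decrease of the merit parameter together with a descent
  error costs a term of order \<open>\<beta>\<close>. So does an iteration whose merit parameter exceeds the true
  trial value, and the parameter then decreases with conditional probability at least \<open>p_tau\<close>.
  Summing over the iterations and taking expectations, the number of costly iterations is
  controlled by the expected number of decreases of the merit parameter, which on the event
  is at most \<open>smax\<close> (and zero if \<open>tau_init = tau_min\<close>); no concentration inequality is needed.
  In the second bound, which does not assume that unit steps are admissible, the first bound
  applies for all large \<open>kmax\<close>, and boundedness of the stationarity measure covers the others.
\<close>

subsection \<open>Smoothness\<close>

text \<open>The obstacle is that the step size and the merit parameter of iteration \<open>k\<close>
  depend on the sample \<open>G k\<close>, so their product with \<open>g \<bullet> (D - d)\<close>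
  need not have mean zero. The remedy is to replace random coefficients by ones known before the
  sample. In the first-order term these are \<open>A_fun (\<tau>' k)\<close> and
  \<open>\<tau>' k\<close>; the exchange costs order \<open>b\<close> only if the parameter drops
  while that inner product is negative, which gives \<open>kap_E3\<close>. In the sampled model
  decrease the merit parameter is replaced by the midpoint of \<open>tau_min\<close> and
  \<open>tau_init\<close>. This splits \<open>M_bar\<close> into a part with
  \<open>tau_init + tau_min\<close>, where symmetry of the linear system leaves only a quadratic
  error over \<open>zeta_c\<close>, and a part with \<open>tau_init - tau_min\<close>, where a crude
  bound suffices. If the merit parameter is too large, the comparison is with \<open>tau_min\<close>
  instead, for which the event guarantees a decrease; \<open>kap_dq1\<close> and
  \<open>kap_dq2\<close> price the difference. The hypothesis on \<open>\<gamma>\<close> makes the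
  sampled decrease consume at most half of the true one, whence the factor 2 in the bounds.\<close>

lemma gradient_has_derivative:
  assumes "f differentiable (at x)"
  shows "(f has_derivative (\<lambda>h. h \<bullet> gradient f x)) (at x)"
proof -
  obtain f' where f': "(f has_derivative f') (at x)"
    using assms unfolding differentiable_def by blast
  interpret f': bounded_linear f' using f' by (rule has_derivative_bounded_linear)
  have f'_eq: "f' = (\<lambda>h. h \<bullet> (\<Sum>b\<in>Basis. f' b *\<^sub>R b))"
  proof
    fix h
    have "f' h = f' (\<Sum>b\<in>Basis. (h \<bullet> b) *\<^sub>R b)" by (simp add: euclidean_representation)
    also have "\<dots> = h \<bullet> (\<Sum>b\<in>Basis. f' b *\<^sub>R b)"
      by (simp add: f'.sum f'.scaleR inner_sum_right mult.commute)
    finally show "f' h = \<dots>" .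
  qed
  then have ex: "GDERIV f x :> (\<Sum>b\<in>Basis. f' b *\<^sub>R b)"
    using f' by (simp add: gderiv_def)
  \<comment> \<open>\<open>gradient\<close> is a definite description, so besides the Riesz vector
    just found, uniqueness is required before it denotes anything.\<close>
  have unique: "g = g'" if "GDERIV f x :> g" "GDERIV f x :> g'" for g g'
  proof -
    have "(\<lambda>h. h \<bullet> g) = (\<lambda>h. h \<bullet> g')"
      using has_derivative_unique that unfolding gderiv_def by blast
    then have "(g - g') \<bullet> g = (g - g') \<bullet> g'" by metis
    then have "(g - g') \<bullet> (g - g') = 0" by (simp add: inner_diff_right)
    then show ?thesis by simp
  qed
  have "GDERIV f x :> gradient f x"
    unfolding gradient_def by (rule theI'[where P = "\<lambda>g. GDERIV f x :> g"]) (use unique ex in blast)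
  then show ?thesis by (simp add: gderiv_def)
qed

text \<open>The descent lemma. Instead of integrating along the segment, the gap
  \<open>\<phi>\<close> between the two sides is shown to have nonpositive derivative on the unit
  interval.\<close>

lemma lipschitz_gradient_upper_bound:
  assumes "convex S" "x \<in> S" "y \<in> S"
    and diff: "\<And>z. z \<in> S \<Longrightarrow> f differentiable (at z)"
    and lip: "L-lipschitz_on S (gradient f)"
  shows "f y \<le> f x + (y - x) \<bullet> gradient f x + L / 2 * (norm (y - x))\<^sup>2"
proof -
  define v where "v = y - x"
  have in_S: "x + t *\<^sub>R v \<in> S" if "0 \<le> t" "t \<le> 1" for t
    using convexD_alt[OF assms(1-3) that] by (simp add: v_def algebra_simps)
  define \<phi> where "\<phi> t = f (x + t *\<^sub>R v) - t * (v \<bullet> gradient f x) - L / 2 * (norm v)\<^sup>2 * t\<^sup>2" for t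
  have "\<phi> 1 \<le> \<phi> 0"
  proof (rule DERIV_nonpos_imp_nonincreasing[where f = \<phi> and a = 0 and b = 1])
    fix t :: real assume t: "0 \<le> t" "t \<le> 1"
    have "((\<lambda>t. f (x + t *\<^sub>R v)) has_derivative (\<lambda>s. (s *\<^sub>R v) \<bullet> gradient f (x + t *\<^sub>R v))) (at t)"
      by (rule has_derivative_compose[of "\<lambda>t. x + t *\<^sub>R v" "\<lambda>s. s *\<^sub>R v",
            OF _ gradient_has_derivative[OF diff[OF in_S[OF t]]]])
        (auto intro!: derivative_eq_intros)
    moreover have "(\<lambda>s. (s *\<^sub>R v) \<bullet> gradient f (x + t *\<^sub>R v)) = (*) (v \<bullet> gradient f (x + t *\<^sub>R v))"
      by (simp add: fun_eq_iff)
    ultimately have *: "((\<lambda>t. f (x + t *\<^sub>R v)) has_field_derivative (v \<bullet> gradient f (x + t *\<^sub>R v))) (at t)"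
      unfolding has_field_derivative_def by metis
    have deriv: "(\<phi> has_field_derivative (v \<bullet> gradient f (x + t *\<^sub>R v)) - v \<bullet> gradient f x
        - L / 2 * (norm v)\<^sup>2 * (2 * t)) (at t)"
      unfolding \<phi>_def by (rule derivative_eq_intros * | simp)+
    have "v \<bullet> gradient f (x + t *\<^sub>R v) - v \<bullet> gradient f x
        \<le> norm v * norm (gradient f (x + t *\<^sub>R v) - gradient f x)"
      by (metis inner_diff_right norm_cauchy_schwarz)
    also have "\<dots> \<le> norm v * (L * norm (t *\<^sub>R v))"
      using lipschitz_onD[OF lip in_S[OF t] \<open>x \<in> S\<close>]
      by (intro mult_left_mono) (auto simp: dist_norm)
    also have "\<dots> = L / 2 * (norm v)\<^sup>2 * (2 * t)"
      using t by (simp add: power2_eq_square)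
    finally have "v \<bullet> gradient f (x + t *\<^sub>R v) - v \<bullet> gradient f x
        - L / 2 * (norm v)\<^sup>2 * (2 * t) \<le> 0" by simp
    with deriv show "\<exists>y. DERIV \<phi> t :> y \<and> y \<le> 0" by blast
  qed (rule zero_le_one)
  then show ?thesis by (simp add: \<phi>_def v_def)
qed

text \<open>The one-sided bound applied to \<open>f\<close> and to \<open>- f\<close>. Both sides
  are needed for the constraints, whose absolute values enter the merit function.\<close>

lemma lipschitz_gradient_bound:
  assumes "convex S" "x \<in> S" "y \<in> S"
    and diff: "\<And>z. z \<in> S \<Longrightarrow> f differentiable (at z)"
    and lip: "L-lipschitz_on S (gradient f)"
  shows "\<bar>f y - f x - (y - x) \<bullet> gradient f x\<bar> \<le> L / 2 * (norm (y - x))\<^sup>2"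
proof -
  have grad_minus: "gradient (\<lambda>x. - f x) z = - gradient f z" if "z \<in> S" for z
  proof -
    have d: "(\<lambda>x. - f x) differentiable (at z)"
      using diff[OF that] by (rule differentiable_minus)
    have "((\<lambda>x. - f x) has_derivative (\<lambda>h. - (h \<bullet> gradient f z))) (at z)"
      using gradient_has_derivative[OF diff[OF that]] by (rule has_derivative_minus)
    from fun_cong[OF has_derivative_unique[OF this gradient_has_derivative[OF d]]]
    have "h \<bullet> (gradient (\<lambda>x. - f x) z + gradient f z) = 0" for h
      unfolding inner_add_right by (metis add.right_inverse add.commute)
    then have "gradient (\<lambda>x. - f x) z + gradient f z = 0"
      using inner_eq_zero_iff by blast
    then show ?thesis by (simp add: add_eq_0_iff)
  qed
  have "L-lipschitz_on S (gradient (\<lambda>x. - f x))"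
    using lip by (auto simp: lipschitz_on_def grad_minus dist_minus)
  then have "- f y \<le> - f x + (y - x) \<bullet> gradient (\<lambda>x. - f x) x + L / 2 * (norm (y - x))\<^sup>2"
    using assms(1-3) diff
    by (intro lipschitz_gradient_upper_bound[where f = "\<lambda>x. - f x"])
      (auto intro: differentiable_minus)
  moreover have "f y \<le> f x + (y - x) \<bullet> gradient f x + L / 2 * (norm (y - x))\<^sup>2"
    by (rule lipschitz_gradient_upper_bound[OF assms])
  ultimately show ?thesis using grad_minus[OF \<open>x \<in> S\<close>] by (simp only: inner_minus_right abs_le_iff) linarith
qed

lemma smooth_problemD:
  assumes "smooth_problem P"
  shows "open (region P)" "convex (region P)"
    and "x \<in> region P \<Longrightarrow> obj P differentiable (at x)"
    and "x \<in> region P \<Longrightarrow> con P differentiable (at x)"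
    and "continuous_on (region P) (gradient (obj P))"
    and "x \<in> region P \<Longrightarrow> f_low P \<le> obj P x"
    and "0 < lip_obj P" "(lip_obj P)-lipschitz_on (region P) (gradient (obj P))"
    and "bounded (con P ` region P)"
    and "0 < lip_con P i"
    and "(lip_con P i)-lipschitz_on (region P) (gradient (\<lambda>x. con P x $ i))"
  using assms unfolding smooth_problem_def by auto

text \<open>The Lipschitz hypotheses speak of gradients of single constraints, the algorithm of the
  Jacobian matrix; this is the dictionary between the two.\<close>

lemma con_component:
  assumes "smooth_problem P" "x \<in> region P"
  shows "(\<lambda>x. con P x $ i) differentiable (at x)"
    and "row i (Jac P x) = gradient (\<lambda>x. con P x $ i) x"
    and "h \<bullet> gradient (\<lambda>x. con P x $ i) x = (Jac P x *v h) $ i"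
proof -
  have "(con P has_derivative (\<lambda>h. Jac P x *v h)) (at x)"
    using smooth_problemD(4)[OF assms] by (simp add: Jac_def jacobian_works)
  then have *: "((\<lambda>x. con P x $ i) has_derivative (\<lambda>h. (Jac P x *v h) $ i)) (at x)"
    by (rule bounded_linear.has_derivative[OF bounded_linear_vec_nth])
  then show d: "(\<lambda>x. con P x $ i) differentiable (at x)"
    unfolding differentiable_def by blast
  have eq: "(\<lambda>h. h \<bullet> gradient (\<lambda>x. con P x $ i) x) = (\<lambda>h. (Jac P x *v h) $ i)"
    using has_derivative_unique[OF gradient_has_derivative[OF d] *] .
  then show "h \<bullet> gradient (\<lambda>x. con P x $ i) x = (Jac P x *v h) $ i" by (rule fun_cong)
  have "h \<bullet> (gradient (\<lambda>x. con P x $ i) x - row i (Jac P x)) = 0" for h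
    using fun_cong[OF eq, of h]
    by (simp add: matrix_vector_mul_component inner_diff_right inner_commute row_def)
  then have "gradient (\<lambda>x. con P x $ i) x - row i (Jac P x) = 0"
    using inner_eq_zero_iff by blast
  then show "row i (Jac P x) = gradient (\<lambda>x. con P x $ i) x" by simp
qed

lemma norm1_nonneg: "0 \<le> norm1 v"
  by (simp add: norm1_def sum_nonneg)

text \<open>Each row is a Lipschitz gradient. Continuity serves the measurability of the Jacobian at
  random iterates.\<close>

lemma continuous_on_Jac:
  assumes "smooth_problem P"
  shows "continuous_on (region P) (Jac P)"
proof -
  have "continuous_on (region P) (\<lambda>x. \<chi> i. gradient (\<lambda>x. con P x $ i) x)"
    using smooth_problemD(11)[OF assms]
    by (intro continuous_on_vec_lambda lipschitz_on_continuous_on)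
  moreover have "(\<chi> i. gradient (\<lambda>x. con P x $ i) x) = Jac P x" if "x \<in> region P" for x
    using con_component(2)[OF assms that] by (simp add: vec_eq_iff row_def)
  ultimately show ?thesis by (simp cong: continuous_on_cong)
qed

lemma merit_upper_bound:
  fixes P :: "('n::finite, 'm::finite) sqp_problem"
  assumes P: "smooth_problem P" and x: "x \<in> region P" and y: "x + \<alpha> *\<^sub>R d \<in> region P"
    and \<tau>: "0 \<le> \<tau>" and \<Gamma>: "(\<Sum>i\<in>UNIV. lip_con P i) \<le> \<Gamma>"
    and Jd: "Jac P x *v d = - con P x"
  shows "\<tau> * obj P (x + \<alpha> *\<^sub>R d) + norm1 (con P (x + \<alpha> *\<^sub>R d))
    \<le> \<tau> * obj P x + \<tau> * \<alpha> * (gradient (obj P) x \<bullet> d) + \<bar>1 - \<alpha>\<bar> * norm1 (con P x)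
      + (\<tau> * lip_obj P + \<Gamma>) / 2 * (\<alpha>\<^sup>2 * (norm d)\<^sup>2)"
proof -
  let ?y = "x + \<alpha> *\<^sub>R d"
  note D = smooth_problemD[OF P]
  have "obj P ?y \<le> obj P x + (?y - x) \<bullet> gradient (obj P) x + lip_obj P / 2 * (norm (?y - x))\<^sup>2"
    by (rule lipschitz_gradient_upper_bound[OF D(2) x y D(3) D(8)])
  then have "\<tau> * obj P ?y \<le> \<tau> * (obj P x + \<alpha> * (gradient (obj P) x \<bullet> d)
      + lip_obj P / 2 * (\<alpha>\<^sup>2 * (norm d)\<^sup>2))"
    using \<tau> by (intro mult_left_mono) (auto simp: inner_commute power_mult_distrib)
  moreover have "norm1 (con P ?y) \<le> \<bar>1 - \<alpha>\<bar> * norm1 (con P x) + \<Gamma> / 2 * (\<alpha>\<^sup>2 * (norm d)\<^sup>2)"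
  proof -
    have "\<bar>con P ?y $ i\<bar> \<le> \<bar>1 - \<alpha>\<bar> * \<bar>con P x $ i\<bar> + lip_con P i * (\<alpha>\<^sup>2 * (norm d)\<^sup>2 / 2)" for i
    proof -
      have "\<bar>con P ?y $ i - con P x $ i - (?y - x) \<bullet> gradient (\<lambda>x. con P x $ i) x\<bar>
          \<le> lip_con P i / 2 * (norm (?y - x))\<^sup>2"
        by (rule lipschitz_gradient_bound[OF D(2) x y con_component(1)[OF P] D(11)])
      \<comment> \<open>The direction solves the linearised constraint, so the linear model of each
        constraint at the new point is \<open>1 - \<alpha>\<close> times its old value.\<close>
      moreover have "(?y - x) \<bullet> gradient (\<lambda>x. con P x $ i) x = - \<alpha> * con P x $ i"
        using con_component(3)[OF P x, where h = d] Jd by simp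
      ultimately have "\<bar>con P ?y $ i - (1 - \<alpha>) * con P x $ i\<bar>
          \<le> lip_con P i * (\<alpha>\<^sup>2 * (norm d)\<^sup>2 / 2)"
        by (simp add: power_mult_distrib algebra_simps)
      then show ?thesis
        unfolding abs_mult[symmetric] by linarith
    qed
    then have "norm1 (con P ?y) \<le>
        (\<Sum>i\<in>UNIV. \<bar>1 - \<alpha>\<bar> * \<bar>con P x $ i\<bar> + lip_con P i * (\<alpha>\<^sup>2 * (norm d)\<^sup>2 / 2))"
      unfolding norm1_def by (intro sum_mono)
    also have "\<dots> = \<bar>1 - \<alpha>\<bar> * norm1 (con P x)
        + (\<Sum>i\<in>UNIV. lip_con P i) * (\<alpha>\<^sup>2 * (norm d)\<^sup>2 / 2)"
      by (simp add: norm1_def sum.distrib sum_distrib_left sum_distrib_right)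
    also have "\<dots> \<le> \<bar>1 - \<alpha>\<bar> * norm1 (con P x) + \<Gamma> * (\<alpha>\<^sup>2 * (norm d)\<^sup>2 / 2)"
      using \<Gamma> by (intro add_left_mono mult_right_mono) auto
    finally show ?thesis by simp
  qed
  ultimately show ?thesis unfolding distrib_left distrib_right add_divide_distrib by (simp add: mult.assoc)
qed

subsection \<open>The linear system\<close>

text \<open>A nonzero kernel vector would make \<open>0\<close> a singular value of the Jacobian,
  against their positive lower bound.\<close>

lemma transpose_Jac_eq_0D:
  fixes P :: "('n::finite, 'm::finite) sqp_problem"
  assumes "smooth_problem P" "x \<in> region P" "transpose (Jac P x) *v y = 0"
  shows "y = 0"
proof (rule ccontr)
  assume "y \<noteq> 0"
  obtain s where s: "s > 0" "\<And>t. t \<in> singular_values (Jac P x) \<Longrightarrow> s \<le> t"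
    using assms(1,2) unfolding smooth_problem_def by blast
  have "(Jac P x ** transpose (Jac P x)) *v y = 0 *\<^sub>R y"
    using assms(3) by (simp flip: matrix_vector_mul_assoc)
  with \<open>y \<noteq> 0\<close> have "sqrt 0 \<in> singular_values (Jac P x)"
    unfolding singular_values_def by blast
  with s show False by fastforce
qed

text \<open>The range part is the orthogonal projection, the transpose of \<open>J\<close> times the
  inverse of \<open>J ** transpose J\<close> times \<open>J\<close>. Existence matters because
  \<open>kappa_spec\<close> speaks about all such splittings and says nothing if there is
  none.\<close>

lemma null_range_decomposition:
  fixes J :: "real ^ 'n::finite ^ 'm::finite"
  assumes inj: "\<And>y. transpose J *v y = 0 \<Longrightarrow> y = 0"
  obtains u v where "d = u + v" "J *v u = 0" "v \<in> range (\<lambda>w. transpose J *v w)"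
proof -
  have "y = 0" if "(J ** transpose J) *v y = 0" for y
  proof -
    have "(transpose J *v y) \<bullet> (transpose J *v y) = y \<bullet> (J *v (transpose J *v y))"
      by (simp add: dot_lmul_matrix flip: vector_transpose_matrix)
    then show ?thesis
      using that inj[of y] by (simp only: matrix_vector_mul_assoc inner_zero_right inner_eq_zero_iff)
  qed
  then have "\<exists>B. B ** (J ** transpose J) = mat 1"
    by (simp add: matrix_left_invertible_ker)
  then obtain B where "(J ** transpose J) ** B = mat 1"
    using matrix_left_right_inverse by blast
  then have *: "J *v (transpose J *v (B *v (J *v d))) = J *v d"
    by (simp add: matrix_vector_mul_assoc matrix_mul_assoc)
  show thesis
    by (rule that[of "d - transpose J *v (B *v (J *v d))" "transpose J *v (B *v (J *v d))"])
      (auto simp: matrix_vector_mult_diff_distrib * simp del: transpose_matrix_vector)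
qed

text \<open>The standard conditions for a nonsingular saddle-point system: curvature on the null
  space and full row rank. The value of \<open>\<zeta>\<close> is kept because it reappears in the
  error bounds.\<close>

definition pos_def_on_null :: "real \<Rightarrow> real ^ 'n ^ 'n \<Rightarrow> real ^ 'n ^ 'm \<Rightarrow> bool" where
  "pos_def_on_null \<zeta> H J \<longleftrightarrow> 0 < \<zeta> \<and> transpose H = H \<and>
     (\<forall>u. J *v u = 0 \<longrightarrow> \<zeta> * (norm u)\<^sup>2 \<le> u \<bullet> (H *v u)) \<and> (\<forall>y. transpose J *v y = 0 \<longrightarrow> y = 0)"

text \<open>The block system is written as one square matrix over the sum of the index types, so
  that determinants and Cramer's rule apply to it.\<close>

definition kkt_mat :: "real ^ 'n ^ 'n \<Rightarrow> real ^ 'n ^ 'm \<Rightarrow> real ^ ('n + 'm) ^ ('n + 'm)" where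
  "kkt_mat H J = (\<chi> i j. case i of
     Inl a \<Rightarrow> (case j of Inl b \<Rightarrow> H $ a $ b | Inr b \<Rightarrow> J $ b $ a)
   | Inr a \<Rightarrow> (case j of Inl b \<Rightarrow> J $ a $ b | Inr b \<Rightarrow> 0))"

definition kkt_rhs :: "real ^ 'n \<Rightarrow> real ^ 'm \<Rightarrow> real ^ ('n + 'm)" where
  "kkt_rhs g c = (\<chi> i. case i of Inl a \<Rightarrow> - g $ a | Inr a \<Rightarrow> - c $ a)"

text \<open>Cramer's rule. An explicit quotient of determinants makes the solution a measurable
  function of the data, while the process merely states that its directions solve the
  system.\<close>

definition kkt_sol :: "real ^ 'n ^ 'n \<Rightarrow> real ^ 'n ^ 'm \<Rightarrow> real ^ 'n \<Rightarrow> real ^ 'm \<Rightarrow> real ^ ('n + 'm)" where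
  "kkt_sol H J g c = (\<chi> k. det (\<chi> i j. if j = k then kkt_rhs g c $ i else kkt_mat H J $ i $ j)
     / det (kkt_mat H J))"

definition kkt_dir :: "real ^ 'n ^ 'n \<Rightarrow> real ^ 'n ^ 'm \<Rightarrow> real ^ 'n \<Rightarrow> real ^ 'm \<Rightarrow> real ^ 'n" where
  "kkt_dir H J g c = (\<chi> a. kkt_sol H J g c $ Inl a)"

lemma kkt_mat_eq_iff:
  fixes H :: "real ^ 'n::finite ^ 'n" and J :: "real ^ 'n ^ 'm::finite"
  shows "kkt_mat H J *v s = kkt_rhs g c \<longleftrightarrow> kkt H J g c (\<chi> a. s $ Inl a) (\<chi> a. s $ Inr a)"
proof -
  have sum_split: "(\<Sum>j\<in>UNIV. h j) = (\<Sum>a\<in>UNIV. h (Inl a)) + (\<Sum>b\<in>UNIV. h (Inr b))"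
    for h :: "'n + 'm \<Rightarrow> real"
    by (simp add: sum.Plus flip: UNIV_Plus_UNIV)
  have all_split: "(\<forall>i. Q i) \<longleftrightarrow> (\<forall>a. Q (Inl a)) \<and> (\<forall>b. Q (Inr b))" for Q :: "'n + 'm \<Rightarrow> bool"
    by (metis sum.exhaust)
  show ?thesis
    unfolding kkt_def vec_eq_iff all_split
    by (simp add: matrix_vector_mult_def sum_split kkt_mat_def kkt_rhs_def transpose_def)
qed

lemma inner_transpose_mult:
  fixes J :: "real ^ 'n::finite ^ 'm::finite"
  shows "u \<bullet> (transpose J *v y) = (J *v u) \<bullet> y"
  by (metis dot_lmul_matrix inner_commute transpose_matrix_vector)

lemma inner_symmetric_mult:
  fixes H :: "real ^ 'n::finite ^ 'n"
  shows "transpose H = H \<Longrightarrow> u \<bullet> (H *v v) = v \<bullet> (H *v u)"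
  by (metis inner_transpose_mult inner_commute)

text \<open>Pairing the first block row with a null vector of \<open>J\<close> removes the
  multiplier, since the range of the transpose is orthogonal to the null space.\<close>

lemma kkt_inner_null:
  assumes "kkt H J g c d y" "J *v u = 0"
  shows "u \<bullet> (H *v d) = - (u \<bullet> g)"
proof -
  have "u \<bullet> (H *v d) + u \<bullet> (transpose J *v y) = - (u \<bullet> g)"
    using assms(1) unfolding kkt_def by (metis inner_add_right inner_minus_right)
  then show ?thesis unfolding inner_transpose_mult assms(2) by simp
qed

text \<open>The direction lies in the null space and has zero curvature, hence vanishes; injectivity
  of the transposed Jacobian then removes the multiplier.\<close>

lemma kkt_homogeneous:
  assumes "pos_def_on_null \<zeta> H J" "kkt H J 0 0 d y"
  shows "d = 0" "y = 0"
proof -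
  have Jd: "J *v d = 0" using assms(2) by (simp add: kkt_def)
  have "\<zeta> * (norm d)\<^sup>2 \<le> 0"
    using kkt_inner_null[OF assms(2) Jd] assms(1) Jd unfolding pos_def_on_null_def by fastforce
  then show "d = 0"
    using assms(1) by (auto simp: pos_def_on_null_def mult_le_0_iff)
  then show "y = 0"
    using assms unfolding pos_def_on_null_def kkt_def by simp
qed

lemma det_kkt_mat:
  assumes "pos_def_on_null \<zeta> H J"
  shows "det (kkt_mat H J) \<noteq> 0"
proof -
  have "s = 0" if "kkt_mat H J *v s = 0" for s
  proof -
    have "kkt_rhs 0 0 = (0 :: real ^ ('a + 'b))"
      by (simp add: kkt_rhs_def vec_eq_iff split: sum.split)
    then have "kkt H J 0 0 (\<chi> a. s $ Inl a) (\<chi> a. s $ Inr a)"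
      using that by (simp flip: kkt_mat_eq_iff)
    from kkt_homogeneous[OF assms this] show "s = 0"
      by (simp add: vec_eq_iff) (metis sum.exhaust)
  qed
  then have "invertible (kkt_mat H J)"
    by (metis invertible_left_inverse matrix_left_invertible_ker)
  then show ?thesis by (simp add: invertible_det_nz)
qed

lemma kkt_kkt_dir:
  assumes "pos_def_on_null \<zeta> H J"
  shows "\<exists>y. kkt H J g c (kkt_dir H J g c) y"
proof -
  have "kkt_mat H J *v kkt_sol H J g c = kkt_rhs g c"
    by (subst cramer[OF det_kkt_mat[OF assms]]) (simp add: kkt_sol_def)
  then show ?thesis unfolding kkt_mat_eq_iff kkt_dir_def by blast
qed

lemma kkt_diff:
  assumes "kkt H J g c d y" "kkt H J g' c' d' y'"
  shows "kkt H J (g - g') (c - c') (d - d') (y - y')"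
  using assms unfolding kkt_def by (auto simp: matrix_vector_mult_diff_distrib algebra_simps)

lemma kkt_unique:
  assumes "pos_def_on_null \<zeta> H J" "kkt H J g c d y"
  shows "d = kkt_dir H J g c"
proof -
  obtain y' where "kkt H J g c (kkt_dir H J g c) y'" using kkt_kkt_dir[OF assms(1)] by blast
  from kkt_diff[OF assms(2) this] kkt_homogeneous(1)[OF assms(1)] show ?thesis by fastforce
qed

subsection \<open>One step of the method\<close>

lemma closest_point_interval:
  fixes a b x :: real
  assumes "a \<le> b"
  shows "closest_point {a..b} x = max a (min b x)"
  by (rule closest_point_unique[symmetric]) (use assms in \<open>auto simp: dist_real_def\<close>)

text \<open>The third claim absorbs the quadratic remainder of \<open>merit_upper_bound\<close>: the
  trial step sizes are chosen so that \<open>\<alpha> * \<rho>\<close> stays below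
  \<open>\<beta> * q\<close>, which turns the remainder into half of the sampled model decrease,
  scaled by \<open>\<alpha> * \<beta>\<close>.\<close>

lemma step_size_bounds:
  assumes pos: "0 < L" "0 < \<Gamma>" "0 < \<tau>" "0 < \<beta>" "0 \<le> \<theta>" "0 < \<xi>" and "d \<noteq> 0"
    and lo: "lo = \<beta> * \<xi> * \<tau> / (\<tau> * L + \<Gamma>)" "lo \<le> 1"
    and \<xi>: "\<xi> \<le> q / (\<tau> * (norm d)\<^sup>2)"
    and \<alpha>: "\<alpha> = step_size L \<Gamma> \<theta> \<beta> \<tau> \<xi> c q d"
  shows "lo \<le> \<alpha>" "\<alpha> \<le> lo + \<theta> * \<beta>\<^sup>2"
    and "\<bar>1 - \<alpha>\<bar> * norm1 c + (\<tau> * L + \<Gamma>) / 2 * (\<alpha>\<^sup>2 * (norm d)\<^sup>2)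
      \<le> norm1 c - \<alpha> * norm1 c + 1/2 * \<alpha> * \<beta> * q"
proof -
  define n where "n = norm1 c"
  define \<rho> where "\<rho> = (\<tau> * L + \<Gamma>) * (norm d)\<^sup>2"
  define hi where "hi = lo + \<theta> * \<beta>\<^sup>2"
  define hat where "hat = max lo (min hi (\<beta> * q / \<rho>))"
  define tilde where "tilde = max lo (min hi (\<beta> * q / \<rho> - 4 * n / \<rho>))"
  have TL: "0 < \<tau> * L + \<Gamma>" using pos by (simp add: add_pos_pos)
  then have \<rho>: "\<rho> > 0" using \<open>d \<noteq> 0\<close> by (simp add: \<rho>_def)
  have n: "n \<ge> 0" by (simp add: n_def norm1_nonneg)
  have lo_pos: "0 < lo" unfolding lo using pos TL by simp
  have lo_hi: "lo \<le> hi" using pos by (simp add: hi_def)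
  have \<alpha>_eq: "\<alpha> = (if hat < 1 then hat else if tilde \<le> 1 then 1 else tilde)"
    unfolding \<alpha> step_size_def Let_def lo(1)[symmetric] \<rho>_def[symmetric] n_def[symmetric]
      hi_def[symmetric] closest_point_interval[OF lo_hi] hat_def tilde_def ..
  \<comment> \<open>The update rule for \<open>\<xi>\<close> says exactly that the left end of the
    interval does not exceed the unprojected \<open>hat\<close>, so projection can only lower
    \<open>hat\<close>.\<close>
  have "\<xi> * (\<tau> * (norm d)\<^sup>2) \<le> q"
    using \<xi> pos \<open>d \<noteq> 0\<close> by (subst (asm) pos_le_divide_eq) auto
  then have "\<beta> * (\<xi> * (\<tau> * (norm d)\<^sup>2)) \<le> \<beta> * q"
    using pos by (intro mult_left_mono) auto
  moreover have "lo * \<rho> = \<beta> * (\<xi> * (\<tau> * (norm d)\<^sup>2))"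
    unfolding lo \<rho>_def using TL by (simp add: field_simps)
  ultimately have lo_init: "lo \<le> \<beta> * q / \<rho>"
    using \<rho> by (simp add: pos_le_divide_eq)
  then have hat_le: "hat \<le> \<beta> * q / \<rho>" by (simp add: hat_def)
  have tilde_hat: "tilde \<le> hat"
  proof -
    have "\<beta> * q / \<rho> - 4 * n / \<rho> \<le> \<beta> * q / \<rho>" using n \<rho> by simp
    then show ?thesis unfolding tilde_def hat_def by (auto simp: max_def min_def)
  qed
  have "hat \<le> hi" "lo \<le> tilde" "lo \<le> hat" "tilde \<le> hi"
    using lo_hi by (auto simp: hat_def tilde_def)
  then show lo_le: "lo \<le> \<alpha>" and "\<alpha> \<le> lo + \<theta> * \<beta>\<^sup>2"
    using \<alpha>_eq tilde_hat \<open>lo \<le> 1\<close> by (auto simp: hi_def[symmetric])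
  have quad: "(\<tau> * L + \<Gamma>) / 2 * (\<alpha>\<^sup>2 * (norm d)\<^sup>2) = 1/2 * (\<alpha> * (\<alpha> * \<rho>))"
    by (simp add: \<rho>_def power2_eq_square)
  show "\<bar>1 - \<alpha>\<bar> * norm1 c + (\<tau> * L + \<Gamma>) / 2 * (\<alpha>\<^sup>2 * (norm d)\<^sup>2)
      \<le> norm1 c - \<alpha> * norm1 c + 1/2 * \<alpha> * \<beta> * q"
  proof (cases "\<alpha> \<le> 1")
    case True
    then have "\<alpha> \<le> hat" using \<alpha>_eq by (auto split: if_splits)
    then have "\<alpha> \<le> \<beta> * q / \<rho>" using hat_le by simp
    then have "\<alpha> * \<rho> \<le> \<beta> * q" using \<rho> by (simp add: pos_le_divide_eq)
    then have "\<alpha> * (\<alpha> * \<rho>) \<le> \<alpha> * (\<beta> * q)"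
      using lo_le lo_pos by (intro mult_left_mono) auto
    with True show ?thesis unfolding quad n_def[symmetric] by (simp add: algebra_simps)
  next
    case False
    then have "\<alpha> = tilde" "tilde > 1" using \<alpha>_eq by (auto split: if_splits)
    \<comment> \<open>Since \<open>lo \<le> 1 < tilde\<close>, the projection did not raise the
      value. This is where a left end beyond the unit step would break the argument.\<close>
    then have "\<alpha> \<le> \<beta> * q / \<rho> - 4 * n / \<rho>"
      using \<open>lo \<le> 1\<close> by (auto simp: tilde_def max_def min_def split: if_splits)
    then have "\<alpha> * \<rho> \<le> \<beta> * q - 4 * n"
      using \<rho> by (simp add: pos_le_divide_eq flip: diff_divide_distrib)
    \<comment> \<open>After halving, the subtracted term contributes
      \<open>2 * \<alpha> * n\<close>. It pays for the excess \<open>2 * (\<alpha> - 1) * n\<close>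
      of \<open>\<bar>1 - \<alpha>\<bar> * n\<close> over \<open>(1 - \<alpha>) * n\<close>, which
      explains the 4 in the step size rule.\<close>
    then have "\<alpha> * (\<alpha> * \<rho>) \<le> \<alpha> * (\<beta> * q - 4 * n)"
      using lo_le lo_pos by (intro mult_left_mono) auto
    with False n show ?thesis unfolding quad n_def[symmetric] by (simp add: algebra_simps)
  qed
qed

text \<open>A trial value below \<open>\<tau>\<close> is finite and nonnegative, so the factor
  \<open>1 - \<epsilon>\<close> cannot push it up again.\<close>

lemma tau_update_trial:
  assumes "0 < \<epsilon>" "\<epsilon> < 1" "s < 1"
  shows "tau_update \<epsilon> \<tau> (tau_trial s c g H d) \<le> \<tau>"
    and "tau_trial s c g H d < ereal \<tau> \<Longrightarrow> tau_update \<epsilon> \<tau> (tau_trial s c g H d) < \<tau>"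
proof -
  have *: "tau_update \<epsilon> \<tau> (tau_trial s c g H d) < \<tau>" if less: "tau_trial s c g H d < ereal \<tau>"
  proof -
    obtain r where r: "tau_trial s c g H d = ereal r" "0 \<le> r"
      using less assms norm1_nonneg[of c]
      by (auto simp: tau_trial_def Let_def split: if_splits)
    have "(1 - \<epsilon>) * r \<le> 1 * r" using assms r by (intro mult_right_mono) auto
    then show ?thesis using less r by (simp add: tau_update_def)
  qed
  then show "tau_update \<epsilon> \<tau> (tau_trial s c g H d) \<le> \<tau>"
    by (cases "ereal \<tau> \<le> tau_trial s c g H d") (simp add: tau_update_def, simp add: not_le less_imp_le)
  show "tau_trial s c g H d < ereal \<tau> \<Longrightarrow> tau_update \<epsilon> \<tau> (tau_trial s c g H d) < \<tau>"
    by (rule *)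
qed

text \<open>The trial value is a nonnegative number over the model term. It translates the event of
  \<open>A4\<close>, a comparison of model terms, into a comparison of trial values.\<close>

lemma tau_trial_antimono:
  assumes "s < 1" "g \<bullet> d + max (d \<bullet> (H *v d)) 0 \<le> g' \<bullet> d' + max (d' \<bullet> (H *v d')) 0"
  shows "tau_trial s c g' H d' \<le> tau_trial s c g H d"
  using assms norm1_nonneg[of c]
  by (auto simp: tau_trial_def Let_def intro!: divide_left_mono mult_nonneg_nonneg mult_pos_pos)

text \<open>Positivity of the outcome excludes a nonpositive trial value, for which multiplying by
  \<open>1 - \<epsilon>\<close> would increase it. On the event the outcome is
  \<open>xi_min\<close>, hence positive.\<close>

lemma xi_update_le:
  assumes "0 < \<epsilon>" "\<epsilon> < 1" "0 < xi_update \<epsilon> \<xi> t"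
  shows "xi_update \<epsilon> \<xi> t \<le> t" "xi_update \<epsilon> \<xi> t \<le> \<xi>"
proof -
  have "t > 0 \<Longrightarrow> (1 - \<epsilon>) * t \<le> 1 * t" using assms by (intro mult_right_mono) auto
  moreover have "\<not> \<xi> \<le> t \<Longrightarrow> t > 0"
    using assms by (auto simp: xi_update_def zero_less_mult_iff)
  ultimately have "xi_update \<epsilon> \<xi> t \<le> t \<and> xi_update \<epsilon> \<xi> t \<le> \<xi>"
    unfolding xi_update_def by (smt (verit))
  then show "xi_update \<epsilon> \<xi> t \<le> t" "xi_update \<epsilon> \<xi> t \<le> \<xi>" by blast+
qed

text \<open>If \<open>d = 0\<close>, then the actual step size 1 need not lie in the projection
  interval, but the iterate does not move and any member of the interval can stand in for it. This
  is why the estimate is stated for some \<open>a\<close>; the witness is then \<open>lo\<close>,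
  and otherwise \<open>\<alpha>\<close> itself.\<close>

lemma merit_step:
  fixes P :: "('n::finite, 'm::finite) sqp_problem"
  assumes P: "smooth_problem P" and x: "x \<in> region P" "x + \<alpha> *\<^sub>R d \<in> region P"
    and pos: "0 < \<Gamma>" "0 < \<tau>" "0 < \<beta>" "0 \<le> \<theta>" "0 < \<xi>"
    and \<Gamma>: "(\<Sum>i\<in>UNIV. lip_con P i) \<le> \<Gamma>"
    and lo: "lo = \<beta> * \<xi> * \<tau> / (\<tau> * lip_obj P + \<Gamma>)" "lo \<le> 1"
    and Jd: "Jac P x *v d = - con P x"
    and q: "q = delta_q (con P x) \<tau> g H d"
    and zero: "d = 0 \<Longrightarrow> \<alpha> = 1"
    and nonzero: "d \<noteq> 0 \<Longrightarrow> \<xi> \<le> q / (\<tau> * (norm d)\<^sup>2)"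
      "d \<noteq> 0 \<Longrightarrow> \<alpha> = step_size (lip_obj P) \<Gamma> \<theta> \<beta> \<tau> \<xi> (con P x) q d"
  shows "\<exists>a. lo \<le> a \<and> a \<le> lo + \<theta> * \<beta>\<^sup>2 \<and> 0 \<le> q \<and>
    \<tau> * obj P (x + \<alpha> *\<^sub>R d) + norm1 (con P (x + \<alpha> *\<^sub>R d)) \<le> \<tau> * obj P x + norm1 (con P x)
      - a * delta_q (con P x) \<tau> (gradient (obj P) x) H d' + 1/2 * a * \<beta> * q
      + a * \<tau> * (gradient (obj P) x \<bullet> (d - d'))"
proof (cases "d = 0")
  case True
  then have c: "con P x = 0" using Jd by simp
  have "0 < lo" unfolding lo using pos smooth_problemD(7)[OF P] by (simp add: add_pos_pos)
  then have "0 \<le> lo * (\<tau> * (1/2 * max (d' \<bullet> (H *v d')) 0))" using pos by simp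
  then show ?thesis
    using True c q pos
    by (intro exI[of _ lo]) (auto simp: delta_q_def norm1_def algebra_simps)
next
  case False
  let ?n = "norm1 (con P x)" and ?g = "gradient (obj P) x"
  note * = step_size_bounds[OF smooth_problemD(7)[OF P] pos False lo nonzero[OF False]]
  have "0 < \<xi> * (\<tau> * (norm d)\<^sup>2)" using pos False by simp
  also have "\<dots> \<le> q" using nonzero(1)[OF False] pos False by (subst (asm) pos_le_divide_eq) auto
  finally have "0 \<le> q" by simp
  have "0 < lo" unfolding lo using pos smooth_problemD(7)[OF P] by (simp add: add_pos_pos)
  \<comment> \<open>Rewriting the slope along \<open>d\<close> through \<open>delta_q\<close> at
    \<open>d'\<close> leaves this curvature term as nonnegative slack.\<close>
  then have "0 \<le> \<alpha> * (\<tau> * (1/2 * max (d' \<bullet> (H *v d')) 0))" using pos *(1) by simp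
  moreover have "\<tau> * obj P (x + \<alpha> *\<^sub>R d) + norm1 (con P (x + \<alpha> *\<^sub>R d))
    \<le> \<tau> * obj P x + \<tau> * \<alpha> * (?g \<bullet> d) + \<bar>1 - \<alpha>\<bar> * ?n
      + (\<tau> * lip_obj P + \<Gamma>) / 2 * (\<alpha>\<^sup>2 * (norm d)\<^sup>2)"
    using pos by (intro merit_upper_bound[OF P x _ \<Gamma> Jd]) simp
  ultimately have "\<tau> * obj P (x + \<alpha> *\<^sub>R d) + norm1 (con P (x + \<alpha> *\<^sub>R d)) \<le> \<tau> * obj P x + ?n
      - \<alpha> * delta_q (con P x) \<tau> ?g H d' + 1/2 * \<alpha> * \<beta> * q + \<alpha> * \<tau> * (?g \<bullet> (d - d'))"
    using *(3) by (simp add: delta_q_def algebra_simps inner_diff_right)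
  then show ?thesis using *(1,2) \<open>0 \<le> q\<close> by blast
qed

section \<open>Sensitivity of directions and models to the gradient error\<close>

lemma mat_norm_bound:
  fixes H :: "real ^ 'n::finite ^ 'n"
  assumes "mat_norm H \<le> \<kappa>"
  shows "norm (H *v v) \<le> \<kappa> * norm v" "\<bar>u \<bullet> (H *v v)\<bar> \<le> \<kappa> * norm u * norm v"
proof -
  have "norm (H *v v) \<le> mat_norm H * norm v"
    unfolding mat_norm_def by (rule onorm[OF matrix_vector_mul_bounded_linear])
  also have "\<dots> \<le> \<kappa> * norm v" using assms by (rule mult_right_mono) simp
  finally show *: "norm (H *v v) \<le> \<kappa> * norm v" .
  have "\<bar>u \<bullet> (H *v v)\<bar> \<le> norm u * norm (H *v v)" by (rule Cauchy_Schwarz_ineq2)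
  also have "\<dots> \<le> norm u * (\<kappa> * norm v)" using * by (rule mult_left_mono) simp
  finally show "\<bar>u \<bullet> (H *v v)\<bar> \<le> \<kappa> * norm u * norm v" by (simp add: mult_ac)
qed

text \<open>With zero constraint right-hand side the solution is a null vector, so its curvature
  equals its pairing with \<open>- g\<close>. Applied with the gradient error as \<open>g\<close>,
  this is the source of the inverse of \<open>zeta_c\<close> in \<open>M_bar\<close>; applied with
  the true gradient, it bounds \<open>z\<close>.\<close>

lemma pos_def_on_null_norm_le:
  assumes H: "pos_def_on_null \<zeta> H J" and kkt: "kkt H J g 0 d y"
  shows "\<zeta> * norm d \<le> norm g" "d \<bullet> (H *v d) \<le> (norm g)\<^sup>2 / \<zeta>"
proof -
  have Jd: "J *v d = 0" using kkt by (simp add: kkt_def)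
  have eq: "d \<bullet> (H *v d) = - (d \<bullet> g)" by (rule kkt_inner_null[OF kkt Jd])
  have le: "- (d \<bullet> g) \<le> norm d * norm g"
    using norm_cauchy_schwarz[of "-d" g] by simp
  have \<zeta>: "\<zeta> > 0" using H by (simp add: pos_def_on_null_def)
  have "\<zeta> * (norm d)\<^sup>2 \<le> norm d * norm g"
    using H Jd eq le unfolding pos_def_on_null_def by fastforce
  then show *: "\<zeta> * norm d \<le> norm g"
    by (cases "d = 0") (simp_all add: power2_eq_square algebra_simps)
  then have "norm d * norm g \<le> norm g / \<zeta> * norm g"
    using \<zeta> by (intro mult_right_mono) (simp_all add: field_simps)
  then show "d \<bullet> (H *v d) \<le> (norm g)\<^sup>2 / \<zeta>"
    using eq le by (simp add: power2_eq_square)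
qed

text \<open>Since \<open>D - d\<close> solves the linear system with right-hand side \<open>-(G - g, 0)\<close>, symmetry of the
  system turns every first-order term in \<open>D - d\<close> into an inner product of the gradient error with
  a vector that does not depend on \<open>G\<close>.\<close>

lemma kkt_perturbation:
  fixes g G :: "real ^ 'n::finite" and J :: "real ^ 'n ^ 'm::finite"
  assumes H: "pos_def_on_null \<zeta> H J"
    and d: "kkt H J g c d y" and D: "kkt H J G c D Y" and z: "kkt H J g 0 z y'"
  defines "p \<equiv> g \<bullet> d + 1/2 * max (d \<bullet> (H *v d)) 0"
    and "s \<equiv> G \<bullet> D + 1/2 * max (D \<bullet> (H *v D)) 0"
  shows "g \<bullet> (D - d) = z \<bullet> (G - g)"
    and "p - s \<le> (if d \<bullet> (H *v d) \<ge> 0 then - d else - d - z) \<bullet> (G - g) + (norm (G - g))\<^sup>2 / \<zeta>"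
proof -
  define w e where "w = D - d" and "e = G - g"
  have w: "kkt H J e 0 w (Y - y)" using kkt_diff[OF D d] by (simp add: w_def e_def)
  have sym: "transpose H = H" using H by (simp add: pos_def_on_null_def)
  have Jw: "J *v w = 0" and Jz: "J *v z = 0" using w z by (simp_all add: kkt_def)
  \<comment> \<open>Both sides equal minus the bilinear form of \<open>H\<close> at \<open>w\<close>
    and \<open>z\<close>.\<close>
  have gw: "g \<bullet> w = z \<bullet> e"
    using kkt_inner_null[OF z Jw] kkt_inner_null[OF w Jz] inner_symmetric_mult[OF sym, of w z]
    by (simp add: inner_commute)
  then show "g \<bullet> (D - d) = z \<bullet> (G - g)" by (simp add: w_def e_def)
  have wHd: "w \<bullet> (H *v d) = - (z \<bullet> e)"
    using kkt_inner_null[OF d Jw] gw by (simp add: inner_commute)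
  have wHw: "w \<bullet> (H *v w) = - (w \<bullet> e)" by (rule kkt_inner_null[OF w Jw])
  have w_nonneg: "0 \<le> w \<bullet> (H *v w)"
  proof -
    have "0 \<le> \<zeta> * (norm w)\<^sup>2" using H by (simp add: pos_def_on_null_def)
    also have "\<dots> \<le> w \<bullet> (H *v w)" using H Jw by (simp add: pos_def_on_null_def)
    finally show ?thesis .
  qed
  have D_eq: "D = d + w" and G_eq: "G = g + e" by (simp_all add: w_def e_def)
  have "D \<bullet> (H *v D) = d \<bullet> (H *v d) + 2 * (w \<bullet> (H *v d)) + w \<bullet> (H *v w)"
    unfolding D_eq using inner_symmetric_mult[OF sym, of d w]
    by (simp add: matrix_vector_right_distrib inner_add_left inner_add_right)
  moreover have "G \<bullet> D = g \<bullet> d + e \<bullet> d + z \<bullet> e - w \<bullet> (H *v w)"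
    unfolding D_eq G_eq using gw wHw by (simp add: inner_add_left inner_add_right inner_commute)
  moreover have "w \<bullet> (H *v w) \<le> (norm e)\<^sup>2 / \<zeta>" by (rule pos_def_on_null_norm_le(2)[OF H w])
  \<comment> \<open>If the true curvature is nonnegative, the sampled maximum is bounded below by
    the sampled curvature, and its cross term cancels \<open>z\<close>; otherwise by
    \<open>0\<close>, and \<open>z\<close> remains. The case split concerns the true direction only,
    so the linear coefficient does not depend on \<open>G\<close>.\<close>
  ultimately show "p - s \<le> (if d \<bullet> (H *v d) \<ge> 0 then - d else - d - z) \<bullet> (G - g) + (norm (G - g))\<^sup>2 / \<zeta>"
    unfolding p_def s_def e_def[symmetric] using wHd w_nonneg
    by (auto simp: inner_diff_left inner_commute[of e d] max_def field_simps)
qed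

text \<open>Crude bounds that make no use of cancellation. They supply, in order,
  \<open>kap_dq1\<close>, \<open>kap_dq2\<close>, the \<open>tau_init - tau_min\<close> part of
  \<open>M_bar\<close>, and the common factor of \<open>kap_E3\<close> and of the last summand of
  \<open>M_bar\<close>.\<close>

lemma model_bounds:
  fixes g G d D :: "real ^ 'n::finite"
  assumes H: "mat_norm H \<le> \<kappa>H" "transpose H = H" "0 < \<kappa>H" "0 < \<kappa>d"
    and g: "norm g \<le> \<kappa>g" and d: "norm d \<le> \<kappa>d * norm g" and w: "norm (D - d) \<le> \<kappa>d * norm (G - g)"
  defines "p \<equiv> g \<bullet> d + 1/2 * max (d \<bullet> (H *v d)) 0"
    and "s \<equiv> G \<bullet> D + 1/2 * max (D \<bullet> (H *v D)) 0"
    and "E \<equiv> norm (G - g)"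
  shows "\<bar>p\<bar> \<le> \<kappa>d * \<kappa>g\<^sup>2 * (1 + 1/2 * \<kappa>H * \<kappa>d)"
    and "\<bar>s\<bar> \<le> 2 * \<kappa>d * (1 + 1/2 * \<kappa>H * \<kappa>d) * (\<kappa>g\<^sup>2 + E\<^sup>2)"
    and "\<bar>p - s\<bar> \<le> (\<kappa>d + 1/2 * \<kappa>H * \<kappa>d\<^sup>2) * (2 * \<kappa>g * E + E\<^sup>2)"
    and "\<bar>g \<bullet> (D - d)\<bar> \<le> \<kappa>g * \<kappa>d * E"
proof -
  have E: "0 \<le> E" by (simp add: E_def)
  have \<kappa>g: "0 \<le> \<kappa>g" using g norm_ge_zero order_trans by blast
  have nd: "norm d \<le> \<kappa>d * \<kappa>g" using d g H(4) by (meson mult_left_mono less_imp_le order_trans)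
  \<comment> \<open>Used with \<open>t\<close> equal to \<open>\<kappa>g\<close> for the true model
    and to \<open>\<kappa>g + E\<close> for the sampled one.\<close>
  have *: "\<bar>a \<bullet> b + 1/2 * max (b \<bullet> (H *v b)) 0\<bar> \<le> \<kappa>d * (1 + 1/2 * \<kappa>H * \<kappa>d) * t\<^sup>2"
    if "norm a \<le> t" "norm b \<le> \<kappa>d * t" "0 \<le> t" for a b t
  proof -
    have "\<bar>a \<bullet> b\<bar> \<le> norm a * norm b" by (rule Cauchy_Schwarz_ineq2)
    also have "\<dots> \<le> t * (\<kappa>d * t)" using that by (intro mult_mono) auto
    finally have 1: "\<bar>a \<bullet> b\<bar> \<le> t * (\<kappa>d * t)" .
    have "\<bar>b \<bullet> (H *v b)\<bar> \<le> \<kappa>H * norm b * norm b" by (rule mat_norm_bound(2)[OF H(1)])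
    also have "\<dots> \<le> \<kappa>H * (\<kappa>d * t) * (\<kappa>d * t)"
      using that H by (intro mult_mono mult_nonneg_nonneg) auto
    finally have 2: "\<bar>b \<bullet> (H *v b)\<bar> \<le> \<kappa>H * (\<kappa>d * t) * (\<kappa>d * t)" .
    have "\<bar>a \<bullet> b + 1/2 * max (b \<bullet> (H *v b)) 0\<bar> \<le> t * (\<kappa>d * t) + 1/2 * (\<kappa>H * (\<kappa>d * t) * (\<kappa>d * t))"
      using 1 2 by (auto simp: max_def)
    also have "\<dots> = \<kappa>d * (1 + 1/2 * \<kappa>H * \<kappa>d) * t\<^sup>2" by (simp add: power2_eq_square algebra_simps)
    finally show ?thesis .
  qed
  have "\<bar>p\<bar> \<le> \<kappa>d * (1 + 1/2 * \<kappa>H * \<kappa>d) * \<kappa>g\<^sup>2"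
    unfolding p_def by (rule *[OF g nd \<kappa>g])
  then show "\<bar>p\<bar> \<le> \<kappa>d * \<kappa>g\<^sup>2 * (1 + 1/2 * \<kappa>H * \<kappa>d)" by (simp add: mult_ac)
  have "norm G \<le> \<kappa>g + E" unfolding E_def using norm_triangle_ineq[of g "G - g"] g by simp
  moreover have "norm D \<le> \<kappa>d * (\<kappa>g + E)"
    using norm_triangle_ineq[of d "D - d"] nd w by (simp add: E_def algebra_simps)
  ultimately have "\<bar>s\<bar> \<le> \<kappa>d * (1 + 1/2 * \<kappa>H * \<kappa>d) * (\<kappa>g + E)\<^sup>2"
    unfolding s_def using \<kappa>g E by (intro *) auto
  also have "\<dots> \<le> \<kappa>d * (1 + 1/2 * \<kappa>H * \<kappa>d) * (2 * (\<kappa>g\<^sup>2 + E\<^sup>2))"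
    using H sum_squares_bound[of \<kappa>g E]
    by (intro mult_left_mono) (auto simp: power2_sum intro!: mult_nonneg_nonneg add_nonneg_nonneg)
  finally show "\<bar>s\<bar> \<le> 2 * \<kappa>d * (1 + 1/2 * \<kappa>H * \<kappa>d) * (\<kappa>g\<^sup>2 + E\<^sup>2)" by (simp only: mult_ac)
  define w e where "w = D - d" and "e = G - g"
  have nw: "norm w \<le> \<kappa>d * E" and ne: "norm e = E" using w by (simp_all add: w_def e_def E_def)
  have gw: "\<bar>g \<bullet> w\<bar> \<le> \<kappa>g * (\<kappa>d * E)"
    using Cauchy_Schwarz_ineq2[of g w] mult_mono[OF g nw \<kappa>g norm_ge_zero] by linarith
  then show "\<bar>g \<bullet> (D - d)\<bar> \<le> \<kappa>g * \<kappa>d * E" by (simp add: w_def mult_ac)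
  have ed: "\<bar>e \<bullet> d\<bar> \<le> E * (\<kappa>d * \<kappa>g)"
    using Cauchy_Schwarz_ineq2[of e d] mult_left_mono[OF nd, of E] E ne by simp
  have ew: "\<bar>e \<bullet> w\<bar> \<le> E * (\<kappa>d * E)"
    using Cauchy_Schwarz_ineq2[of e w] mult_left_mono[OF nw, of E] E ne by simp
  have "\<bar>w \<bullet> (H *v d)\<bar> \<le> \<kappa>H * norm w * norm d" by (rule mat_norm_bound(2)[OF H(1)])
  also have "\<dots> \<le> \<kappa>H * (\<kappa>d * E) * (\<kappa>d * \<kappa>g)"
    using nw nd H E by (intro mult_mono mult_nonneg_nonneg) auto
  finally have wHd: "\<bar>w \<bullet> (H *v d)\<bar> \<le> \<kappa>H * (\<kappa>d * E) * (\<kappa>d * \<kappa>g)" .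
  have "\<bar>w \<bullet> (H *v w)\<bar> \<le> \<kappa>H * norm w * norm w" by (rule mat_norm_bound(2)[OF H(1)])
  also have "\<dots> \<le> \<kappa>H * (\<kappa>d * E) * (\<kappa>d * E)"
    using nw H E by (intro mult_mono mult_nonneg_nonneg) auto
  finally have wHw: "\<bar>w \<bullet> (H *v w)\<bar> \<le> \<kappa>H * (\<kappa>d * E) * (\<kappa>d * E)" .
  have D_eq: "D = d + w" and G_eq: "G = g + e" by (simp_all add: w_def e_def)
  have DHD: "D \<bullet> (H *v D) = d \<bullet> (H *v d) + 2 * (w \<bullet> (H *v d)) + w \<bullet> (H *v w)"
    unfolding D_eq using inner_symmetric_mult[OF H(2), of d w]
    by (simp add: matrix_vector_right_distrib inner_add_left inner_add_right)
  have GD: "G \<bullet> D = g \<bullet> d + e \<bullet> d + g \<bullet> w + e \<bullet> w"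
    unfolding D_eq G_eq by (simp add: inner_add_left inner_add_right)
  have max_lip: "\<bar>max u 0 - max v 0\<bar> \<le> \<bar>u - v\<bar>" for u v :: real by (auto simp: max_def)
  have "\<bar>p - s\<bar> \<le> \<bar>e \<bullet> d\<bar> + \<bar>g \<bullet> w\<bar> + \<bar>e \<bullet> w\<bar> + 1/2 * (2 * \<bar>w \<bullet> (H *v d)\<bar> + \<bar>w \<bullet> (H *v w)\<bar>)"
  proof -
    define m where "m = max (d \<bullet> (H *v d)) 0 - max (D \<bullet> (H *v D)) 0"
    have eq: "p - s = - (e \<bullet> d + g \<bullet> w + e \<bullet> w) + 1/2 * m"
      by (simp add: p_def s_def GD m_def algebra_simps)
    have m: "\<bar>m\<bar> \<le> 2 * \<bar>w \<bullet> (H *v d)\<bar> + \<bar>w \<bullet> (H *v w)\<bar>"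
    proof -
      have "\<bar>m\<bar> \<le> \<bar>d \<bullet> (H *v d) - D \<bullet> (H *v D)\<bar>" unfolding m_def by (rule max_lip)
      then show ?thesis unfolding DHD by linarith
    qed
    have "\<bar>- x + 1/2 * m\<bar> \<le> \<bar>x\<bar> + 1/2 * t" if "\<bar>m\<bar> \<le> t" for x t :: real
      using that by linarith
    from this[OF m, of "e \<bullet> d + g \<bullet> w + e \<bullet> w"]
    have "\<bar>p - s\<bar> \<le> \<bar>e \<bullet> d + g \<bullet> w + e \<bullet> w\<bar> + 1/2 * (2 * \<bar>w \<bullet> (H *v d)\<bar> + \<bar>w \<bullet> (H *v w)\<bar>)"
      unfolding eq .
    moreover have "\<bar>e \<bullet> d + g \<bullet> w + e \<bullet> w\<bar> \<le> \<bar>e \<bullet> d\<bar> + \<bar>g \<bullet> w\<bar> + \<bar>e \<bullet> w\<bar>"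
      by linarith
    ultimately show ?thesis by linarith
  qed
  also have "\<dots> \<le> E * (\<kappa>d * \<kappa>g) + \<kappa>g * (\<kappa>d * E) + E * (\<kappa>d * E)
      + 1/2 * (2 * (\<kappa>H * (\<kappa>d * E) * (\<kappa>d * \<kappa>g)) + \<kappa>H * (\<kappa>d * E) * (\<kappa>d * E))"
    by (intro add_mono mult_left_mono ed gw ew wHd wHw) simp_all
  also have "\<dots> = (\<kappa>d + 1/2 * \<kappa>H * \<kappa>d\<^sup>2) * (2 * \<kappa>g * E + E\<^sup>2)"
    by (simp add: power2_eq_square algebra_simps)
  finally show "\<bar>p - s\<bar> \<le> (\<kappa>d + 1/2 * \<kappa>H * \<kappa>d\<^sup>2) * (2 * \<kappa>g * E + E\<^sup>2)" .
qed

text \<open>\<open>Q\<close> and \<open>S\<close> are the true and sampled model decreases. Since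
  \<open>Ab * \<beta> \<le> Am\<close>, charging \<open>S\<close> costs at most half of
  \<open>\<beta> * Am * Q \<tau>\<close>, up to the difference of the models. In that difference
  \<open>\<tau>\<close> depends on the sample, so it is split into the fixed midpoint, which
  multiplies the mean-zero term \<open>l\<close>, and a deviation of at most half the range, which
  multiplies the crude bound.\<close>

lemma model_decrease_good:
  fixes n p s :: real and Q S :: "real \<Rightarrow> real"
  defines "Q \<equiv> \<lambda>t. n - t * p" and "S \<equiv> \<lambda>t. n - t * s"
  assumes \<beta>: "0 < \<beta>" and \<tau>: "\<tau>m \<le> \<tau>" "\<tau> \<le> \<tau>i" "0 < \<tau>m"
    and a: "\<beta> * Am \<le> a" "a \<le> Ab * \<beta>" and Am: "0 < Am" "Ab * \<beta> \<le> Am"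
    and S: "0 \<le> S \<tau>" and Q: "\<eta> \<le> Q \<tau>" "0 \<le> Q \<tau>"
    and ps: "\<bar>p - s\<bar> \<le> D" "p - s \<le> l + e" "0 \<le> e"
  shows "1/2 * Am * \<beta> * \<eta> \<le> a * Q \<tau> - 1/2 * a * \<beta> * S \<tau> + 1/2 * Ab * \<beta>\<^sup>2 * ((\<tau>i + \<tau>m) / 2 * l)
    + \<beta>\<^sup>2 * (1/2 * Ab * ((\<tau>i + \<tau>m) / 2 * e) + 1/2 * Ab * ((\<tau>i - \<tau>m) / 2 * D))"
proof -
  define mid half where "mid = (\<tau>i + \<tau>m) / 2" and "half = (\<tau>i - \<tau>m) / 2"
  have Ab: "0 < Ab" using a \<beta> Am by (metis less_le_trans mult_pos_pos zero_less_mult_pos2)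
  have "\<beta> * Am * Q \<tau> \<le> a * Q \<tau>" using a Q by (intro mult_right_mono) auto
  moreover have "a * (\<beta> * S \<tau>) \<le> Ab * \<beta> * (\<beta> * S \<tau>)" using a \<beta> S by (intro mult_right_mono) auto
  moreover have "Ab * \<beta> * (\<beta> * Q \<tau>) \<le> Am * (\<beta> * Q \<tau>)" using Am \<beta> Q by (intro mult_right_mono) auto
  moreover have "Am * \<beta> * \<eta> \<le> Am * \<beta> * Q \<tau>" using Am \<beta> Q by (intro mult_left_mono) auto
  moreover have "S \<tau> \<le> Q \<tau> + mid * (l + e) + half * D"
  proof -
    have "(\<tau> - mid) * (p - s) \<le> \<bar>\<tau> - mid\<bar> * \<bar>p - s\<bar>"
      by (metis abs_ge_self abs_mult)
    also have "\<dots> \<le> half * D"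
    proof (intro mult_mono)
      show "\<bar>\<tau> - mid\<bar> \<le> half"
        unfolding abs_le_iff using \<tau> by (auto simp: mid_def half_def field_simps)
    qed (use \<tau> ps in \<open>auto simp: half_def\<close>)
    finally have "(\<tau> - mid) * (p - s) \<le> half * D" .
    moreover have "mid * (p - s) \<le> mid * (l + e)"
      using ps \<tau> by (intro mult_left_mono) (auto simp: mid_def)
    ultimately show ?thesis by (simp add: Q_def S_def algebra_simps)
  qed
  then have "Ab * \<beta>\<^sup>2 * S \<tau> \<le> Ab * \<beta>\<^sup>2 * (Q \<tau> + mid * (l + e) + half * D)"
    using Ab by (intro mult_left_mono) auto
  ultimately show ?thesis
    unfolding mid_def[symmetric] half_def[symmetric] by (simp add: algebra_simps power2_eq_square)
qed

text \<open>At \<open>\<tau>\<close> the true decrease is not controlled, so everything is compared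
  with \<open>\<tau>m\<close>. The exchange costs \<open>a * \<tau> - \<beta> * Am * \<tau>m\<close>
  times \<open>p\<close> and \<open>Ab * (\<tau> - \<tau>m)\<close> times \<open>s\<close>; both
  coefficients are covered by \<open>V\<close>, the first after a factor \<open>\<beta>\<close>, and
  \<open>V\<close> is the common factor of the \<open>kap_dq\<close> constants.\<close>

lemma model_decrease_bad:
  fixes n p s :: real and Q S :: "real \<Rightarrow> real"
  defines "Q \<equiv> \<lambda>t. n - t * p" and "S \<equiv> \<lambda>t. n - t * s"
  assumes \<beta>: "0 < \<beta>" and \<tau>: "\<tau>m \<le> \<tau>" "\<tau> \<le> \<tau>i" "0 < \<tau>m" and n: "0 \<le> n"
    and a: "\<beta> * Am \<le> a" "a \<le> Ab * \<beta>" and Am: "0 < Am" "Ab * \<beta> \<le> Am"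
    and S: "0 \<le> S \<tau>" and Q: "\<eta> \<le> Q \<tau>m" "0 \<le> Q \<tau>m"
    and ps: "p - s \<le> l + e" "0 \<le> e" and p: "\<bar>p\<bar> \<le> Bp" and s: "\<bar>s\<bar> \<le> Bs"
  shows "1/2 * Am * \<beta> * \<eta> \<le> a * Q \<tau> - 1/2 * a * \<beta> * S \<tau> + 1/2 * Ab * \<beta>\<^sup>2 * (\<tau>m * l)
    + \<beta>\<^sup>2 * (1/2 * Ab * ((\<tau>i + \<tau>m) / 2 * e))
    + (\<beta> * ((Ab * \<tau>i - Am * \<tau>m) * Bp) + 1/2 * \<beta>\<^sup>2 * ((Ab * \<tau>i - Am * \<tau>m) * Bs))"
proof -
  define mid where "mid = (\<tau>i + \<tau>m) / 2"
  define V where "V = Ab * \<tau>i - Am * \<tau>m"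
  have Ab: "0 < Ab" using a \<beta> Am by (metis less_le_trans mult_pos_pos zero_less_mult_pos2)
  have AmAb: "Am \<le> Ab" using a \<beta> by (metis mult.commute mult_le_cancel_right_pos order_trans)
  have V1: "a * \<tau> - \<beta> * Am * \<tau>m \<le> \<beta> * V"
  proof -
    have "a * \<tau> \<le> Ab * \<beta> * \<tau>i" using a \<tau> Ab \<beta> by (intro mult_mono) auto
    then show ?thesis by (simp add: V_def algebra_simps)
  qed
  have V0: "0 \<le> a * \<tau> - \<beta> * Am * \<tau>m"
  proof -
    have "0 \<le> \<beta> * Am" using \<beta> Am by simp
    then have "\<beta> * Am * \<tau>m \<le> a * \<tau>" using a \<tau> by (intro mult_mono) auto
    then show ?thesis by simp
  qed
  have V2: "Ab * (\<tau> - \<tau>m) \<le> V"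
  proof -
    have "Ab * \<tau> \<le> Ab * \<tau>i" "Am * \<tau>m \<le> Ab * \<tau>m" using \<tau> Ab AmAb by auto
    then show ?thesis by (simp add: V_def algebra_simps)
  qed
  have "(a * \<tau> - \<beta> * Am * \<tau>m) * p \<le> \<beta> * V * Bp"
  proof -
    have "(a * \<tau> - \<beta> * Am * \<tau>m) * p \<le> (a * \<tau> - \<beta> * Am * \<tau>m) * Bp"
      using V0 p by (intro mult_left_mono) auto
    also have "\<dots> \<le> \<beta> * V * Bp" using V1 p by (intro mult_right_mono) auto
    finally show ?thesis .
  qed
  moreover have "\<beta> * Am * n \<le> a * n" using a n by (intro mult_right_mono) auto
  ultimately have 1: "\<beta> * Am * Q \<tau>m - \<beta> * V * Bp \<le> a * Q \<tau>"
    by (simp add: Q_def algebra_simps)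
  have 2: "a * (\<beta> * S \<tau>) \<le> Ab * \<beta> * (\<beta> * S \<tau>)" using a \<beta> S by (intro mult_right_mono) auto
  have 3: "Ab * \<beta> * (\<beta> * Q \<tau>m) \<le> Am * (\<beta> * Q \<tau>m)" using Am \<beta> Q by (intro mult_right_mono) auto
  have 4: "Am * \<beta> * \<eta> \<le> Am * \<beta> * Q \<tau>m" using Am \<beta> Q by (intro mult_left_mono) auto
  have "- (Ab * (\<tau> - \<tau>m) * s) \<le> V * Bs"
  proof -
    have "- (Ab * (\<tau> - \<tau>m) * s) = Ab * (\<tau> - \<tau>m) * (- s)" by simp
    also have "\<dots> \<le> Ab * (\<tau> - \<tau>m) * Bs" using Ab \<tau> s by (intro mult_left_mono) auto
    also have "\<dots> \<le> V * Bs" using V2 s by (intro mult_right_mono) auto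
    finally show ?thesis .
  qed
  moreover have "Ab * (\<tau>m * (p - s)) \<le> Ab * (\<tau>m * (l + e))"
    using ps \<tau> Ab by (intro mult_left_mono) auto
  \<comment> \<open>A deliberate loss: the quadratic error receives the same weight as in the good
    case, and the two cases then share one bound.\<close>
  moreover have "Ab * (\<tau>m * e) \<le> Ab * (mid * e)"
    using ps \<tau> Ab by (intro mult_left_mono mult_right_mono) (auto simp: mid_def)
  ultimately have "Ab * S \<tau> \<le> Ab * Q \<tau>m + Ab * (\<tau>m * l) + Ab * (mid * e) + V * Bs"
    unfolding Q_def S_def by (simp add: algebra_simps)
  then have "\<beta>\<^sup>2 * (Ab * S \<tau>) \<le> \<beta>\<^sup>2 * (Ab * Q \<tau>m + Ab * (\<tau>m * l) + Ab * (mid * e) + V * Bs)"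
    by (intro mult_left_mono) auto
  with 1 2 3 4 show ?thesis unfolding V_def[symmetric] mid_def[symmetric] by (simp add: algebra_simps power2_eq_square)
qed

text \<open>Here \<open>K * \<tau>'\<close> is the product of step size and merit parameter that would be used if the
  merit parameter \<open>\<tau>'\<close> were kept; only its positive deviation is of order \<open>\<beta>\<^sup>2\<close>, the negative one
  hurts only when \<open>r\<close> is negative and the parameter decreases.\<close>

lemma first_order_error:
  fixes r R :: real
  assumes \<tau>: "0 < \<tau>m" "\<tau>m \<le> \<tau>" "\<tau> \<le> \<tau>'" "\<tau>' \<le> \<tau>i" and \<beta>: "0 < \<beta>" "0 \<le> \<theta>"
    and A: "Am \<le> A" "A \<le> K" "K \<le> AM" "0 < Am" "\<tau> = \<tau>' \<Longrightarrow> K = A"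
    and a: "\<beta> * A \<le> a" "a \<le> \<beta> * A + \<theta> * \<beta>\<^sup>2" and r: "\<bar>r\<bar> \<le> R"
  shows "a * \<tau> * r \<le> \<beta> * K * \<tau>' * r + \<beta>\<^sup>2 * (\<theta> * \<tau>i * R)
    + (if r < 0 \<and> \<tau> < \<tau>' then \<beta> * (((AM + \<theta> * \<beta>) * \<tau>i - Am * \<tau>m) * R) else 0)"
proof (cases "r < 0")
  case False
  have "a * \<tau> \<le> (\<beta> * A + \<theta> * \<beta>\<^sup>2) * \<tau>" using a \<tau> by (intro mult_right_mono) auto
  also have "\<dots> = \<beta> * (A * \<tau>) + \<theta> * \<beta>\<^sup>2 * \<tau>" by (simp add: algebra_simps)
  also have "\<dots> \<le> \<beta> * (K * \<tau>') + \<theta> * \<beta>\<^sup>2 * \<tau>i"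
    using A \<tau> \<beta> by (intro add_mono mult_left_mono mult_mono) auto
  finally have "a * \<tau> * r \<le> (\<beta> * (K * \<tau>') + \<theta> * \<beta>\<^sup>2 * \<tau>i) * r"
    using False by (intro mult_right_mono) auto
  also have "\<dots> = \<beta> * K * \<tau>' * r + \<theta> * \<beta>\<^sup>2 * \<tau>i * r" by (simp add: algebra_simps)
  also have "\<theta> * \<beta>\<^sup>2 * \<tau>i * r \<le> \<theta> * \<beta>\<^sup>2 * \<tau>i * R"
    using \<beta> \<tau> r by (intro mult_left_mono mult_nonneg_nonneg) auto
  finally show ?thesis using False by (simp add: algebra_simps)
next
  case True
  have "0 \<le> \<theta> * \<tau>i * R" using \<beta> \<tau> r by (intro mult_nonneg_nonneg) auto
  then have nonneg: "0 \<le> \<beta>\<^sup>2 * (\<theta> * \<tau>i * R)" by simp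
  show ?thesis
  proof (cases "\<tau> < \<tau>'")
    case False
    then have "\<tau> = \<tau>'" using \<tau> by simp
    moreover have "0 \<le> \<beta> * A" using A \<beta> by simp
    ultimately have "\<beta> * K * \<tau>' \<le> a * \<tau>" using A a \<tau> by (intro mult_mono) auto
    then have "a * \<tau> * r \<le> \<beta> * K * \<tau>' * r" using True by (intro mult_right_mono_neg) auto
    then show ?thesis using False nonneg by simp
  next
    \<comment> \<open>The only case that costs order \<open>\<beta>\<close>:
      \<open>K * \<tau>'\<close> may overshoot \<open>A * \<tau>\<close> by a large part of its
      whole range, and a negative \<open>r\<close> turns the overshoot into a loss.\<close>
    case less: True
    have "K * \<tau>' \<le> (AM + \<theta> * \<beta>) * \<tau>i" using A \<tau> \<beta> by (intro mult_mono) (auto simp: add_increasing2)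
    then have "\<beta> * (K * \<tau>') \<le> \<beta> * ((AM + \<theta> * \<beta>) * \<tau>i)" using \<beta> by (intro mult_left_mono) auto
    moreover have "\<beta> * Am * \<tau>m \<le> a * \<tau>"
    proof (intro mult_mono)
      show "\<beta> * Am \<le> a" using A a \<beta> mult_left_mono[of Am A \<beta>] by linarith
      then show "0 \<le> a" using A \<beta> mult_pos_pos[of \<beta> Am] by linarith
    qed (use \<tau> in auto)
    ultimately have *: "\<beta> * K * \<tau>' - a * \<tau> \<le> \<beta> * ((AM + \<theta> * \<beta>) * \<tau>i - Am * \<tau>m)"
      by (simp add: algebra_simps)
    have V: "0 \<le> \<beta> * ((AM + \<theta> * \<beta>) * \<tau>i - Am * \<tau>m)"
    proof -
      have "Am * \<tau>m \<le> (AM + \<theta> * \<beta>) * \<tau>i" using A \<tau> \<beta> by (intro mult_mono) (auto simp: add_increasing2)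
      then show ?thesis using \<beta> by simp
    qed
    have "(\<beta> * K * \<tau>' - a * \<tau>) * (- r) \<le> \<beta> * ((AM + \<theta> * \<beta>) * \<tau>i - Am * \<tau>m) * (- r)"
      using * True by (intro mult_right_mono) auto
    also have "\<dots> \<le> \<beta> * ((AM + \<theta> * \<beta>) * \<tau>i - Am * \<tau>m) * R"
      using V r by (intro mult_left_mono) auto
    finally have "a * \<tau> * r \<le> \<beta> * K * \<tau>' * r + \<beta> * ((AM + \<theta> * \<beta>) * \<tau>i - Am * \<tau>m) * R"
      by (simp add: algebra_simps)
    then show ?thesis using True less nonneg by (simp add: mult.assoc)
  qed
qed

subsection \<open>Measurability of a run\<close>

lemma borel_measurable_vec_nth:
  fixes f :: "'a \<Rightarrow> 'b::topological_space ^ 'n"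
  assumes "f \<in> borel_measurable M"
  shows "(\<lambda>x. f x $ i) \<in> borel_measurable M"
  by (rule borel_measurable_continuous_on[OF _ assms]) (intro continuous_intros)

lemma borel_measurable_vec:
  fixes f :: "'a \<Rightarrow> real ^ 'n::finite"
  assumes "\<And>i. (\<lambda>x. f x $ i) \<in> borel_measurable M"
  shows "f \<in> borel_measurable M"
proof (subst borel_measurable_euclidean_space, rule ballI)
  fix b :: "real ^ 'n" assume "b \<in> Basis"
  then obtain i where b: "b = axis i 1" by (auto simp: Basis_vec_def)
  have "f x \<bullet> b = f x $ i" for x by (simp only: b inner_axis inner_real_def mult_1_right)
  then show "(\<lambda>x. f x \<bullet> b) \<in> borel_measurable M" by (simp only: assms)
qed

lemma borel_measurable_det:
  fixes f :: "'a \<Rightarrow> real ^ 'n::finite ^ 'n"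
  assumes "\<And>i j. (\<lambda>x. f x $ i $ j) \<in> borel_measurable M"
  shows "(\<lambda>x. det (f x)) \<in> borel_measurable M"
  unfolding det_def
  by (intro borel_measurable_sum borel_measurable_times borel_measurable_prod borel_measurable_const assms)

lemma borel_measurable_mat_vec [measurable (raw)]:
  fixes f :: "'a \<Rightarrow> real ^ 'n::finite ^ 'm::finite"
  assumes [measurable]: "f \<in> borel_measurable M" "g \<in> borel_measurable M"
  shows "(\<lambda>x. f x *v g x) \<in> borel_measurable M"
  unfolding matrix_vector_mult_def
  by (intro borel_measurable_vec, unfold vec_lambda_beta)
    (intro borel_measurable_sum borel_measurable_times borel_measurable_vec_nth assms)

lemma borel_measurable_norm1 [measurable (raw)]:
  fixes f :: "'a \<Rightarrow> real ^ 'm::finite"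
  assumes [measurable]: "f \<in> borel_measurable M"
  shows "(\<lambda>x. norm1 (f x)) \<in> borel_measurable M"
  unfolding norm1_def
  by (intro borel_measurable_sum borel_measurable_abs borel_measurable_vec_nth assms)

lemma borel_measurable_kkt_dir:
  fixes H :: "'a \<Rightarrow> real ^ 'n::finite ^ 'n" and J :: "'a \<Rightarrow> real ^ 'n ^ 'm::finite"
  assumes [measurable]: "H \<in> borel_measurable M" "J \<in> borel_measurable M"
    "g \<in> borel_measurable M" "c \<in> borel_measurable M"
  shows "(\<lambda>x. kkt_dir (H x) (J x) (g x) (c x)) \<in> borel_measurable M"
proof -
  have mat: "(\<lambda>x. kkt_mat (H x) (J x) $ i $ j) \<in> borel_measurable M" for i j
    by (cases i; cases j; simp only: kkt_mat_def vec_lambda_beta sum.case)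
      (intro borel_measurable_vec_nth assms borel_measurable_const)+
  have rhs: "(\<lambda>x. kkt_rhs (g x) (c x) $ i) \<in> borel_measurable M" for i
    by (cases i; simp only: kkt_rhs_def vec_lambda_beta sum.case)
      (intro borel_measurable_uminus borel_measurable_vec_nth assms)+
  have num: "(\<lambda>x. det (\<chi> i j. if j = k then kkt_rhs (g x) (c x) $ i
      else kkt_mat (H x) (J x) $ i $ j)) \<in> borel_measurable M" for k
  proof (rule borel_measurable_det)
    fix i j
    show "(\<lambda>x. (\<chi> i j. if j = k then kkt_rhs (g x) (c x) $ i
      else kkt_mat (H x) (J x) $ i $ j) $ i $ j) \<in> borel_measurable M"
      by (cases "j = k") (simp_all add: mat rhs)
  qed
  have den: "(\<lambda>x. det (kkt_mat (H x) (J x))) \<in> borel_measurable M"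
    by (rule borel_measurable_det) (rule mat)
  show ?thesis
    by (rule borel_measurable_vec) (simp add: kkt_dir_def kkt_sol_def borel_measurable_divide[OF num den])
qed

text \<open>The problem functions are regular on the region only and arbitrary elsewhere, so
  measurability must use that the iterates never leave it.\<close>

lemma borel_measurable_continuous_on_open:
  assumes "open S" "continuous_on S f" "X \<in> borel_measurable M" "\<And>\<omega>. \<omega> \<in> space M \<Longrightarrow> X \<omega> \<in> S"
  shows "(\<lambda>\<omega>. f (X \<omega>)) \<in> borel_measurable M"
proof -
  have "X \<in> measurable M (restrict_space borel S)"
    using assms by (intro measurable_restrict_space2) auto
  from measurable_compose[OF this borel_measurable_continuous_on_restrict[OF assms(2)]]
  show ?thesis .
qed

text \<open>A form without extended reals, built from operations whose measurability is automatic.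
  The next two lemmas serve the same purpose.\<close>

lemma tau_update_trial_eq:
  "tau_update \<epsilon> \<tau> (tau_trial s c g H d) =
    (let q = g \<bullet> d + max (d \<bullet> (H *v d)) 0; t = (1 - s) * norm1 c / q
     in if q \<le> 0 \<or> \<tau> \<le> t then \<tau> else (1 - \<epsilon>) * t)"
  by (simp add: tau_update_def tau_trial_def Let_def)

lemma le_tau_trial_iff:
  "ereal \<tau> \<le> tau_trial s c g H d \<longleftrightarrow>
    (let q = g \<bullet> d + max (d \<bullet> (H *v d)) 0 in q \<le> 0 \<or> \<tau> \<le> (1 - s) * norm1 c / q)"
  by (simp add: tau_trial_def Let_def)

lemma step_size_eq:
  assumes "0 \<le> \<theta>"
  shows "step_size L \<Gamma> \<theta> \<beta> \<tau> \<xi> c q d =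
     (let hat_init = \<beta> * q / ((\<tau> * L + \<Gamma>) * (norm d)^2);
          tilde_init = hat_init - 4 * norm1 c / ((\<tau> * L + \<Gamma>) * (norm d)^2);
          lo = \<beta> * \<xi> * \<tau> / (\<tau> * L + \<Gamma>);
          hat = max lo (min (lo + \<theta> * \<beta>^2) hat_init);
          tilde = max lo (min (lo + \<theta> * \<beta>^2) tilde_init)
      in if hat < 1 then hat else if tilde \<le> 1 then 1 else tilde)"
  using assms by (simp add: step_size_def Let_def closest_point_interval)

section \<open>A run of the method and its adaptedness\<close>

locale sqp =
  fixes P :: "('n::finite, 'm::finite) sqp_problem"
    and A :: "'n sqp_params"
    and C :: sqp_consts
    and kmax smax :: nat
    and \<beta> :: "nat \<Rightarrow> real"
    and R :: "('w, 'n, 'm) sqp_process"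
  assumes smooth: "smooth_problem P"
    and adm_params: "admissible_params P A"
    and adm_consts: "admissible_consts C"
    and setting: "sqp_setting P A C kmax smax \<beta> R"
begin

abbreviation "M \<equiv> pspace R"
abbreviation "E \<equiv> event_E P A C kmax smax R"
abbreviation "ME \<equiv> cond_on P A C kmax smax R"
abbreviation "X \<equiv> rX R"
abbreviation "G \<equiv> rG R"
abbreviation "H \<equiv> rH R"
abbreviation "D \<equiv> rD R"
abbreviation "\<tau> \<equiv> rTau R"
abbreviation "\<tau>' \<equiv> tau_before A R"
abbreviation "g \<equiv> grad_at P R"
abbreviation "d \<equiv> rDtrue R"
abbreviation "J k \<omega> \<equiv> Jac P (X k \<omega>)"
abbreviation "c k \<omega> \<equiv> con P (X k \<omega>)"
abbreviation "L \<equiv> lip_obj P"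

definition "\<xi>' k \<omega> = prev (xi_init A) (\<lambda>j. rXi R j \<omega>) k"

text \<open>The vector that \<open>kkt_perturbation\<close> pairs with the gradient error. Its data
  are the matrix, Jacobian and true gradient at the iterate, so it is determined by the
  past.\<close>

definition "z k \<omega> = kkt_dir (H k \<omega>) (J k \<omega>) (g k \<omega>) 0"

lemma settingD:
  shows "prob_space M" "uniform_index kmax R" "A3 P A C kmax smax R" "A4 P A C kmax smax R"
    and "0 < measure M E"
    and "\<And>k. k \<le> kmax \<Longrightarrow> 0 < \<beta> k \<and> \<beta> k \<le> 1"
    and "\<And>k. k \<le> kmax \<Longrightarrow> G k \<in> borel_measurable M"
    and "\<And>k. k \<le> kmax \<Longrightarrow> H k \<in> borel_measurable (hist R k)"
    and "\<And>k \<omega>. \<omega> \<in> space M \<Longrightarrow> k \<le> Suc kmax \<Longrightarrow> X k \<omega> \<in> region P"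
    and "\<And>k \<omega>. \<omega> \<in> space M \<Longrightarrow> k \<le> kmax \<Longrightarrow> norm (g k \<omega>) \<le> kap_g C"
    and "\<And>k \<omega>. \<omega> \<in> space M \<Longrightarrow> k \<le> kmax \<Longrightarrow> transpose (H k \<omega>) = H k \<omega> \<and> mat_norm (H k \<omega>) \<le> kap_H C"
    and "\<And>\<omega>. \<omega> \<in> space M \<Longrightarrow> sqp_run P A kmax \<beta> (\<lambda>k. G k \<omega>) (\<lambda>k. H k \<omega>) (\<lambda>k. X k \<omega>) (\<lambda>k. D k \<omega>)
          (\<lambda>k. rY R k \<omega>) (\<lambda>k. \<tau> k \<omega>) (\<lambda>k. rXi R k \<omega>) (\<lambda>k. rAlpha R k \<omega>)"
    and "\<And>k \<omega>. \<omega> \<in> space M \<Longrightarrow> k \<le> kmax \<Longrightarrow>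
      kkt (H k \<omega>) (J k \<omega>) (g k \<omega>) (c k \<omega>) (d k \<omega>) (rYtrue R k \<omega>)"
    and "\<And>k \<omega> u. \<omega> \<in> space M \<Longrightarrow> k \<le> kmax \<Longrightarrow> J k \<omega> *v u = 0 \<Longrightarrow>
      zeta_c C * (norm u)^2 \<le> u \<bullet> (H k \<omega> *v u)"
  using setting
  unfolding sqp_setting_def sqp_process_spec_def A1_run_def A2_def by auto

lemma constsD:
  shows "0 < kap_g C" "0 < kap_H C" "0 < zeta_c C" "0 < tau_min C" "0 < xi_min C"
    "0 < M_var C" "0 < M_tau C" "0 < p_tau C" "p_tau C \<le> 1"
    "0 < kap_d C" "0 < kap_uv C" "0 < kap_Psi C" "0 < kap_q C"
  using adm_consts unfolding admissible_consts_def by auto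

lemma paramsD:
  shows "0 < tau_init A" "0 < xi_init A" "0 < eps_tau A" "eps_tau A < 1" "0 < eps_xi A" "eps_xi A < 1"
    "0 < sig A" "sig A < 1" "0 \<le> theta A" "(\<Sum>i\<in>UNIV. lip_con P i) \<le> Gam A" "0 < Gam A" "0 < L"
proof -
  have "0 < (\<Sum>i\<in>UNIV. lip_con P i)" using smooth_problemD(10)[OF smooth] by (intro sum_pos) auto
  then show "0 < Gam A" using adm_params unfolding admissible_params_def by linarith
qed (use adm_params smooth_problemD(7)[OF smooth] in \<open>auto simp: admissible_params_def\<close>)

lemma run_zero: "\<omega> \<in> space M \<Longrightarrow> X 0 \<omega> = x_init A"
  using settingD(12) unfolding sqp_run_def by blast

lemma run_step:
  assumes "\<omega> \<in> space M" "k \<le> kmax"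
  shows "kkt (H k \<omega>) (J k \<omega>) (G k \<omega>) (c k \<omega>) (D k \<omega>) (rY R k \<omega>)"
    and "X (Suc k) \<omega> = X k \<omega> + rAlpha R k \<omega> *\<^sub>R D k \<omega>"
    and "\<tau> k \<omega> = (if D k \<omega> = 0 then \<tau>' k \<omega>
      else tau_update (eps_tau A) (\<tau>' k \<omega>) (tau_trial (sig A) (c k \<omega>) (G k \<omega>) (H k \<omega>) (D k \<omega>)))"
    and "rXi R k \<omega> = (if D k \<omega> = 0 then \<xi>' k \<omega>
      else xi_update (eps_xi A) (\<xi>' k \<omega>)
        (delta_q (c k \<omega>) (\<tau> k \<omega>) (G k \<omega>) (H k \<omega>) (D k \<omega>) / (\<tau> k \<omega> * (norm (D k \<omega>))^2)))"
    and "rAlpha R k \<omega> = (if D k \<omega> = 0 then 1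
      else step_size L (Gam A) (theta A) (\<beta> k) (\<tau> k \<omega>) (rXi R k \<omega>) (c k \<omega>)
        (delta_q (c k \<omega>) (\<tau> k \<omega>) (G k \<omega>) (H k \<omega>) (D k \<omega>)) (D k \<omega>))"
  using settingD(12)[OF assms(1)] assms(2)
  unfolding sqp_run_def Let_def tau_before_def \<xi>'_def by auto

lemma prev_Suc: "\<tau>' (Suc k) \<omega> = \<tau> k \<omega>" "\<xi>' (Suc k) \<omega> = rXi R k \<omega>"
  "\<tau>' 0 \<omega> = tau_init A" "\<xi>' 0 \<omega> = xi_init A"
  by (simp_all add: tau_before_def \<xi>'_def prev_def)

lemma pos_def:
  assumes "\<omega> \<in> space M" "k \<le> kmax"
  shows "pos_def_on_null (zeta_c C) (H k \<omega>) (J k \<omega>)"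
proof -
  have "X k \<omega> \<in> region P" using assms settingD(9) by simp
  then show ?thesis
    unfolding pos_def_on_null_def
    using constsD(3) settingD(11,14)[OF assms] transpose_Jac_eq_0D[OF smooth] by blast
qed

text \<open>Uniqueness turns the relational specification of the direction into an explicit formula,
  on which its measurability rests.\<close>

lemma D_eq: "\<omega> \<in> space M \<Longrightarrow> k \<le> kmax \<Longrightarrow> D k \<omega> = kkt_dir (H k \<omega>) (J k \<omega>) (G k \<omega>) (c k \<omega>)"
  using kkt_unique[OF pos_def run_step(1)] .

lemma d_eq: "\<omega> \<in> space M \<Longrightarrow> k \<le> kmax \<Longrightarrow> d k \<omega> = kkt_dir (H k \<omega>) (J k \<omega>) (g k \<omega>) (c k \<omega>)"
  using kkt_unique[OF pos_def settingD(13)] .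

lemma space_hist [simp]: "space (hist R k) = space M"
  by (simp add: hist_def)

lemma measurable_hist_G: "i < k \<Longrightarrow> G i \<in> borel_measurable (hist R k)"
proof -
  assume i: "i < k"
  have "(\<lambda>\<omega>. \<lambda>i\<in>{..<k}. G i \<omega>) \<in> measurable (hist R k) (\<Pi>\<^sub>M i\<in>{..<k}. borel)"
    unfolding hist_def by (rule measurable_vimage_algebra1) (auto simp: space_PiM)
  from measurable_compose[OF this measurable_component_singleton[of i]] i
  show ?thesis by simp
qed

lemma hist_subset:
  assumes "space N = space M" "\<And>i. i < k \<Longrightarrow> G i \<in> borel_measurable N"
  shows "sets (hist R k) \<subseteq> sets N"
  unfolding hist_def
  by (rule sets_image_in_sets[OF assms(1)]) (intro measurable_restrict assms(2), simp)

lemma measurable_hist_mono: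
  assumes "f \<in> measurable (hist R i) N" "i \<le> k"
  shows "f \<in> measurable (hist R k) N"
proof -
  have "sets (hist R i) \<subseteq> sets (hist R k)"
    using assms(2) by (intro hist_subset measurable_hist_G) auto
  with assms(1) show ?thesis by (auto simp: measurable_def)
qed

lemma subalgebra_hist: "k \<le> Suc kmax \<Longrightarrow> subalgebra M (hist R k)"
  unfolding subalgebra_def space_hist by (intro conjI refl hist_subset settingD(7)) auto

lemma borel_measurable_at_iterate:
  fixes N :: "'w measure"
  assumes "k \<le> Suc kmax" "space N = space M" "X k \<in> borel_measurable N"
  shows "J k \<in> borel_measurable N" "c k \<in> borel_measurable N" "g k \<in> borel_measurable N"
proof -
  note * = borel_measurable_continuous_on_open[OF smooth_problemD(1)[OF smooth] _ assms(3)]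
  have X: "\<And>\<omega>. \<omega> \<in> space N \<Longrightarrow> X k \<omega> \<in> region P" using settingD(9) assms by simp
  show "J k \<in> borel_measurable N"
    using *[OF continuous_on_Jac[OF smooth] X] .
  have "continuous_on (region P) (con P)"
    by (rule differentiable_imp_continuous_on)
      (use smooth_problemD(4)[OF smooth] in \<open>auto intro: differentiable_at_imp_differentiable_on\<close>)
  from *[OF this X] show "c k \<in> borel_measurable N" .
  show "g k \<in> borel_measurable N"
    unfolding grad_at_def using *[OF smooth_problemD(5)[OF smooth] X] .
qed

text \<open>The process postulates measurability for gradients and matrices alone. The rest is
  derived: each new quantity is an explicit measurable expression in the history and
  \<open>G k\<close>.\<close>

lemma borel_measurable_step:
  assumes k: "k \<le> kmax"
    and meas: "X k \<in> borel_measurable (hist R k)" "\<tau>' k \<in> borel_measurable (hist R k)"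
      "\<xi>' k \<in> borel_measurable (hist R k)"
  defines "N \<equiv> hist R (Suc k)"
  shows "D k \<in> borel_measurable N" "\<tau> k \<in> borel_measurable N" "rXi R k \<in> borel_measurable N"
    "X (Suc k) \<in> borel_measurable N"
proof -
  have up: "f \<in> borel_measurable N" if "f \<in> borel_measurable (hist R k)" for f :: "'w \<Rightarrow> 'z::topological_space"
    unfolding N_def using that by (rule measurable_hist_mono) simp
  have spN: "space N = space M" by (simp add: N_def)
  note [measurable] = meas[THEN up] settingD(8)[OF k, THEN up]
  have Jk [measurable]: "J k \<in> borel_measurable N" and ck [measurable]: "c k \<in> borel_measurable N"
    using borel_measurable_at_iterate[OF _ spN meas(1)[THEN up]] k by auto
  have Gk [measurable]: "G k \<in> borel_measurable N" unfolding N_def by (rule measurable_hist_G) simp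
  note eq = D_eq[OF _ k] run_step[OF _ k]
  have D': "(\<lambda>\<omega>. kkt_dir (H k \<omega>) (J k \<omega>) (G k \<omega>) (c k \<omega>)) \<in> borel_measurable N"
    by (intro borel_measurable_kkt_dir) measurable
  show D [measurable]: "D k \<in> borel_measurable N"
    by (rule measurable_cong[THEN iffD1, OF _ D']) (simp add: spN eq(1))
  have q [measurable]: "(\<lambda>\<omega>. D k \<omega> \<bullet> (H k \<omega> *v D k \<omega>)) \<in> borel_measurable N" by measurable
  have T': "(\<lambda>\<omega>. if D k \<omega> = 0 then \<tau>' k \<omega>
      else tau_update (eps_tau A) (\<tau>' k \<omega>) (tau_trial (sig A) (c k \<omega>) (G k \<omega>) (H k \<omega>) (D k \<omega>)))
      \<in> borel_measurable N"
    unfolding tau_update_trial_eq Let_def by measurable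
  show T [measurable]: "\<tau> k \<in> borel_measurable N"
    by (rule measurable_cong[THEN iffD1, OF _ T']) (simp add: spN run_step(3)[OF _ k])
  have Q [measurable]: "(\<lambda>\<omega>. delta_q (c k \<omega>) (\<tau> k \<omega>) (G k \<omega>) (H k \<omega>) (D k \<omega>)) \<in> borel_measurable N"
    unfolding delta_q_def by measurable
  have Xi': "(\<lambda>\<omega>. if D k \<omega> = 0 then \<xi>' k \<omega>
      else xi_update (eps_xi A) (\<xi>' k \<omega>)
        (delta_q (c k \<omega>) (\<tau> k \<omega>) (G k \<omega>) (H k \<omega>) (D k \<omega>) / (\<tau> k \<omega> * (norm (D k \<omega>))^2)))
      \<in> borel_measurable N"
    unfolding xi_update_def by measurable
  show Xi [measurable]: "rXi R k \<in> borel_measurable N"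
    by (rule measurable_cong[THEN iffD1, OF _ Xi']) (simp add: spN run_step(4)[OF _ k])
  have "(\<lambda>\<omega>. X k \<omega> + (if D k \<omega> = 0 then 1
      else step_size L (Gam A) (theta A) (\<beta> k) (\<tau> k \<omega>) (rXi R k \<omega>) (c k \<omega>)
        (delta_q (c k \<omega>) (\<tau> k \<omega>) (G k \<omega>) (H k \<omega>) (D k \<omega>)) (D k \<omega>)) *\<^sub>R D k \<omega>) \<in> borel_measurable N"
    unfolding step_size_eq[OF paramsD(9)] Let_def by measurable
  then show "X (Suc k) \<in> borel_measurable N"
    by (rule measurable_cong[THEN iffD1, rotated]) (simp add: spN run_step(2,5)[OF _ k])
qed

lemma borel_measurable_state:
  assumes "k \<le> Suc kmax"
  shows "X k \<in> borel_measurable (hist R k)" "\<tau>' k \<in> borel_measurable (hist R k)"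
    "\<xi>' k \<in> borel_measurable (hist R k)"
proof -
  have "X k \<in> borel_measurable (hist R k) \<and> \<tau>' k \<in> borel_measurable (hist R k) \<and>
    \<xi>' k \<in> borel_measurable (hist R k)"
    using assms
  proof (induction k)
    case 0
    have "X 0 \<in> borel_measurable (hist R 0)"
      by (rule measurable_cong[THEN iffD1, of _ "\<lambda>_. x_init A"]) (auto simp: run_zero)
    then show ?case by (simp add: prev_Suc)
  next
    case (Suc k)
    then show ?case using borel_measurable_step[of k] by (simp add: prev_Suc)
  qed
  then show "X k \<in> borel_measurable (hist R k)" "\<tau>' k \<in> borel_measurable (hist R k)"
    "\<xi>' k \<in> borel_measurable (hist R k)" by auto
qed

lemma borel_measurable_hist:
  assumes k: "k \<le> kmax"
  shows "c k \<in> borel_measurable (hist R k)" "g k \<in> borel_measurable (hist R k)"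
    "d k \<in> borel_measurable (hist R k)" "z k \<in> borel_measurable (hist R k)"
    "Measurable.pred (hist R k) (\<lambda>\<omega>. ereal (\<tau>' k \<omega>) \<le> tau_trial_true P A R k \<omega>)"
    "Measurable.pred (hist R k) (\<lambda>\<omega>. ereal t \<le> tau_trial_true P A R k \<omega>)"
proof -
  note [measurable] = settingD(8)[OF k]
  have [measurable]: "X k \<in> borel_measurable (hist R k)" "\<tau>' k \<in> borel_measurable (hist R k)"
    using borel_measurable_state[of k] k by auto
  have Jm [measurable]: "J k \<in> borel_measurable (hist R k)" and
    cm [measurable]: "c k \<in> borel_measurable (hist R k)" and
    gm [measurable]: "g k \<in> borel_measurable (hist R k)"
    using borel_measurable_at_iterate[of k "hist R k"] k by auto
  show "c k \<in> borel_measurable (hist R k)" "g k \<in> borel_measurable (hist R k)" by fact+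
  have d': "(\<lambda>\<omega>. kkt_dir (H k \<omega>) (J k \<omega>) (g k \<omega>) (c k \<omega>)) \<in> borel_measurable (hist R k)"
    by (intro borel_measurable_kkt_dir) measurable
  show d [measurable]: "d k \<in> borel_measurable (hist R k)"
    by (rule measurable_cong[THEN iffD1, OF _ d']) (simp add: d_eq[OF _ k])
  show "z k \<in> borel_measurable (hist R k)"
    unfolding z_def by (intro borel_measurable_kkt_dir) measurable
  show "Measurable.pred (hist R k) (\<lambda>\<omega>. ereal (\<tau>' k \<omega>) \<le> tau_trial_true P A R k \<omega>)"
    "Measurable.pred (hist R k) (\<lambda>\<omega>. ereal t \<le> tau_trial_true P A R k \<omega>)"
    unfolding tau_trial_true_def le_tau_trial_iff Let_def by measurable
qed

text \<open>Measurability with respect to the gradients, rather than just the whole space, is what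
  later makes the event independent of the returned index.\<close>

lemma event_E_hist: "E \<in> sets (hist R (Suc kmax))"
proof -
  let ?N = "hist R (Suc kmax)"
  have T: "\<tau> k \<in> borel_measurable ?N" "rXi R k \<in> borel_measurable ?N" "\<tau>' k \<in> borel_measurable ?N"
    "Measurable.pred ?N (\<lambda>\<omega>. ereal (tau_min C) \<le> tau_trial_true P A R k \<omega>)"
    if "k \<le> kmax" for k
    using that borel_measurable_step(2,3)[OF that borel_measurable_state] borel_measurable_state(2)[of k]
    by (auto intro: measurable_hist_mono[where k = "Suc kmax"] measurable_hist_mono[OF borel_measurable_hist(6)])
  \<comment> \<open>The cardinality is recast as a finite sum of indicators to make the condition
    visibly measurable.\<close>
  have E_eq: "E = {\<omega> \<in> space ?N.
      (\<forall>k\<in>{..kmax}. tau_min C \<le> \<tau> k \<omega> \<and> ereal (tau_min C) \<le> tau_trial_true P A R k \<omega> \<and>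
                   rXi R k \<omega> = xi_min C) \<and>
      (\<Sum>k\<in>{..kmax}. if \<tau> k \<omega> < \<tau>' k \<omega> then 1 else 0) \<le> real smax}"
  proof -
    have "(\<Sum>k\<in>{..kmax}. if \<tau> k \<omega> < \<tau>' k \<omega> then 1 else 0) = real (card {k. k \<le> kmax \<and> \<tau> k \<omega> < \<tau>' k \<omega>})" for \<omega>
    proof -
      have "{k. k \<le> kmax \<and> \<tau> k \<omega> < \<tau>' k \<omega>} = {..kmax} \<inter> {k. \<tau> k \<omega> < \<tau>' k \<omega>}" by auto
      then show ?thesis by (simp add: sum.If_cases)
    qed
    then show ?thesis by (auto simp: event_E_def)
  qed
  show ?thesis
    unfolding E_eq pred_def[symmetric]
  proof (intro pred_intros_logic pred_intros_finite)
    fix k assume "k \<in> {..kmax}"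
    then have [measurable]: "\<tau> k \<in> borel_measurable ?N" "rXi R k \<in> borel_measurable ?N"
      "Measurable.pred ?N (\<lambda>\<omega>. ereal (tau_min C) \<le> tau_trial_true P A R k \<omega>)"
      using T by auto
    show "Measurable.pred ?N (\<lambda>\<omega>. tau_min C \<le> \<tau> k \<omega>)" by measurable
    show "Measurable.pred ?N (\<lambda>\<omega>. ereal (tau_min C) \<le> tau_trial_true P A R k \<omega>)" by measurable
    show "Measurable.pred ?N (\<lambda>\<omega>. rXi R k \<omega> = xi_min C)" by measurable
  next
    have "(\<lambda>\<omega>. \<Sum>k\<in>{..kmax}. if \<tau> k \<omega> < \<tau>' k \<omega> then 1 else 0 :: real) \<in> borel_measurable ?N"
    proof (rule borel_measurable_sum)
      fix k assume "k \<in> {..kmax}"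
      then have [measurable]: "\<tau> k \<in> borel_measurable ?N" "\<tau>' k \<in> borel_measurable ?N"
        using T by auto
      show "(\<lambda>\<omega>. if \<tau> k \<omega> < \<tau>' k \<omega> then 1 else 0 :: real) \<in> borel_measurable ?N" by measurable
    qed
    then show "Measurable.pred ?N (\<lambda>\<omega>. (\<Sum>k\<in>{..kmax}. if \<tau> k \<omega> < \<tau>' k \<omega> then 1 else 0) \<le> real smax)"
      by measurable
  qed auto
qed

end

section \<open>Deterministic bounds on the event\<close>

context sqp
begin

lemma event_ED:
  assumes "\<omega> \<in> E"
  shows "\<omega> \<in> space M"
    and "k \<le> kmax \<Longrightarrow> tau_min C \<le> \<tau> k \<omega>"
    and "k \<le> kmax \<Longrightarrow> ereal (tau_min C) \<le> tau_trial_true P A R k \<omega>"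
    and "k \<le> kmax \<Longrightarrow> rXi R k \<omega> = xi_min C"
  using assms unfolding event_E_def by auto

lemma event_E_nonempty: "E \<noteq> {}"
  using settingD(5) by force

lemma tau_decreasing: "\<omega> \<in> space M \<Longrightarrow> k \<le> kmax \<Longrightarrow> \<tau> k \<omega> \<le> \<tau>' k \<omega>"
  by (subst run_step(3)) (auto intro: tau_update_trial(1)[OF paramsD(3,4,8)])

lemma tau_before_le_init: "\<omega> \<in> space M \<Longrightarrow> k \<le> Suc kmax \<Longrightarrow> \<tau>' k \<omega> \<le> tau_init A"
proof (induction k)
  case (Suc k)
  then show ?case using tau_decreasing[of \<omega> k] by (simp add: prev_Suc)
qed (simp add: prev_Suc)

lemma tau_bounds:
  assumes "\<omega> \<in> E" "k \<le> kmax"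
  shows "0 < \<tau> k \<omega>" "tau_min C \<le> \<tau> k \<omega>" "\<tau> k \<omega> \<le> \<tau>' k \<omega>" "\<tau>' k \<omega> \<le> tau_init A" "tau_min C \<le> \<tau>' k \<omega>"
    "tau_min C \<le> tau_init A"
  using event_ED[OF assms(1)] assms(2) tau_decreasing[of \<omega> k] tau_before_le_init[of \<omega> k] constsD(4)
  by (force, force, force, force, force, force)

lemma tau_min_le_init: "tau_min C \<le> tau_init A"
  using event_E_nonempty tau_bounds(6)[of _ 0] by blast

lemma xi_min_le:
  assumes "\<omega> \<in> E" "k \<le> kmax" "D k \<omega> \<noteq> 0"
  shows "xi_min C \<le> delta_q (c k \<omega>) (\<tau> k \<omega>) (G k \<omega>) (H k \<omega>) (D k \<omega>) / (\<tau> k \<omega> * (norm (D k \<omega>))^2)"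
  using run_step(4)[OF event_ED(1)[OF assms(1)] assms(2)] event_ED(4)[OF assms(1,2)] assms(3)
    xi_update_le(1)[OF paramsD(5,6)] constsD(5) by metis

lemma xi_min_le_init: "xi_min C \<le> xi_init A"
proof -
  obtain \<omega> where \<omega>: "\<omega> \<in> E" using event_E_nonempty by blast
  have "xi_min C = (if D 0 \<omega> = 0 then xi_init A else xi_update (eps_xi A) (xi_init A)
        (delta_q (c 0 \<omega>) (\<tau> 0 \<omega>) (G 0 \<omega>) (H 0 \<omega>) (D 0 \<omega>) / (\<tau> 0 \<omega> * (norm (D 0 \<omega>))^2)))"
    using run_step(4)[OF event_ED(1)[OF \<omega>], of 0] event_ED(4)[OF \<omega>, of 0] by (simp add: prev_Suc)
  then show ?thesis
    using xi_update_le(2)[OF paramsD(5,6)] constsD(5) by (metis order_refl)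
qed

text \<open>With \<open>\<xi> = xi_min\<close> and merit parameter \<open>t\<close>, the left end of
  the projection interval is \<open>\<beta> k * A_fun t\<close>.\<close>

definition "A_fun t = xi_min C * t / (t * L + Gam A)"

lemma A_fun_mono:
  assumes "0 < s" "s \<le> t"
  shows "A_fun s \<le> A_fun t"
proof -
  have pos: "0 < s * L + Gam A" "0 < t * L + Gam A"
    using assms paramsD(11,12) by (auto intro!: add_nonneg_pos)
  have "s * (t * L + Gam A) \<le> t * (s * L + Gam A)"
    using assms paramsD(11) by (simp add: algebra_simps)
  then have "s / (s * L + Gam A) \<le> t / (t * L + Gam A)"
    using pos by (simp add: frac_le_eq divide_le_eq pos_divide_le_eq mult.commute field_simps)
  then have "xi_min C * (s / (s * L + Gam A)) \<le> xi_min C * (t / (t * L + Gam A))"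
    using constsD(5) by (intro mult_left_mono) auto
  then show ?thesis by (simp add: A_fun_def)
qed

lemma A_fun_tau_min: "A_fun (tau_min C) = A_min P A C"
  by (simp add: A_fun_def A_min_def)

lemma A_min_pos: "0 < A_min P A C"
  unfolding A_min_def using constsD paramsD(11,12) by (intro divide_pos_pos add_pos_pos mult_pos_pos) auto

lemma A_fun_le_max:
  assumes "0 < t" "t \<le> tau_init A"
  shows "A_fun t \<le> A_max P A"
proof -
  have "A_fun t \<le> A_fun (tau_init A)" using assms by (rule A_fun_mono)
  also have "\<dots> \<le> A_max P A"
    unfolding A_fun_def A_max_def using xi_min_le_init paramsD
    by (intro divide_right_mono mult_right_mono) auto
  finally show ?thesis .
qed

lemma A_min_le_max: "A_min P A C \<le> A_max P A"
  using A_fun_le_max[OF constsD(4) tau_min_le_init] by (simp add: A_fun_tau_min)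

definition "err k \<omega> = norm (G k \<omega> - g k \<omega>)"

definition "Z k \<omega> = (stationarity P R k \<omega>)^2 / (kap_H C)^2 + infeasibility P R k \<omega>"

definition "Q k \<omega> t = delta_q (c k \<omega>) t (g k \<omega>) (H k \<omega>) (d k \<omega>)"

text \<open>The exchange rate between the stationarity measure and the true model decrease:
  \<open>Z\<close> is at most \<open>kap_Psi + 1\<close> times \<open>Psi\<close>, and the decrease
  is at least \<open>kap_q * tau_min\<close> times \<open>Psi\<close>.\<close>

definition "\<eta> = kap_q C * tau_min C / (kap_Psi C + 1)"

lemma kappaD:
  assumes "\<omega> \<in> space M" "k \<le> kmax"
  shows "norm (d k \<omega>) \<le> kap_d C * norm (g k \<omega>)"
    and "norm (D k \<omega> - d k \<omega>) \<le> kap_d C * err k \<omega>"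
  using setting assms unfolding sqp_setting_def kappa_spec_def Let_def err_def by auto

text \<open>By the first block row, the residual of the true multiplier is minus \<open>H\<close>
  applied to the true direction. This explains the division by the square of \<open>kap_H\<close> in
  the final bound.\<close>

lemma stationarity_le:
  assumes "\<omega> \<in> space M" "k \<le> kmax"
  shows "stationarity P R k \<omega> = norm (H k \<omega> *v d k \<omega>)"
    and "stationarity P R k \<omega> \<le> kap_H C * norm (d k \<omega>)"
proof -
  have "g k \<omega> + transpose (J k \<omega>) *v rYtrue R k \<omega> = - (H k \<omega> *v d k \<omega>)"
    using settingD(13)[OF assms] unfolding kkt_def by (simp add: algebra_simps eq_neg_iff_add_eq_0)
  then show *: "stationarity P R k \<omega> = norm (H k \<omega> *v d k \<omega>)"
    unfolding stationarity_def by simp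
  show "stationarity P R k \<omega> \<le> kap_H C * norm (d k \<omega>)"
    unfolding * using settingD(11)[OF assms] by (intro mat_norm_bound(1)) auto
qed

lemma Z_nonneg: "0 \<le> Z k \<omega>"
  unfolding Z_def infeasibility_def by (intro add_nonneg_nonneg norm1_nonneg) auto

lemma \<eta>_pos: "0 < \<eta>"
  unfolding \<eta>_def using constsD by simp

text \<open>\<open>Z\<close> is at most the squared norm of the true direction plus the
  infeasibility, which \<open>kappa_spec\<close> compares with \<open>Psi\<close>, and
  \<open>Psi\<close> with the model decrease. Any null-range splitting of the direction
  does.\<close>

lemma model_decrease_lower_bound:
  assumes \<omega>: "\<omega> \<in> space M" and k: "k \<le> kmax"
    and t: "tau_min C \<le> t" "ereal t \<le> tau_trial_true P A R k \<omega>"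
  shows "\<eta> * Z k \<omega> \<le> Q k \<omega> t" "0 \<le> Q k \<omega> t"
proof -
  have X: "X k \<omega> \<in> region P" using settingD(9) \<omega> k by simp
  obtain u v where uv: "d k \<omega> = u + v" "J k \<omega> *v u = 0" "v \<in> range (\<lambda>w. transpose (J k \<omega>) *v w)"
    using null_range_decomposition transpose_Jac_eq_0D[OF smooth X] by blast
  let ?\<Psi> = "Psi (kap_uv C) u v (c k \<omega>)"
  have K: "(norm (d k \<omega>))^2 + norm1 (c k \<omega>) \<le> (kap_Psi C + 1) * ?\<Psi>"
    and K2: "0 < t \<Longrightarrow> kap_q C * t * ?\<Psi> \<le> Q k \<omega> t"
    using setting \<omega> k uv t(2) unfolding sqp_setting_def kappa_spec_def Let_def Q_def by blast+
  have \<Psi>: "0 \<le> ?\<Psi>" by (simp add: Psi_def)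
  have "(stationarity P R k \<omega>)\<^sup>2 \<le> (kap_H C * norm (d k \<omega>))\<^sup>2"
    using stationarity_le(2)[OF \<omega> k] by (intro power_mono) (auto simp: stationarity_def)
  then have "(stationarity P R k \<omega>)^2 / (kap_H C)^2 \<le> (norm (d k \<omega>))^2"
    using constsD(2) by (simp add: power_mult_distrib field_simps)
  then have "Z k \<omega> \<le> (kap_Psi C + 1) * ?\<Psi>"
    using K by (simp add: Z_def infeasibility_def)
  then have "\<eta> * Z k \<omega> \<le> \<eta> * ((kap_Psi C + 1) * ?\<Psi>)"
    using \<eta>_pos by (intro mult_left_mono) auto
  also have "\<dots> = kap_q C * tau_min C * ?\<Psi>"
    using constsD(12) by (simp add: \<eta>_def)
  also have "\<dots> \<le> kap_q C * t * ?\<Psi>"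
    using t \<Psi> constsD by (intro mult_right_mono mult_left_mono) auto
  also have "\<dots> \<le> Q k \<omega> t" using K2 t constsD(4) by simp
  finally show "\<eta> * Z k \<omega> \<le> Q k \<omega> t" .
  with Z_nonneg[of k \<omega>] \<eta>_pos show "0 \<le> Q k \<omega> t"
    by (meson mult_nonneg_nonneg less_imp_le order_trans)
qed

text \<open>Iterations in which the merit parameter is too large for the true model to guarantee a
  decrease; each of them lets the parameter decrease with probability at least \<open>p_tau\<close>.\<close>

definition "unsafe k = {\<omega> \<in> space M. \<not> ereal (\<tau>' k \<omega>) \<le> tau_trial_true P A R k \<omega>}"

definition "decr k = {\<omega> \<in> space M. \<tau> k \<omega> < \<tau>' k \<omega>}"

text \<open>The sampling error enters each step, to first order, only through its inner product with
  this vector, which is determined by the past.\<close>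

definition "hvec b k \<omega> =
  (1/2 * (A_max P A + theta A * b) * b\<^sup>2 *
    (if ereal (\<tau>' k \<omega>) \<le> tau_trial_true P A R k \<omega> then (tau_init A + tau_min C) / 2 else tau_min C)) *\<^sub>R
    (if d k \<omega> \<bullet> (H k \<omega> *v d k \<omega>) \<ge> 0 then - d k \<omega> else - d k \<omega> - z k \<omega>)
  + (b * A_fun (\<tau>' k \<omega>) * \<tau>' k \<omega>) *\<^sub>R z k \<omega>"

text \<open>Subtracting \<open>f_low\<close> makes the coefficient of \<open>t\<close> nonnegative
  on the region, so lowering the merit parameter never raises the value.\<close>

definition "merit t x = t * (obj P x - f_low P) + norm1 (con P x)"

end

section \<open>Descent of the merit function with constant step parameter\<close>

locale sqp_const_step = sqp +
  fixes b :: real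
  assumes \<beta>_eq: "k \<le> kmax \<Longrightarrow> \<beta> k = b"
    and step_le: "(A_max P A + theta A * b) * b \<le> A_min P A C"
    and unit: "unit_step_interval P A C kmax smax \<beta> R"
begin

abbreviation "A_up \<equiv> A_max P A + theta A * b"

text \<open>Coefficients of \<open>err\<close> squared and of \<open>err\<close> in the noise of
  order \<open>b\<close> squared. The first summand of \<open>c1\<close> is the midpoint term with
  the inverse of \<open>zeta_c\<close>; the second, with the first of \<open>c2\<close>, is the
  deviation from the midpoint; the last of \<open>c2\<close> is the width of the projection
  interval.\<close>

definition "c1 = 1/2 * A_up * ((tau_init A + tau_min C) / 2 / zeta_c C)
  + 1/2 * A_up * ((tau_init A - tau_min C) / 2 * (kap_d C + 1/2 * kap_H C * (kap_d C)\<^sup>2))"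

definition "c2 = 1/2 * A_up * ((tau_init A - tau_min C) / 2 *
      ((kap_d C + 1/2 * kap_H C * (kap_d C)\<^sup>2) * (2 * kap_g C)))
  + theta A * tau_init A * (kap_g C * kap_d C)"

text \<open>Up to the factor \<open>b\<close>, the largest variation of step size times merit
  parameter; the common factor of \<open>kap_E3\<close>, \<open>kap_dq1\<close> and
  \<open>kap_dq2\<close>.\<close>

definition "V = A_up * tau_init A - A_min P A C * tau_min C"

lemma b_pos: "0 < b" "b \<le> 1"
  using settingD(6)[of 0] \<beta>_eq[of 0] by auto

lemma A_up_pos: "A_max P A \<le> A_up" "0 < A_up"
proof -
  show "A_max P A \<le> A_up" using b_pos paramsD(9) by simp
  then show "0 < A_up" using A_min_pos A_min_le_max by linarith
qed

lemma V_nonneg: "0 \<le> V"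
proof -
  have "A_min P A C * tau_min C \<le> A_up * tau_init A"
    using A_min_le_max A_up_pos tau_min_le_init constsD(4) A_min_pos by (intro mult_mono) auto
  then show ?thesis by (simp add: V_def)
qed

lemma kap_dq1_eq: "kap_dq1 P A C b = V * (kap_d C * (kap_g C)\<^sup>2 * (1 + 1/2 * kap_H C * kap_d C))"
  by (simp add: kap_dq1_def V_def mult_ac)

text \<open>Combines \<open>merit_step\<close>, \<open>first_order_error\<close> and one of the two
  model estimates. The terms linear in the gradient error are collected in \<open>hvec\<close>, and
  the other errors are nonnegative expressions in \<open>err\<close>, so that expectations can be
  taken termwise.\<close>

lemma step_bound:
  assumes \<omega>: "\<omega> \<in> E" and k: "k \<le> kmax"
  shows "1/2 * A_min P A C * b * (\<eta> * Z k \<omega>)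
    \<le> merit (\<tau> k \<omega>) (X k \<omega>) - merit (\<tau> k \<omega>) (X (Suc k) \<omega>)
      + hvec b k \<omega> \<bullet> (G k \<omega> - g k \<omega>) + b\<^sup>2 * (c1 * (err k \<omega>)\<^sup>2 + c2 * err k \<omega>)
      + indicator (unsafe k) \<omega> * (b * kap_dq1 P A C b
          + b\<^sup>2 * (V * kap_d C * (1 + 1/2 * kap_H C * kap_d C) * ((kap_g C)\<^sup>2 + (err k \<omega>)\<^sup>2)))
      + indicator (bad_event P A R k) \<omega> * (b * (V * (kap_g C * kap_d C * err k \<omega>)))"
proof -
  note sp = event_ED(1)[OF \<omega>] and tb = tau_bounds[OF \<omega> k]
  define t n e where "t = \<tau> k \<omega>" and "n = norm1 (c k \<omega>)" and "e = G k \<omega> - g k \<omega>"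
  define p where "p = g k \<omega> \<bullet> d k \<omega> + 1/2 * max (d k \<omega> \<bullet> (H k \<omega> *v d k \<omega>)) 0"
  define s where "s = G k \<omega> \<bullet> D k \<omega> + 1/2 * max (D k \<omega> \<bullet> (H k \<omega> *v D k \<omega>)) 0"
  define r where "r = g k \<omega> \<bullet> (D k \<omega> - d k \<omega>)"
  define w0 where "w0 = (if d k \<omega> \<bullet> (H k \<omega> *v d k \<omega>) \<ge> 0 then - d k \<omega> else - d k \<omega> - z k \<omega>)"
  define l where "l = w0 \<bullet> e"
  have err: "err k \<omega> = norm e" by (simp add: err_def e_def)
  have X: "X k \<omega> \<in> region P" "X (Suc k) \<omega> \<in> region P" using settingD(9)[OF sp] k by auto
  have lo1: "b * xi_min C * t / (t * L + Gam A) \<le> 1"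
    using unit \<omega> k \<beta>_eq event_ED(4)[OF \<omega> k] unfolding unit_step_interval_def t_def by metis
  have lo_eq: "b * A_fun t = b * xi_min C * t / (t * L + Gam A)" by (simp add: A_fun_def)
  have "\<exists>a. b * A_fun t \<le> a \<and> a \<le> b * A_fun t + theta A * b\<^sup>2 \<and> 0 \<le> delta_q (c k \<omega>) t (G k \<omega>) (H k \<omega>) (D k \<omega>) \<and>
    t * obj P (X k \<omega> + rAlpha R k \<omega> *\<^sub>R D k \<omega>) + norm1 (con P (X k \<omega> + rAlpha R k \<omega> *\<^sub>R D k \<omega>))
      \<le> t * obj P (X k \<omega>) + norm1 (c k \<omega>)
      - a * delta_q (c k \<omega>) t (gradient (obj P) (X k \<omega>)) (H k \<omega>) (d k \<omega>)
      + 1/2 * a * b * delta_q (c k \<omega>) t (G k \<omega>) (H k \<omega>) (D k \<omega>)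
      + a * t * (gradient (obj P) (X k \<omega>) \<bullet> (D k \<omega> - d k \<omega>))"
    by (rule merit_step[OF smooth X(1) X(2)[unfolded run_step(2)[OF sp k]] paramsD(11) _ b_pos(1)
          paramsD(9) constsD(5) paramsD(10) lo_eq lo1[folded lo_eq]])
      (use tb run_step[OF sp k] event_ED(4)[OF \<omega> k] xi_min_le[OF \<omega> k] \<beta>_eq[OF k]
        in \<open>auto simp: t_def kkt_def\<close>)
  then obtain a where a: "b * A_fun t \<le> a" "a \<le> b * A_fun t + theta A * b\<^sup>2" "0 \<le> n - t * s"
    and desc: "merit t (X (Suc k) \<omega>) \<le> merit t (X k \<omega>) - a * (n - t * p) + 1/2 * a * b * (n - t * s) + a * t * r"
    by (auto simp: delta_q_def n_def p_def s_def r_def grad_at_def merit_def run_step(2)[OF sp k] algebra_simps)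
  have At: "A_min P A C \<le> A_fun t" "A_fun t \<le> A_fun (\<tau>' k \<omega>)" "A_fun (\<tau>' k \<omega>) \<le> A_max P A"
    using A_fun_mono[of "tau_min C" t] A_fun_mono[of t "\<tau>' k \<omega>"] A_fun_le_max[of "\<tau>' k \<omega>"] tb constsD(4)
    by (auto simp: A_fun_tau_min t_def)
  have a_lo: "b * A_min P A C \<le> a" using a(1) mult_left_mono[OF At(1), of b] b_pos by linarith
  have a_hi: "a \<le> A_up * b"
  proof -
    have "b * A_fun t \<le> b * A_max P A" using At b_pos by (intro mult_left_mono) auto
    then show ?thesis using a(2) by (simp add: algebra_simps power2_eq_square)
  qed
  have norms: "mat_norm (H k \<omega>) \<le> kap_H C" "transpose (H k \<omega>) = H k \<omega>" "norm (g k \<omega>) \<le> kap_g C"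
    using settingD(10,11)[OF sp k] by auto
  note mb = model_bounds[OF norms(1,2) constsD(2,10) norms(3) kappaD(1)[OF sp k] kappaD(2)[OF sp k, unfolded err_def],
      folded p_def s_def e_def r_def]
  obtain y' where z: "kkt (H k \<omega>) (J k \<omega>) (g k \<omega>) 0 (z k \<omega>) y'"
    using kkt_kkt_dir[OF pos_def[OF sp k]] unfolding z_def by blast
  note pert = kkt_perturbation[OF pos_def[OF sp k] settingD(13)[OF sp k] run_step(1)[OF sp k] z,
      folded p_def s_def e_def r_def w0_def l_def]
  \<comment> \<open>The choice \<open>K = A_fun (\<tau>' k \<omega>)\<close> is known before the
    sample, dominates \<open>A_fun t\<close> by monotonicity, and equals it if the parameter is
    kept.\<close>
  have first: "a * t * r \<le> b * A_fun (\<tau>' k \<omega>) * \<tau>' k \<omega> * r + b\<^sup>2 * (theta A * tau_init A * (kap_g C * kap_d C * norm e))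
    + (if r < 0 \<and> t < \<tau>' k \<omega> then b * (((A_max P A + theta A * b) * tau_init A - A_min P A C * tau_min C)
        * (kap_g C * kap_d C * norm e)) else 0)"
    by (rule first_order_error[where A = "A_fun t"])
      (use tb At a mb(4) b_pos paramsD(9) A_min_pos constsD(4) in \<open>auto simp: t_def\<close>)
  have bad_iff: "r < 0 \<and> t < \<tau>' k \<omega> \<longleftrightarrow> \<omega> \<in> bad_event P A R k"
    using sp by (simp add: bad_event_def r_def t_def)
  define B where "B = (if ereal (\<tau>' k \<omega>) \<le> tau_trial_true P A R k \<omega> then (tau_init A + tau_min C) / 2 else tau_min C)"
  have hv: "hvec b k \<omega> \<bullet> e = 1/2 * A_up * b\<^sup>2 * (B * l) + b * A_fun (\<tau>' k \<omega>) * \<tau>' k \<omega> * r"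
    unfolding hvec_def B_def[symmetric] w0_def[symmetric] using pert(1)
    by (simp add: inner_add_left l_def)
  define D3 where "D3 = (kap_d C + 1/2 * kap_H C * (kap_d C)\<^sup>2) * (2 * kap_g C * norm e + (norm e)\<^sup>2)"
  have D3: "0 \<le> D3" unfolding D3_def using constsD by (intro mult_nonneg_nonneg add_nonneg_nonneg) auto
  have dec: "1/2 * A_min P A C * b * (\<eta> * Z k \<omega>) \<le> a * (n - t * p) - 1/2 * a * b * (n - t * s)
    + 1/2 * A_up * b\<^sup>2 * (B * l)
    + b\<^sup>2 * (1/2 * A_up * ((tau_init A + tau_min C) / 2 * ((norm e)\<^sup>2 / zeta_c C))
        + 1/2 * A_up * ((tau_init A - tau_min C) / 2 * D3))
    + indicator (unsafe k) \<omega> * (b * kap_dq1 P A C b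
          + b\<^sup>2 * (V * kap_d C * (1 + 1/2 * kap_H C * kap_d C) * ((kap_g C)\<^sup>2 + (norm e)\<^sup>2)))"
  proof (cases "ereal (\<tau>' k \<omega>) \<le> tau_trial_true P A R k \<omega>")
    case True
    then have "\<omega> \<notin> unsafe k" by (simp add: unsafe_def)
    have "ereal t \<le> ereal (\<tau>' k \<omega>)" using tb by (simp add: t_def)
    then have "ereal t \<le> tau_trial_true P A R k \<omega>" using True by (rule order_trans)
    note * = model_decrease_lower_bound[OF sp k _ this]
    have "1/2 * A_min P A C * b * (\<eta> * Z k \<omega>) \<le> a * (n - t * p) - 1/2 * a * b * (n - t * s)
      + 1/2 * A_up * b\<^sup>2 * ((tau_init A + tau_min C) / 2 * l)
      + b\<^sup>2 * (1/2 * A_up * ((tau_init A + tau_min C) / 2 * ((norm e)\<^sup>2 / zeta_c C))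
        + 1/2 * A_up * ((tau_init A - tau_min C) / 2 * D3))"
      by (rule model_decrease_good[OF b_pos(1), where s = s])
        (use tb * a a_lo a_hi A_min_pos step_le constsD(3,4) pert(2) mb(3)
          in \<open>auto simp: t_def n_def p_def Q_def delta_q_def D3_def\<close>)
    then show ?thesis using True \<open>\<omega> \<notin> unsafe k\<close> by (simp add: B_def)
  next
    case False
    then have "\<omega> \<in> unsafe k" using sp by (simp add: unsafe_def)
    note * = model_decrease_lower_bound[OF sp k order_refl event_ED(3)[OF \<omega> k]]
    have "1/2 * A_min P A C * b * (\<eta> * Z k \<omega>) \<le> a * (n - t * p) - 1/2 * a * b * (n - t * s)
      + 1/2 * A_up * b\<^sup>2 * (tau_min C * l)
      + b\<^sup>2 * (1/2 * A_up * ((tau_init A + tau_min C) / 2 * ((norm e)\<^sup>2 / zeta_c C)))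
      + (b * ((A_up * tau_init A - A_min P A C * tau_min C) * (kap_d C * (kap_g C)\<^sup>2 * (1 + 1/2 * kap_H C * kap_d C)))
       + 1/2 * b\<^sup>2 * ((A_up * tau_init A - A_min P A C * tau_min C) *
          (2 * kap_d C * (1 + 1/2 * kap_H C * kap_d C) * ((kap_g C)\<^sup>2 + (norm e)\<^sup>2))))"
      by (rule model_decrease_bad[OF b_pos(1), where s = s])
        (use tb * a a_lo a_hi A_min_pos step_le constsD(3,4) pert(2) mb(1,2)
          in \<open>auto simp: t_def n_def p_def Q_def delta_q_def norm1_nonneg\<close>)
    note bound = this
    \<comment> \<open>The deviation term is absent from the bad case and is added for free, to match
      the bound of the good case.\<close>
    have D3': "0 \<le> b\<^sup>2 * (1/2 * A_up * ((tau_init A - tau_min C) / 2 * D3))"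
      using D3 A_up_pos tau_min_le_init by (intro mult_nonneg_nonneg) auto
    \<comment> \<open>The factor 2 in the bound on the sampled model cancels the half in front of
      \<open>b\<close> squared.\<close>
    have half_double: "1/2 * x * (V * (2 * y * w * u)) = x * (V * y * w * u)" for x y w u by simp
    have "B = tau_min C" "indicator (unsafe k) \<omega> = (1::real)"
      using False \<open>\<omega> \<in> unsafe k\<close> by (simp_all add: B_def)
    then show ?thesis using D3' bound[folded V_def]
      unfolding kap_dq1_eq half_double distrib_left[of "b\<^sup>2"] by (simp only: mult_1_left)
  qed
  have c12: "c1 * (norm e)\<^sup>2 + c2 * norm e
    = (1/2 * A_up * ((tau_init A + tau_min C) / 2 * ((norm e)\<^sup>2 / zeta_c C))
        + 1/2 * A_up * ((tau_init A - tau_min C) / 2 * D3))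
      + theta A * tau_init A * (kap_g C * kap_d C * norm e)"
    unfolding c1_def c2_def D3_def by (simp add: algebra_simps add_divide_distrib diff_divide_distrib)
  have bad: "indicator (bad_event P A R k) \<omega> * (b * (V * (kap_g C * kap_d C * norm e)))
    = (if r < 0 \<and> t < \<tau>' k \<omega> then b * (((A_max P A + theta A * b) * tau_init A - A_min P A C * tau_min C)
        * (kap_g C * kap_d C * norm e)) else 0)"
    unfolding bad_iff by (simp add: V_def)
  show ?thesis
    using first dec desc hv unfolding err c12 bad e_def[symmetric] t_def[symmetric]
    by (simp add: distrib_left) 
qed

text \<open>The sum telescopes once the parameter in front of each iterate is lowered to its
  successor, which does not increase the merit value.\<close>

lemma sum_merit_le:
  assumes \<omega>: "\<omega> \<in> E"
  shows "(\<Sum>k\<le>kmax. merit (\<tau> k \<omega>) (X k \<omega>) - merit (\<tau> k \<omega>) (X (Suc k) \<omega>)) \<le> merit (tau_init A) (x_init A)"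
proof -
  have f: "0 \<le> obj P (X k \<omega>) - f_low P" if "k \<le> Suc kmax" for k
    using smooth_problemD(6)[OF smooth settingD(9)[OF event_ED(1)[OF \<omega>] that]] by simp
  have "m \<le> kmax \<Longrightarrow> (\<Sum>k\<le>m. merit (\<tau> k \<omega>) (X k \<omega>) - merit (\<tau> k \<omega>) (X (Suc k) \<omega>))
    \<le> merit (tau_init A) (x_init A) - merit (\<tau> m \<omega>) (X (Suc m) \<omega>)" for m
  proof (induction m)
    case 0
    have "\<tau> 0 \<omega> * (obj P (X 0 \<omega>) - f_low P) \<le> tau_init A * (obj P (X 0 \<omega>) - f_low P)"
      using tau_bounds(3)[OF \<omega>, of 0] f[of 0] by (intro mult_right_mono) (auto simp: prev_Suc)
    then show ?case using run_zero[OF event_ED(1)[OF \<omega>]] by (simp add: merit_def)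
  next
    case (Suc m)
    have "\<tau> (Suc m) \<omega> * (obj P (X (Suc m) \<omega>) - f_low P) \<le> \<tau> m \<omega> * (obj P (X (Suc m) \<omega>) - f_low P)"
      using tau_bounds(3)[OF \<omega>, of "Suc m"] f[of "Suc m"] Suc.prems
      by (intro mult_right_mono) (auto simp: prev_Suc)
    then show ?case using Suc by (simp add: merit_def)
  qed
  from this[OF order_refl] have "(\<Sum>k\<le>kmax. merit (\<tau> k \<omega>) (X k \<omega>) - merit (\<tau> k \<omega>) (X (Suc k) \<omega>))
    \<le> merit (tau_init A) (x_init A) - merit (\<tau> kmax \<omega>) (X (Suc kmax) \<omega>)" .
  moreover have "0 \<le> merit (\<tau> kmax \<omega>) (X (Suc kmax) \<omega>)"
    unfolding merit_def using tau_bounds(1)[OF \<omega>, of kmax] f[of "Suc kmax"] norm1_nonneg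
    by (intro add_nonneg_nonneg mult_nonneg_nonneg) auto
  ultimately show ?thesis by simp
qed

end

subsection \<open>Integration over the event\<close>

lemma norm1_con_bounded:
  fixes P :: "('n::finite, 'm::finite) sqp_problem"
  assumes smooth: "smooth_problem P"
  shows "\<exists>K\<ge>0. \<forall>x\<in>region P. norm1 (con P x) \<le> K"
proof -
  obtain B where B: "\<And>x. x \<in> region P \<Longrightarrow> norm (con P x) \<le> B"
    using smooth_problemD(9)[OF smooth] by (auto simp: bounded_iff)
  have "norm1 (con P x) \<le> (\<Sum>i\<in>(UNIV::'m set). \<bar>B\<bar>)" if "x \<in> region P" for x
    unfolding norm1_def
    using B[OF that] component_le_norm_cart[of "con P x"] by (intro sum_mono) (meson abs_ge_self order_trans)
  then show ?thesis by (intro exI[of _ "\<Sum>i\<in>(UNIV::'m set). \<bar>B\<bar>"]) (auto intro: sum_nonneg)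
qed

section \<open>From conditional bounds to bounds on integrals\<close>

context sigma_finite_subalgebra
begin

lemma nn_integral_le_of_cond_exp_le:
  assumes [measurable]: "f \<in> borel_measurable M"
    and le: "AE x in M. nn_cond_exp M F f x \<le> c" and B: "B \<in> sets F"
  shows "(\<integral>\<^sup>+x. f x * indicator B x \<partial>M) \<le> c * emeasure M B"
proof -
  have BM: "B \<in> sets M" using B subalg by (auto simp: subalgebra_def)
  have "(\<integral>\<^sup>+x. f x * indicator B x \<partial>M) = (\<integral>\<^sup>+x. indicator B x * f x \<partial>M)"
    by (simp add: mult.commute)
  also have "\<dots> = (\<integral>\<^sup>+x. indicator B x * nn_cond_exp M F f x \<partial>M)"
    using B by (intro nn_cond_exp_intg[symmetric]) auto
  also have "\<dots> \<le> (\<integral>\<^sup>+x. c * indicator B x \<partial>M)"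
    using le by (intro nn_integral_mono_AE) (auto simp: indicator_def elim!: eventually_mono)
  also have "\<dots> = c * emeasure M B"
    using BM by (rule nn_integral_cmult_indicator)
  finally show ?thesis .
qed

lemma emeasure_Int_ge_of_cond_prob_ge:
  assumes S: "S \<in> sets M"
    and ge: "AE x in M. q \<le> nn_cond_exp M F (indicator S) x" and B: "B \<in> sets F"
  shows "q * emeasure M B \<le> emeasure M (B \<inter> S)"
proof -
  have BM: "B \<in> sets M" using B subalg by (auto simp: subalgebra_def)
  have "q * emeasure M B = (\<integral>\<^sup>+x. q * indicator B x \<partial>M)"
    using BM by (rule nn_integral_cmult_indicator[symmetric])
  also have "\<dots> \<le> (\<integral>\<^sup>+x. indicator B x * nn_cond_exp M F (indicator S) x \<partial>M)"
    using ge by (intro nn_integral_mono_AE) (auto simp: indicator_def elim!: eventually_mono)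
  also have "\<dots> = (\<integral>\<^sup>+x. indicator B x * indicator S x \<partial>M)"
    using B S by (intro nn_cond_exp_intg) auto
  also have "\<dots> = emeasure M (B \<inter> S)"
    using BM S by (simp flip: indicator_inter_arith)
  finally show ?thesis .
qed

text \<open>\<open>B\<close> need not belong to the sub-sigma-algebra, so conditioning on it is a
  quotient of conditional expectations. Where the denominator \<open>p\<close> vanishes,
  \<open>B\<close> carries no mass; elsewhere the quotient bound gives \<open>c * p\<close>, and
  \<open>p\<close> integrates to the measure of \<open>B\<close>.\<close>

lemma nn_integral_le_of_cond_ratio_le:
  assumes f [measurable]: "f \<in> borel_measurable M" and B: "B \<in> sets M" and c: "c \<noteq> 0"
    and le: "AE x in M. nn_cond_exp M F (indicator B) x = 0 \<or>
      nn_cond_exp M F (\<lambda>x. f x * indicator B x) x / nn_cond_exp M F (indicator B) x \<le> c"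
  shows "(\<integral>\<^sup>+x. f x * indicator B x \<partial>M) \<le> c * emeasure M B"
proof -
  note [measurable] = B
  define p where "p = nn_cond_exp M F (indicator B)"
  have pF [measurable]: "p \<in> borel_measurable F" by (simp add: p_def)
  have pM [measurable]: "p \<in> borel_measurable M" by (simp add: p_def)
  define S where "S = {x \<in> space F. p x = 0}"
  have SF: "S \<in> sets F" unfolding S_def by measurable
  have spF: "space F = space M" using subalg by (simp add: subalgebra_def)
  have SM [measurable]: "S \<in> sets M" using SF subalg by (auto simp: subalgebra_def)
  \<comment> \<open>The part of \<open>B\<close> inside \<open>S\<close> is null: its mass is the
    integral of \<open>p\<close> over the zero set of \<open>p\<close>.\<close>
  have "(\<integral>\<^sup>+x. indicator S x * indicator B x \<partial>M) = (\<integral>\<^sup>+x. indicator S x * p x \<partial>M)"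
    unfolding p_def using SF by (intro nn_cond_exp_intg[symmetric]) auto
  also have "\<dots> = (\<integral>\<^sup>+x. 0 \<partial>M)"
    by (intro nn_integral_cong) (auto simp: S_def indicator_def)
  finally have "(\<integral>\<^sup>+x. indicator S x * indicator B x \<partial>M) = 0" by simp
  then have "AE x in M. indicator S x * indicator B x = (0::ennreal)"
    by (subst (asm) nn_integral_0_iff_AE) auto
  then have "(\<integral>\<^sup>+x. f x * indicator B x \<partial>M) = (\<integral>\<^sup>+x. indicator (space F - S) x * (f x * indicator B x) \<partial>M)"
    by (intro nn_integral_cong_AE) (auto simp: indicator_def spF elim!: eventually_mono)
  also have "\<dots> = (\<integral>\<^sup>+x. indicator (space F - S) x * nn_cond_exp M F (\<lambda>x. f x * indicator B x) x \<partial>M)"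
    using SF by (intro nn_cond_exp_intg[symmetric]) auto
  also have "\<dots> \<le> (\<integral>\<^sup>+x. c * p x \<partial>M)"
  proof (intro nn_integral_mono_AE, use le in eventually_elim)
    fix x
    assume x: "nn_cond_exp M F (indicator B) x = 0 \<or>
      nn_cond_exp M F (\<lambda>x. f x * indicator B x) x / nn_cond_exp M F (indicator B) x \<le> c"
    let ?a = "nn_cond_exp M F (\<lambda>x. f x * indicator B x) x"
    show "indicator (space F - S) x * ?a \<le> c * p x"
    proof (cases "p x = 0 \<or> p x = top")
      case True
      then show ?thesis using c by (auto simp: S_def indicator_def ennreal_mult_top)
    next
      case False
      then have "?a = ?a * p x / p x" by (simp add: ennreal_mult_divide_eq)
      also have "\<dots> = p x * (?a / p x)" by (simp only: ennreal_times_divide mult.commute[of "p x"])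
      also have "\<dots> \<le> p x * c" using x False by (intro mult_left_mono) (auto simp: p_def)
      finally show ?thesis by (auto simp: indicator_def mult.commute)
    qed
  qed
  also have "\<dots> = c * (\<integral>\<^sup>+x. p x \<partial>M)" by (rule nn_integral_cmult) simp
  also have "(\<integral>\<^sup>+x. p x \<partial>M) = (\<integral>\<^sup>+x. 1 * p x \<partial>M)" by simp
  also have "\<dots> = (\<integral>\<^sup>+x. 1 * indicator B x \<partial>M)"
    unfolding p_def by (intro nn_cond_exp_intg) auto
  also have "\<dots> = emeasure M B" by simp
  finally show ?thesis .
qed

end

context sqp
begin

lemma event_E_sets: "E \<in> sets M"
  using event_E_hist subalgebra_hist[of "Suc kmax"] by (auto simp: subalgebra_def)

lemma emeasure_event_E: "emeasure M E \<noteq> 0" "emeasure M E \<noteq> \<infinity>"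
proof -
  interpret prob_space M by (rule settingD(1))
  show "emeasure M E \<noteq> 0" "emeasure M E \<noteq> \<infinity>" using settingD(5) by (auto simp: emeasure_eq_measure)
qed

lemma space_ME [simp]: "space ME = space M" and sets_ME [simp, measurable_cong]: "sets ME = sets M"
  by (simp_all add: cond_on_def)

lemma prob_space_ME: "prob_space ME"
  unfolding cond_on_def by (rule prob_space_uniform_measure[OF emeasure_event_E])

lemma AE_ME: "AE \<omega> in ME. \<omega> \<in> E"
  unfolding cond_on_def by (rule AE_uniform_measureI[OF event_E_sets]) simp

lemma sigma_finite_subalgebra_hist:
  assumes "k \<le> Suc kmax"
  shows "sigma_finite_subalgebra ME (hist R k)"
proof -
  interpret prob_space ME by (rule prob_space_ME)
  have "subalgebra ME (hist R k)"
    using subalgebra_hist[OF assms] by (simp add: subalgebra_def)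
  then have "finite_measure_subalgebra ME (hist R k)"
    by (intro finite_measure_subalgebra.intro finite_measure_axioms finite_measure_subalgebra_axioms.intro)
  then show ?thesis by (rule finite_measure_subalgebra_is_sigma_finite)
qed

lemma borel_measurable_of_hist:
  assumes "f \<in> measurable (hist R k) N" "k \<le> Suc kmax"
  shows "f \<in> measurable M N" "f \<in> measurable ME N"
  using measurable_from_subalg[OF subalgebra_hist[OF assms(2)] assms(1)]
  by (simp_all cong: measurable_cong_sets)

lemma borel_measurable_run:
  assumes k: "k \<le> kmax"
  shows "G k \<in> borel_measurable M" "D k \<in> borel_measurable M" "d k \<in> borel_measurable M"
    "g k \<in> borel_measurable M" "H k \<in> borel_measurable M" "c k \<in> borel_measurable M"
    "z k \<in> borel_measurable M" "\<tau> k \<in> borel_measurable M" "\<tau>' k \<in> borel_measurable M"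
    "err k \<in> borel_measurable M" "Z k \<in> borel_measurable M"
proof -
  note step = borel_measurable_step[OF k borel_measurable_state]
  note up = borel_measurable_of_hist(1)
  show Gm [measurable]: "G k \<in> borel_measurable M" using settingD(7)[OF k] .
  show "D k \<in> borel_measurable M" "\<tau> k \<in> borel_measurable M"
    using step k by (auto intro: up)
  show dm [measurable]: "d k \<in> borel_measurable M"
    and gm [measurable]: "g k \<in> borel_measurable M" and Hm [measurable]: "H k \<in> borel_measurable M"
    and cm [measurable]: "c k \<in> borel_measurable M"
    and "z k \<in> borel_measurable M"
    and "\<tau>' k \<in> borel_measurable M"
    using borel_measurable_hist[OF k] settingD(8)[OF k] borel_measurable_state(2)[of k] k
    by (auto intro: up)
  show "err k \<in> borel_measurable M" unfolding err_def by measurable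
  \<comment> \<open>No measurability of \<open>rYtrue\<close> is at hand; the residual is therefore
    expressed through the true direction.\<close>
  have Z': "(\<lambda>\<omega>. (norm (H k \<omega> *v d k \<omega>))^2 / (kap_H C)^2 + norm1 (c k \<omega>)) \<in> borel_measurable M"
    by measurable
  show "Z k \<in> borel_measurable M"
    by (rule measurable_cong[THEN iffD1, OF _ Z']) (simp add: Z_def infeasibility_def stationarity_le(1)[OF _ k])
qed

lemma sets_run:
  assumes k: "k \<le> kmax"
  shows "unsafe k \<in> sets (hist R k)" "unsafe k \<in> sets M" "decr k \<in> sets M" "bad_event P A R k \<in> sets M"
proof -
  note [measurable] = borel_measurable_hist(5)[OF k] borel_measurable_run[OF k]
  have "{\<omega> \<in> space (hist R k). \<not> ereal (\<tau>' k \<omega>) \<le> tau_trial_true P A R k \<omega>} \<in> sets (hist R k)"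
    by measurable
  then show "unsafe k \<in> sets (hist R k)" by (simp add: unsafe_def)
  then show "unsafe k \<in> sets M"
    using subalgebra_hist[of k] k by (auto simp: subalgebra_def)
  show "decr k \<in> sets M" unfolding decr_def by measurable
  show "bad_event P A R k \<in> sets M" unfolding bad_event_def by measurable
qed

lemma A3_unfolded:
  assumes k: "k \<le> kmax"
  shows "AE \<omega> in ME. real_cond_exp ME (hist R k) (\<lambda>\<omega>. G k \<omega> $ i) \<omega> = g k \<omega> $ i"
    and "AE \<omega> in ME. nn_cond_exp ME (hist R k) (\<lambda>\<omega>. ennreal ((err k \<omega>)^2)) \<omega> \<le> ennreal (M_var C)"
    and "AE \<omega> in ME. nn_cond_exp ME (hist R k) (indicator (bad_event P A R k)) \<omega> = 0 \<or>
      nn_cond_exp ME (hist R k) (\<lambda>\<omega>. ennreal (err k \<omega>) * indicator (bad_event P A R k) \<omega>) \<omega> /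
      nn_cond_exp ME (hist R k) (indicator (bad_event P A R k)) \<omega> \<le> ennreal (M_tau C)"
  using settingD(3) k unfolding A3_def Let_def err_def by (auto elim!: eventually_mono)

text \<open>The set is kept general so that it can be \<open>unsafe k\<close>, which belongs to the
  history; the error of an unsafe iteration then comes with its probability as a factor.\<close>

lemma err_sq_integral:
  assumes k: "k \<le> kmax" and B: "B \<in> sets (hist R k)"
  shows "integrable ME (\<lambda>\<omega>. indicator B \<omega> * (err k \<omega>)\<^sup>2)"
    and "(\<integral>\<omega>. indicator B \<omega> * (err k \<omega>)\<^sup>2 \<partial>ME) \<le> M_var C * measure ME B"
proof -
  interpret prob_space ME by (rule prob_space_ME)
  interpret sigma_finite_subalgebra ME "hist R k" using k by (intro sigma_finite_subalgebra_hist) simp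
  note [measurable] = borel_measurable_run(10)[OF k]
  have [measurable]: "B \<in> sets M" using B subalgebra_hist[of k] k by (auto simp: subalgebra_def)
  have "(\<integral>\<^sup>+\<omega>. ennreal (indicator B \<omega> * (err k \<omega>)\<^sup>2) \<partial>ME) = (\<integral>\<^sup>+\<omega>. ennreal ((err k \<omega>)\<^sup>2) * indicator B \<omega> \<partial>ME)"
    by (intro nn_integral_cong) (auto simp: indicator_def)
  also have "\<dots> \<le> ennreal (M_var C) * emeasure ME B"
    by (rule nn_integral_le_of_cond_exp_le[OF _ A3_unfolded(2)[OF k] B]) measurable
  also have "\<dots> = ennreal (M_var C * measure ME B)"
    using constsD(6) by (simp add: emeasure_eq_measure ennreal_mult)
  finally have le: "(\<integral>\<^sup>+\<omega>. ennreal (indicator B \<omega> * (err k \<omega>)\<^sup>2) \<partial>ME) \<le> ennreal (M_var C * measure ME B)" .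
  show int: "integrable ME (\<lambda>\<omega>. indicator B \<omega> * (err k \<omega>)\<^sup>2)"
    by (rule integrableI_nonneg) (use le in \<open>auto intro: le_less_trans\<close>)
  show "(\<integral>\<omega>. indicator B \<omega> * (err k \<omega>)\<^sup>2 \<partial>ME) \<le> M_var C * measure ME B"
    using le constsD(6) by (subst (asm) nn_integral_eq_integral[OF int]) (auto simp: ennreal_le_iff)
qed

lemma err_integral:
  assumes k: "k \<le> kmax"
  shows "integrable ME (\<lambda>\<omega>. (err k \<omega>)\<^sup>2)" "(\<integral>\<omega>. (err k \<omega>)\<^sup>2 \<partial>ME) \<le> M_var C"
    and "integrable ME (err k)" "(\<integral>\<omega>. err k \<omega> \<partial>ME) \<le> sqrt (M_var C)"
proof -
  interpret prob_space ME by (rule prob_space_ME)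
  note [measurable] = borel_measurable_run(10)[OF k]
  have top: "space M \<in> sets (hist R k)" by (metis space_hist sets.top)
  have eq: "indicator (space M) \<omega> * (err k \<omega>)\<^sup>2 = (err k \<omega>)\<^sup>2" if "\<omega> \<in> space ME" for \<omega>
    using that by simp
  show int2: "integrable ME (\<lambda>\<omega>. (err k \<omega>)\<^sup>2)"
    using err_sq_integral(1)[OF k top] by (subst (asm) Bochner_Integration.integrable_cong[OF refl eq]) auto
  show le2: "(\<integral>\<omega>. (err k \<omega>)\<^sup>2 \<partial>ME) \<le> M_var C"
    using err_sq_integral(2)[OF k top] prob_space
    by (subst (asm) Bochner_Integration.integral_cong[OF refl eq]) auto
  define m where "m = sqrt (M_var C)"
  have m: "0 < m" "m\<^sup>2 = M_var C" using constsD(6) by (auto simp: m_def)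
  \<comment> \<open>The arithmetic-geometric mean inequality with weight \<open>m\<close> yields
    integrability and, after integration, the square-root bound at once.\<close>
  have le: "err k \<omega> \<le> (err k \<omega>)\<^sup>2 / (2 * m) + m / 2" for \<omega>
    using sum_squares_bound[of "err k \<omega>" m] m by (simp add: field_simps power2_eq_square)
  have int': "integrable ME (\<lambda>\<omega>. (err k \<omega>)\<^sup>2 / (2 * m) + m / 2)"
    using int2 by simp
  show int1: "integrable ME (err k)"
    by (rule Bochner_Integration.integrable_bound[OF int'])
      (use le m in \<open>auto simp: err_def intro!: AE_I2 order_trans[OF le[unfolded err_def]]\<close>)
  have "(\<integral>\<omega>. err k \<omega> \<partial>ME) \<le> (\<integral>\<omega>. (err k \<omega>)\<^sup>2 / (2 * m) + m / 2 \<partial>ME)"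
    by (rule integral_mono[OF int1 int' le])
  also have "\<dots> = (\<integral>\<omega>. (err k \<omega>)\<^sup>2 \<partial>ME) / (2 * m) + m / 2"
    using int2 prob_space by simp
  also have "\<dots> \<le> m\<^sup>2 / (2 * m) + m / 2" using le2 m by (intro add_right_mono divide_right_mono) auto
  also have "\<dots> = m" using m(1) by (simp add: power2_eq_square field_simps)
  finally show "(\<integral>\<omega>. err k \<omega> \<partial>ME) \<le> sqrt (M_var C)" by (simp add: m_def)
qed

text \<open>\<open>bad_event\<close> involves the current sample and is not determined by the
  history, hence the quotient form of the hypothesis.\<close>

lemma bad_integral:
  assumes k: "k \<le> kmax"
  shows "integrable ME (\<lambda>\<omega>. indicator (bad_event P A R k) \<omega> * err k \<omega>)"
    and "(\<integral>\<omega>. indicator (bad_event P A R k) \<omega> * err k \<omega> \<partial>ME) \<le> M_tau C * measure ME (bad_event P A R k)"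
proof -
  interpret prob_space ME by (rule prob_space_ME)
  interpret sigma_finite_subalgebra ME "hist R k" using k by (intro sigma_finite_subalgebra_hist) simp
  let ?B = "bad_event P A R k"
  note [measurable] = borel_measurable_run(10)[OF k] sets_run(4)[OF k]
  have nonneg: "0 \<le> err k \<omega>" for \<omega> by (simp add: err_def)
  have "(\<integral>\<^sup>+\<omega>. ennreal (indicator ?B \<omega> * err k \<omega>) \<partial>ME) = (\<integral>\<^sup>+\<omega>. ennreal (err k \<omega>) * indicator ?B \<omega> \<partial>ME)"
    by (intro nn_integral_cong) (auto simp: indicator_def)
  also have "\<dots> \<le> ennreal (M_tau C) * emeasure ME ?B"
    by (rule nn_integral_le_of_cond_ratio_le[OF _ _ _ A3_unfolded(3)[OF k]]) (use constsD(7) in auto)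
  also have "\<dots> = ennreal (M_tau C * measure ME ?B)"
    using constsD(7) by (simp add: emeasure_eq_measure ennreal_mult)
  finally have le: "(\<integral>\<^sup>+\<omega>. ennreal (indicator ?B \<omega> * err k \<omega>) \<partial>ME) \<le> ennreal (M_tau C * measure ME ?B)" .
  show int: "integrable ME (\<lambda>\<omega>. indicator ?B \<omega> * err k \<omega>)"
    by (rule integrableI_nonneg) (use le nonneg in \<open>auto intro: le_less_trans\<close>)
  show "(\<integral>\<omega>. indicator ?B \<omega> * err k \<omega> \<partial>ME) \<le> M_tau C * measure ME ?B"
    using le constsD(7) nonneg by (subst (asm) nn_integral_eq_integral[OF int]) (auto simp: ennreal_le_iff)
qed

lemma bad_subset_decr: "bad_event P A R k \<subseteq> decr k"
  by (auto simp: bad_event_def decr_def)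

text \<open>If the sampled model term is at least the true one, the sampled trial value is at most
  the true one, which on \<open>unsafe k\<close> lies below the current parameter and forces a
  decrease. Since \<open>unsafe k\<close> belongs to the history, the bound of \<open>A4\<close> can
  be integrated over it.\<close>

lemma unsafe_prob:
  assumes k: "k \<le> kmax"
  shows "p_tau C * measure ME (unsafe k) \<le> measure ME (decr k)"
proof -
  interpret prob_space ME by (rule prob_space_ME)
  interpret sigma_finite_subalgebra ME "hist R k" using k by (intro sigma_finite_subalgebra_hist) simp
  note [measurable] = borel_measurable_run[OF k] sets_run[OF k]
  define q where "q \<omega> g d = g \<bullet> d + max (d \<bullet> (H k \<omega> *v d)) 0" for \<omega> g d
  define S where "S = {\<omega> \<in> space M. q \<omega> (g k \<omega>) (d k \<omega>) \<le> q \<omega> (G k \<omega>) (D k \<omega>)}"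
  have S: "S \<in> sets ME" unfolding S_def q_def sets_ME by measurable
  have ge: "AE \<omega> in ME. ennreal (p_tau C) \<le> nn_cond_exp ME (hist R k) (indicator S) \<omega>"
    using settingD(4) k unfolding A4_def Let_def S_def q_def by blast
  have "unsafe k \<inter> S \<subseteq> decr k"
  proof
    fix \<omega> assume \<omega>: "\<omega> \<in> unsafe k \<inter> S"
    then have sp: "\<omega> \<in> space M" and less: "tau_trial_true P A R k \<omega> < ereal (\<tau>' k \<omega>)"
      by (auto simp: unsafe_def)
    have le: "q \<omega> (g k \<omega>) (d k \<omega>) \<le> q \<omega> (G k \<omega>) (D k \<omega>)" using \<omega> by (simp add: S_def)
    \<comment> \<open>A zero direction would skip the update, but it would also make the true model
      term nonpositive and the true trial value infinite.\<close>
    have "D k \<omega> \<noteq> 0"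
    proof
      assume "D k \<omega> = 0"
      then have "q \<omega> (g k \<omega>) (d k \<omega>) \<le> 0" using le by (simp add: q_def)
      then have "tau_trial_true P A R k \<omega> = \<infinity>" by (simp add: tau_trial_true_def tau_trial_def q_def)
      then show False using less by simp
    qed
    moreover have "tau_trial (sig A) (c k \<omega>) (G k \<omega>) (H k \<omega>) (D k \<omega>) \<le> tau_trial_true P A R k \<omega>"
      unfolding tau_trial_true_def using le paramsD(8) by (intro tau_trial_antimono) (auto simp: q_def)
    ultimately have "\<tau> k \<omega> < \<tau>' k \<omega>"
      using run_step(3)[OF sp k] tau_update_trial(2)[OF paramsD(3,4,8)] less by (metis le_less_trans)
    then show "\<omega> \<in> decr k" using sp by (simp add: decr_def)
  qed
  then have "emeasure ME (unsafe k \<inter> S) \<le> emeasure ME (decr k)"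
    by (intro emeasure_mono) simp_all
  moreover have "ennreal (p_tau C) * emeasure ME (unsafe k) \<le> emeasure ME (unsafe k \<inter> S)"
    by (rule emeasure_Int_ge_of_cond_prob_ge[OF S ge]) (rule sets_run(1)[OF k])
  ultimately have "ennreal (p_tau C) * emeasure ME (unsafe k) \<le> emeasure ME (decr k)" by (rule order_trans[rotated])
  then have "ennreal (p_tau C * measure ME (unsafe k)) \<le> ennreal (measure ME (decr k))"
    using constsD(8) by (simp add: emeasure_eq_measure ennreal_mult)
  then show ?thesis by (simp add: ennreal_le_iff)
qed

text \<open>The sum is the expected number of decreases, and the event caps their number pathwise.
  If the two parameters agree, \<open>\<tau>\<close> is pinned between them.\<close>

lemma sum_decr_prob:
  shows "(\<Sum>k\<le>kmax. measure ME (decr k)) \<le> real smax"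
    and "tau_init A = tau_min C \<Longrightarrow> (\<Sum>k\<le>kmax. measure ME (decr k)) = 0"
proof -
  interpret prob_space ME by (rule prob_space_ME)
  have int: "integrable ME (indicator (decr k) :: _ \<Rightarrow> real)" if "k \<le> kmax" for k
    using sets_run(3)[OF that] by (intro integrable_real_indicator) (auto simp: less_top[symmetric])
  have eq: "(\<Sum>k\<le>kmax. measure ME (decr k)) = (\<integral>\<omega>. (\<Sum>k\<le>kmax. indicator (decr k) \<omega>) \<partial>ME)"
  proof -
    have "(\<Sum>k\<le>kmax. measure ME (decr k)) = (\<Sum>k\<le>kmax. \<integral>\<omega>. indicator (decr k) \<omega> \<partial>ME)"
      using sets_run(3) sets.sets_into_space by (intro sum.cong) (auto simp: Int_absorb2)
    also have "\<dots> = (\<integral>\<omega>. (\<Sum>k\<le>kmax. indicator (decr k) \<omega>) \<partial>ME)"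
      using int by (intro Bochner_Integration.integral_sum[symmetric]) simp
    finally show ?thesis .
  qed
  have card: "(\<Sum>k\<le>kmax. indicator (decr k) \<omega> :: real) = real (card {k. k \<le> kmax \<and> \<tau> k \<omega> < \<tau>' k \<omega>})"
    if "\<omega> \<in> E" for \<omega>
  proof -
    have "{k. k \<le> kmax \<and> \<tau> k \<omega> < \<tau>' k \<omega>} = {..kmax} \<inter> {k. \<omega> \<in> decr k}"
      using event_ED(1)[OF that] by (auto simp: decr_def)
    then show ?thesis by (simp add: indicator_def sum.If_cases)
  qed
  have "(\<integral>\<omega>. (\<Sum>k\<le>kmax. indicator (decr k) \<omega> :: real) \<partial>ME) \<le> (\<integral>\<omega>. real smax \<partial>ME)"
  proof (intro integral_mono_AE)
    show "AE \<omega> in ME. (\<Sum>k\<le>kmax. indicator (decr k) \<omega> :: real) \<le> real smax"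
      using AE_ME by eventually_elim (simp add: card, simp add: event_E_def)
  qed (use int in \<open>auto intro!: Bochner_Integration.integrable_sum\<close>)
  then show "(\<Sum>k\<le>kmax. measure ME (decr k)) \<le> real smax" unfolding eq using prob_space by simp
  assume "tau_init A = tau_min C"
  then have none: "{k. k \<le> kmax \<and> \<tau> k \<omega> < \<tau>' k \<omega>} = {}" if "\<omega> \<in> E" for \<omega>
    using tau_bounds[OF that] by force
  have "(\<integral>\<omega>. (\<Sum>k\<le>kmax. indicator (decr k) \<omega> :: real) \<partial>ME) = (\<integral>\<omega>. 0 \<partial>ME)"
  proof (intro integral_cong_AE)
    show "AE \<omega> in ME. (\<Sum>k\<le>kmax. indicator (decr k) \<omega> :: real) = 0"
      using AE_ME by eventually_elim (simp add: card none)
  qed (use sets_run(3) in \<open>auto intro!: borel_measurable_sum borel_measurable_indicator\<close>)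
  then show "(\<Sum>k\<le>kmax. measure ME (decr k)) = 0" unfolding eq by simp
qed

lemma Z_bounded:
  assumes "\<And>x. x \<in> region P \<Longrightarrow> norm1 (con P x) \<le> K" "\<omega> \<in> space M" "k \<le> kmax"
  shows "Z k \<omega> \<le> (kap_d C * kap_g C)\<^sup>2 + K"
proof -
  have "norm (d k \<omega>) \<le> kap_d C * kap_g C"
    using kappaD(1)[OF assms(2,3)] settingD(10)[OF assms(2,3)] constsD(10)
    by (meson mult_left_mono less_imp_le order_trans)
  then have "stationarity P R k \<omega> \<le> kap_H C * (kap_d C * kap_g C)"
    using stationarity_le(2)[OF assms(2,3)] constsD(2) by (meson mult_left_mono less_imp_le order_trans)
  then have "(stationarity P R k \<omega>)\<^sup>2 \<le> (kap_H C * (kap_d C * kap_g C))\<^sup>2"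
    by (intro power_mono) (auto simp: stationarity_def)
  then have "(stationarity P R k \<omega>)\<^sup>2 / (kap_H C)\<^sup>2 \<le> (kap_d C * kap_g C)\<^sup>2"
    using constsD(2) by (simp add: power_mult_distrib field_simps)
  then show ?thesis
    unfolding Z_def infeasibility_def using assms settingD(9)[OF assms(2), of k] by (intro add_mono) auto
qed

lemma stationarity_infeasibility_hist:
  assumes k: "k \<le> kmax"
  shows "stationarity P R k \<in> borel_measurable (hist R (Suc kmax))"
    "infeasibility P R k \<in> borel_measurable (hist R (Suc kmax))"
proof -
  note [measurable] = borel_measurable_hist[OF k] settingD(8)[OF k]
  have "(\<lambda>\<omega>. norm (H k \<omega> *v d k \<omega>)) \<in> borel_measurable (hist R k)" by measurable
  then have "stationarity P R k \<in> borel_measurable (hist R k)"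
    by (rule measurable_cong[THEN iffD1, rotated]) (simp add: stationarity_le(1)[OF _ k])
  then show "stationarity P R k \<in> borel_measurable (hist R (Suc kmax))"
    by (rule measurable_hist_mono) (use k in simp)
  have "infeasibility P R k \<in> borel_measurable (hist R k)"
    unfolding infeasibility_def by measurable
  then show "infeasibility P R k \<in> borel_measurable (hist R (Suc kmax))"
    by (rule measurable_hist_mono) (use k in simp)
qed

lemma Z_hist: "k \<le> kmax \<Longrightarrow> Z k \<in> borel_measurable (hist R (Suc kmax))"
  using stationarity_infeasibility_hist[measurable] unfolding Z_def by measurable

lemma Z_integrable: "k \<le> kmax \<Longrightarrow> integrable ME (Z k)"
proof -
  assume k: "k \<le> kmax"
  interpret prob_space ME by (rule prob_space_ME)
  obtain K where K: "\<forall>x\<in>region P. norm1 (con P x) \<le> K" using norm1_con_bounded[OF smooth] by blast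
  show ?thesis
    by (rule integrable_const_bound[of _ "(kap_d C * kap_g C)\<^sup>2 + K"])
      (use Z_bounded[OF K[rule_format] _ k] Z_nonneg borel_measurable_run(11)[OF k] in \<open>auto intro!: AE_I2\<close>)
qed

end

section \<open>Vanishing mean of the first-order term\<close>

context sqp_const_step
begin

lemma hvec_measurable:
  assumes k: "k \<le> kmax"
  shows "hvec b k \<in> borel_measurable (hist R k)"
proof -
  note [measurable] = borel_measurable_hist[OF k] settingD(8)[OF k]
  have [measurable]: "\<tau>' k \<in> borel_measurable (hist R k)" using borel_measurable_state k by simp
  show ?thesis unfolding hvec_def A_fun_def by measurable
qed

text \<open>A bound on the event, hence almost surely under the conditioned measure, makes the
  products with the gradient integrable.\<close>

lemma hvec_bounded: "\<exists>K. \<forall>k\<le>kmax. \<forall>\<omega>\<in>E. norm (hvec b k \<omega>) \<le> K"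
proof (intro exI allI impI ballI)
  fix k \<omega> assume k: "k \<le> kmax" and \<omega>: "\<omega> \<in> E"
  note sp = event_ED(1)[OF \<omega>] and tb = tau_bounds[OF \<omega> k]
  have d: "norm (d k \<omega>) \<le> kap_d C * kap_g C"
    using kappaD(1)[OF sp k] settingD(10)[OF sp k] constsD(10)
    by (meson mult_left_mono less_imp_le order_trans)
  obtain y' where z: "kkt (H k \<omega>) (J k \<omega>) (g k \<omega>) 0 (z k \<omega>) y'"
    using kkt_kkt_dir[OF pos_def[OF sp k]] unfolding z_def by blast
  have "zeta_c C * norm (z k \<omega>) \<le> kap_g C"
    using pos_def_on_null_norm_le(1)[OF pos_def[OF sp k] z] settingD(10)[OF sp k] by simp
  then have z: "norm (z k \<omega>) \<le> kap_g C / zeta_c C"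
    using constsD(3) by (simp add: field_simps)
  let ?w = "if d k \<omega> \<bullet> (H k \<omega> *v d k \<omega>) \<ge> 0 then - d k \<omega> else - d k \<omega> - z k \<omega>"
  let ?a = "1/2 * (A_max P A + theta A * b) * b\<^sup>2 *
    (if ereal (\<tau>' k \<omega>) \<le> tau_trial_true P A R k \<omega> then (tau_init A + tau_min C) / 2 else tau_min C)"
  let ?c = "b * A_fun (\<tau>' k \<omega>) * \<tau>' k \<omega>"
  have w: "norm ?w \<le> kap_d C * kap_g C + kap_g C / zeta_c C"
  proof -
    have "0 \<le> kap_g C / zeta_c C" using constsD by simp
    then show ?thesis using d z norm_triangle_ineq4[of "- d k \<omega>" "z k \<omega>"] by auto
  qed
  have a: "\<bar>?a\<bar> \<le> 1/2 * A_up * b\<^sup>2 * tau_init A"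
  proof -
    have *: "\<bar>u * t\<bar> \<le> u * tau_init A" if "0 \<le> u" "0 \<le> t" "t \<le> tau_init A" for u t
      using that by (simp add: mult_left_mono)
    show ?thesis by (rule *) (use A_up_pos tau_min_le_init constsD(4) in auto)
  qed
  have "0 \<le> A_fun (\<tau>' k \<omega>)"
    using A_fun_mono[OF constsD(4) tb(5)] A_min_pos by (simp add: A_fun_tau_min)
  then have c: "\<bar>?c\<bar> \<le> b * A_max P A * tau_init A"
    using A_fun_le_max[of "\<tau>' k \<omega>"] tb constsD(4) b_pos A_min_pos A_min_le_max
    by (auto simp: abs_mult intro!: mult_mono)
  have "norm (hvec b k \<omega>) \<le> \<bar>?a\<bar> * norm ?w + \<bar>?c\<bar> * norm (z k \<omega>)"
    unfolding hvec_def by (rule order_trans[OF norm_triangle_ineq]) (simp only: norm_scaleR order_refl)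
  also have "\<dots> \<le> (1/2 * A_up * b\<^sup>2 * tau_init A) * (kap_d C * kap_g C + kap_g C / zeta_c C)
      + (b * A_max P A * tau_init A) * (kap_g C / zeta_c C)"
    using a c w z by (intro add_mono mult_mono) (auto intro: order_trans[OF abs_ge_zero])
  finally show "norm (hvec b k \<omega>) \<le> (1/2 * A_up * b\<^sup>2 * tau_init A) * (kap_d C * kap_g C + kap_g C / zeta_c C)
      + (b * A_max P A * tau_init A) * (kap_g C / zeta_c C)" .
qed

text \<open>A factor measurable in the history passes through the conditional expectation of the
  gradient. The argument runs by components, as the mean condition of \<open>A3\<close>
  does.\<close>

lemma hvec_integral:
  assumes k: "k \<le> kmax"
  shows "integrable ME (\<lambda>\<omega>. hvec b k \<omega> \<bullet> (G k \<omega> - g k \<omega>))"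
    and "(\<integral>\<omega>. hvec b k \<omega> \<bullet> (G k \<omega> - g k \<omega>) \<partial>ME) = 0"
proof -
  interpret prob_space ME by (rule prob_space_ME)
  interpret sigma_finite_subalgebra ME "hist R k" using k by (intro sigma_finite_subalgebra_hist) simp
  note meas [measurable] = borel_measurable_run[OF k]
  have hF [measurable]: "(\<lambda>\<omega>. hvec b k \<omega> $ i) \<in> borel_measurable (hist R k)" for i
    by (rule borel_measurable_vec_nth[OF hvec_measurable[OF k]])
  have hM [measurable]: "(\<lambda>\<omega>. hvec b k \<omega> $ i) \<in> borel_measurable ME" for i
    using borel_measurable_of_hist(2)[OF hF] k by simp
  have Gi [measurable]: "(\<lambda>\<omega>. G k \<omega> $ i) \<in> borel_measurable ME" "(\<lambda>\<omega>. g k \<omega> $ i) \<in> borel_measurable ME" for i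
    using borel_measurable_vec_nth[OF meas(1)] borel_measurable_vec_nth[OF meas(4)] by simp_all
  obtain K where K: "\<And>\<omega>. \<omega> \<in> E \<Longrightarrow> norm (hvec b k \<omega>) \<le> K" using hvec_bounded k by blast
  have dom: "integrable ME (\<lambda>\<omega>. K * (err k \<omega> + kap_g C))"
    using err_integral(3)[OF k] by simp
  have hi: "\<bar>hvec b k \<omega> $ i\<bar> \<le> K" if "\<omega> \<in> E" for \<omega> i
    using K[OF that] component_le_norm_cart[of "hvec b k \<omega>" i] by linarith
  have gi: "\<bar>g k \<omega> $ i\<bar> \<le> kap_g C" if "\<omega> \<in> E" for \<omega> i
    using settingD(10)[OF event_ED(1)[OF that] k] component_le_norm_cart[of "g k \<omega>" i] by linarith
  have ei: "\<bar>G k \<omega> $ i - g k \<omega> $ i\<bar> \<le> err k \<omega>" for \<omega> i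
    using component_le_norm_cart[of "G k \<omega> - g k \<omega>" i] by (simp add: err_def)
  have err0: "0 \<le> err k \<omega>" for \<omega> by (simp add: err_def)
  have K0: "0 \<le> K" using K event_E_nonempty norm_ge_zero by (meson all_not_in_conv order_trans)
  have int_hG: "integrable ME (\<lambda>\<omega>. hvec b k \<omega> $ i * G k \<omega> $ i)" for i
  proof (rule Bochner_Integration.integrable_bound[OF dom])
    show "AE \<omega> in ME. norm (hvec b k \<omega> $ i * G k \<omega> $ i) \<le> norm (K * (err k \<omega> + kap_g C))"
      using AE_ME
    proof eventually_elim
      fix \<omega> assume \<omega>: "\<omega> \<in> E"
      have "\<bar>hvec b k \<omega> $ i\<bar> * \<bar>G k \<omega> $ i\<bar> \<le> K * (err k \<omega> + kap_g C)"
        using hi[OF \<omega>, of i] gi[OF \<omega>, of i] ei[of \<omega> i] K0 by (intro mult_mono) linarith+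
      moreover have "0 \<le> K * (err k \<omega> + kap_g C)" using K0 err0 constsD(1) by (intro mult_nonneg_nonneg add_nonneg_nonneg) auto
      ultimately show "norm (hvec b k \<omega> $ i * G k \<omega> $ i) \<le> norm (K * (err k \<omega> + kap_g C))"
        by (simp only: real_norm_def abs_mult[symmetric] abs_of_nonneg)
    qed
  qed measurable
  have cond: "AE \<omega> in ME. hvec b k \<omega> $ i * real_cond_exp ME (hist R k) (\<lambda>\<omega>. G k \<omega> $ i) \<omega>
      = hvec b k \<omega> $ i * g k \<omega> $ i" for i
    using A3_unfolded(1)[OF k, of i] by (auto elim!: eventually_mono)
  have int_hg: "integrable ME (\<lambda>\<omega>. hvec b k \<omega> $ i * g k \<omega> $ i)" for i
    using real_cond_exp_intg(1)[OF int_hG hF Gi(1)] by (subst integrable_cong_AE[OF _ _ cond, symmetric]) simp_all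
  have eq: "(\<integral>\<omega>. hvec b k \<omega> $ i * g k \<omega> $ i \<partial>ME) = (\<integral>\<omega>. hvec b k \<omega> $ i * G k \<omega> $ i \<partial>ME)" for i
    using real_cond_exp_intg(2)[OF int_hG hF Gi(1)] by (subst integral_cong_AE[OF _ _ cond, symmetric]) simp_all
  have inner: "hvec b k \<omega> \<bullet> (G k \<omega> - g k \<omega>)
      = (\<Sum>i\<in>UNIV. hvec b k \<omega> $ i * G k \<omega> $ i - hvec b k \<omega> $ i * g k \<omega> $ i)" for \<omega>
    by (simp add: inner_vec_def right_diff_distrib)
  show "integrable ME (\<lambda>\<omega>. hvec b k \<omega> \<bullet> (G k \<omega> - g k \<omega>))"
    unfolding inner by (intro Bochner_Integration.integrable_sum Bochner_Integration.integrable_diff int_hG int_hg)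
  show "(\<integral>\<omega>. hvec b k \<omega> \<bullet> (G k \<omega> - g k \<omega>) \<partial>ME) = 0"
    unfolding inner using int_hG int_hg eq
    by (subst Bochner_Integration.integral_sum) (auto simp: Bochner_Integration.integral_diff)
qed

end

section \<open>Averaging over the returned index\<close>

context sqp
begin

lemma ME_density: "ME = density M (\<lambda>\<omega>. ennreal (indicator E \<omega> / measure M E))"
proof -
  interpret prob_space M by (rule settingD(1))
  have "indicator E \<omega> / emeasure M E = ennreal (indicator E \<omega> / measure M E)" for \<omega>
    using settingD(5) divide_ennreal[of "indicator E \<omega>" "measure M E"]
    by (simp add: emeasure_eq_measure ennreal_indicator)
  then show ?thesis unfolding cond_on_def uniform_measure_def by simp
qed

lemma integral_ME:
  fixes f :: "'w \<Rightarrow> real"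
  assumes [measurable]: "f \<in> borel_measurable M"
  shows "(\<integral>\<omega>. f \<omega> \<partial>ME) = (\<integral>\<omega>. indicator E \<omega> / measure M E * f \<omega> \<partial>M)"
    and "integrable ME f \<longleftrightarrow> integrable M (\<lambda>\<omega>. indicator E \<omega> / measure M E * f \<omega>)"
proof -
  note [measurable] = event_E_sets
  have m: "(\<lambda>\<omega>. indicator E \<omega> / measure M E) \<in> borel_measurable M" by measurable
  show "(\<integral>\<omega>. f \<omega> \<partial>ME) = (\<integral>\<omega>. indicator E \<omega> / measure M E * f \<omega> \<partial>M)"
    unfolding ME_density by (subst integral_density[OF assms m]) (auto intro!: AE_I2)
  show "integrable ME f \<longleftrightarrow> integrable M (\<lambda>\<omega>. indicator E \<omega> / measure M E * f \<omega>)"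
    unfolding ME_density by (subst integrable_density[OF assms m]) (auto intro!: AE_I2)
qed

text \<open>Only an inequality: the returned index may exceed \<open>kmax\<close> on a null set, where the process
  is arbitrary, so the integrand may fail to be measurable, and then the integral is \<open>0\<close>.\<close>

lemma cond_mean_le:
  fixes W :: "nat \<Rightarrow> 'w \<Rightarrow> real"
  assumes meas: "\<And>k. k \<le> kmax \<Longrightarrow> W k \<in> borel_measurable (hist R (Suc kmax))"
    and int: "\<And>k. k \<le> kmax \<Longrightarrow> integrable ME (W k)"
    and nonneg: "\<And>k \<omega>. 0 \<le> W k \<omega>"
  shows "cond_mean P A C kmax smax R W \<le> (\<Sum>k\<le>kmax. \<integral>\<omega>. W k \<omega> \<partial>ME) / (real kmax + 1)"
proof -
  interpret prob_space M by (rule settingD(1))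
  let ?K = "rKstar R" and ?F = "hist R (Suc kmax)"
  define VK where "VK = vimage_algebra (space M) ?K (count_space (UNIV::nat set))"
  have Km [measurable]: "?K \<in> measurable M (count_space UNIV)"
    and distr: "distr M (count_space UNIV) ?K = measure_pmf (pmf_of_set {..kmax})"
    and indep: "indep_set (sets ?F) (sets VK)"
    using settingD(2) unfolding uniform_index_def VK_def by auto
  have WM [measurable]: "W k \<in> borel_measurable M" if "k \<le> kmax" for k
    using borel_measurable_of_hist(1)[OF meas[OF that]] by simp
  have le: "AE \<omega> in M. ?K \<omega> \<le> kmax"
  proof -
    have "AE k in distr M (count_space UNIV) ?K. k \<le> kmax"
      unfolding distr AE_measure_pmf_iff by (subst set_pmf_of_set) auto
    then show ?thesis by (subst (asm) AE_distr_iff) auto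
  qed
  have prob: "(\<integral>\<omega>. indicator {k} (?K \<omega>) \<partial>M) = 1 / (real kmax + 1)" if "k \<le> kmax" for k
  proof -
    have "(\<integral>\<omega>. indicator {k} (?K \<omega>) \<partial>M) = (\<integral>j. indicator {k} j \<partial>distr M (count_space UNIV) ?K :: real)"
      by (rule integral_distr[symmetric]) auto
    also have "\<dots> = measure (measure_pmf (pmf_of_set {..kmax})) {k}"
      unfolding distr by simp
    also have "\<dots> = pmf (pmf_of_set {..kmax}) k" by (rule measure_pmf_single)
    also have "\<dots> = 1 / (real kmax + 1)" using that by (simp add: pmf_of_set add.commute)
    finally show ?thesis .
  qed
  \<comment> \<open>Independence holds for the original measure, so conditioning on the event is
    moved into the integrand. The weight depends on the gradients only, and \<open>w * W k\<close>
    is then independent of the index.\<close>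
  define w where "w \<omega> = indicator E \<omega> / measure M E" for \<omega>
  have wF [measurable]: "w \<in> borel_measurable ?F"
    unfolding w_def using event_E_hist by measurable
  have wM [measurable]: "w \<in> borel_measurable M"
    using borel_measurable_of_hist(1)[OF wF] by simp
  have term_eq: "(\<integral>\<omega>. (w \<omega> * W k \<omega>) * indicator {k} (?K \<omega>) \<partial>M) = (\<integral>\<omega>. W k \<omega> \<partial>ME) * (1 / (real kmax + 1))"
    and term_int: "integrable M (\<lambda>\<omega>. (w \<omega> * W k \<omega>) * indicator {k} (?K \<omega>))" if k: "k \<le> kmax" for k
  proof -
    note [measurable] = WM[OF k] meas[OF k]
    have intW: "integrable M (\<lambda>\<omega>. w \<omega> * W k \<omega>)"
      using int[OF k] integral_ME(2)[OF WM[OF k]] by (simp add: w_def)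
    have intK: "integrable M (\<lambda>\<omega>. indicator {k} (?K \<omega>) :: real)"
      by (rule integrable_const_bound[of _ 1]) (auto simp: indicator_def)
    have fF: "(\<lambda>\<omega>. w \<omega> * W k \<omega>) \<in> borel_measurable ?F" by measurable
    have KV: "(\<lambda>\<omega>. indicator {k} (?K \<omega>) :: real) \<in> borel_measurable VK"
    proof -
      have "?K \<in> measurable VK (count_space UNIV)"
        unfolding VK_def by (rule measurable_vimage_algebra1) simp
      from measurable_compose[OF this, of "indicator {k}" borel] show ?thesis by simp
    qed
    have sub: "sigma_sets (space M) {f -` S \<inter> space M | S. S \<in> sets borel} \<subseteq> sets N"
      if "f \<in> borel_measurable N" "space N = space M" for f :: "'w \<Rightarrow> real" and N
    proof -
      have "{f -` S \<inter> space M | S. S \<in> sets borel} \<subseteq> sets N"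
        using measurable_sets[OF that(1)] that(2) by auto
      from sets.sigma_sets_subset[OF this] that(2) show ?thesis by simp
    qed
    have "indep_set (sigma_sets (space M) {(\<lambda>\<omega>. w \<omega> * W k \<omega>) -` S \<inter> space M | S. S \<in> sets borel})
      (sigma_sets (space M) {(\<lambda>\<omega>. indicator {k} (?K \<omega>) :: real) -` S \<inter> space M | S. S \<in> sets borel})"
      unfolding indep_set_def
      by (rule indep_sets_mono_sets[OF indep[unfolded indep_set_def]])
        (use sub[OF fF] sub[OF KV] in \<open>auto simp: VK_def split: bool.split\<close>)
    then have "indep_var borel (\<lambda>\<omega>. w \<omega> * W k \<omega>) borel (\<lambda>\<omega>. indicator {k} (?K \<omega>) :: real)"
      unfolding indep_var_eq
      using borel_measurable_integrable[OF intW] borel_measurable_integrable[OF intK] by blast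
    note * = indep_var_lebesgue_integral[OF this intW intK] indep_var_integrable[OF this intW intK]
    show "(\<integral>\<omega>. (w \<omega> * W k \<omega>) * indicator {k} (?K \<omega>) \<partial>M) = (\<integral>\<omega>. W k \<omega> \<partial>ME) * (1 / (real kmax + 1))"
      using *(1) prob[OF k] integral_ME(1)[OF WM[OF k]] by (simp add: w_def)
    show "integrable M (\<lambda>\<omega>. (w \<omega> * W k \<omega>) * indicator {k} (?K \<omega>))" using *(2) .
  qed
  have sum_eq: "W (?K \<omega>) \<omega> = (\<Sum>k\<le>kmax. W k \<omega> * indicator {k} (?K \<omega>))" if "?K \<omega> \<le> kmax" for \<omega>
  proof -
    have "(\<Sum>k\<le>kmax. W k \<omega> * indicator {k} (?K \<omega>)) = (\<Sum>k\<le>kmax. if ?K \<omega> = k then W k \<omega> else 0)"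
      by (intro sum.cong) (auto simp: indicator_def)
    also have "\<dots> = W (?K \<omega>) \<omega>" using that by (simp add: sum.delta')
    finally show ?thesis ..
  qed
  define S where "S \<omega> = (\<Sum>k\<le>kmax. W k \<omega> * indicator {k} (?K \<omega>))" for \<omega>
  have Sm [measurable]: "S \<in> borel_measurable M"
    unfolding S_def
    by (intro borel_measurable_sum borel_measurable_times measurable_compose[OF Km]) (auto simp: WM)
  have AE_eq: "AE \<omega> in ME. W (?K \<omega>) \<omega> = S \<omega>"
    unfolding cond_on_def
    by (rule AE_uniform_measureI[OF event_E_sets]) (use le in eventually_elim, simp add: S_def sum_eq)
  show ?thesis
  proof (cases "(\<lambda>\<omega>. W (?K \<omega>) \<omega>) \<in> borel_measurable ME")
    case True
    have "cond_mean P A C kmax smax R W = (\<integral>\<omega>. S \<omega> \<partial>ME)"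
      unfolding cond_mean_def using True Sm by (intro integral_cong_AE AE_eq) simp_all
    also have "\<dots> = (\<integral>\<omega>. w \<omega> * S \<omega> \<partial>M)"
      unfolding w_def by (rule integral_ME(1)[OF Sm])
    also have "\<dots> = (\<integral>\<omega>. (\<Sum>k\<le>kmax. (w \<omega> * W k \<omega>) * indicator {k} (?K \<omega>)) \<partial>M)"
      by (simp only: S_def sum_distrib_left mult.assoc)
    also have "\<dots> = (\<Sum>k\<le>kmax. (\<integral>\<omega>. W k \<omega> \<partial>ME) * (1 / (real kmax + 1)))"
      using term_int term_eq by (subst Bochner_Integration.integral_sum) auto
    also have "\<dots> = (\<Sum>k\<le>kmax. \<integral>\<omega>. W k \<omega> \<partial>ME) / (real kmax + 1)"
      by (simp add: sum_divide_distrib)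
    finally show ?thesis by simp
  next
    case False
    then have "cond_mean P A C kmax smax R W = 0"
      unfolding cond_mean_def using borel_measurable_integrable not_integrable_integral_eq by blast
    also have "0 \<le> (\<Sum>k\<le>kmax. \<integral>\<omega>. W k \<omega> \<partial>ME) / (real kmax + 1)"
      by (intro divide_nonneg_nonneg sum_nonneg Bochner_Integration.integral_nonneg nonneg) auto
    finally show ?thesis .
  qed
qed

end

section \<open>Expected noise and summation over the run\<close>

context sqp_const_step
begin

text \<open>The two sides differ only in the part weighted by \<open>tau_init - tau_min\<close>.
  There the cross term \<open>2 * kap_g * sqrt M_var\<close> multiplied by \<open>kap_H\<close> is
  absorbed into \<open>kap_g\<close> squared plus \<open>M_var\<close>; what remains is
  slack.\<close>

lemma c1_c2_le_M_bar: "c1 * M_var C + c2 * sqrt (M_var C) \<le> M_bar P A C b"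
proof -
  define m where "m = sqrt (M_var C)"
  define \<Delta> where "\<Delta> = tau_init A - tau_min C"
  have m: "0 \<le> m" "M_var C = m\<^sup>2" using constsD(6) by (auto simp: m_def)
  have sq: "2 * kap_g C * m \<le> (kap_g C)\<^sup>2 + m\<^sup>2" by (rule sum_squares_bound)
  define h where "h = kap_d C + 1/2 * kap_H C * (kap_d C)\<^sup>2"
  have "h * (m\<^sup>2 + 2 * kap_g C * m)
    \<le> 2 * (kap_d C * m * (2 * kap_g C + m) + kap_H C * (kap_d C)\<^sup>2 * (m\<^sup>2 + 3/2 * (kap_g C)\<^sup>2))"
  proof -
    have "kap_H C * (kap_d C)\<^sup>2 * (2 * kap_g C * m) \<le> kap_H C * (kap_d C)\<^sup>2 * ((kap_g C)\<^sup>2 + m\<^sup>2)"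
      using sq constsD by (intro mult_left_mono) auto
    moreover have "0 \<le> kap_H C * (kap_d C)\<^sup>2 * (kap_g C)\<^sup>2" "0 \<le> kap_H C * (kap_d C)\<^sup>2 * m\<^sup>2"
      "0 \<le> kap_d C * m * (2 * kap_g C + m)"
      using constsD m by (auto intro!: mult_nonneg_nonneg)
    ultimately show ?thesis unfolding h_def by (simp add: algebra_simps power2_eq_square)
  qed
  then have "1/4 * (A_up * \<Delta>) * (h * (m\<^sup>2 + 2 * kap_g C * m))
    \<le> 1/4 * (A_up * \<Delta>) * (2 * (kap_d C * m * (2 * kap_g C + m) + kap_H C * (kap_d C)\<^sup>2 * (m\<^sup>2 + 3/2 * (kap_g C)\<^sup>2)))"
    using A_up_pos tau_min_le_init by (intro mult_left_mono) (auto simp: \<Delta>_def)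
  moreover have "c1 * m\<^sup>2 + c2 * m = 1/4 * A_up * (tau_init A + tau_min C) * inverse (zeta_c C) * m\<^sup>2
    + 1/4 * (A_up * \<Delta>) * (h * (m\<^sup>2 + 2 * kap_g C * m))
    + theta A * tau_init A * kap_g C * kap_d C * m"
    unfolding c1_def c2_def \<Delta>_def[symmetric] h_def[symmetric] divide_inverse[of _ "zeta_c C"]
    by (simp add: algebra_simps power2_eq_square add_divide_distrib)
  moreover have "M_bar P A C b = 1/4 * A_up * (tau_init A + tau_min C) * inverse (zeta_c C) * m\<^sup>2
    + 1/4 * (A_up * \<Delta>) * (2 * (kap_d C * m * (2 * kap_g C + m) + kap_H C * (kap_d C)\<^sup>2 * (m\<^sup>2 + 3/2 * (kap_g C)\<^sup>2)))
    + theta A * tau_init A * kap_g C * kap_d C * m"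
    unfolding M_bar_def m_def[symmetric] \<Delta>_def[symmetric] unfolding m(2) by simp
  ultimately show ?thesis unfolding m_def[symmetric] unfolding m(2) by linarith
qed

lemma kap_nonneg: "0 \<le> kap_dq1 P A C b" "0 \<le> kap_dq2 P A C b" "0 \<le> kap_E3 P A C b"
proof -
  have 1: "0 \<le> 1 + 1/2 * kap_H C * kap_d C" using constsD by simp
  show "0 \<le> kap_dq1 P A C b" "0 \<le> kap_dq2 P A C b" "0 \<le> kap_E3 P A C b"
    unfolding kap_dq1_def kap_dq2_def kap_E3_def V_def[symmetric]
    using V_nonneg constsD 1 by (auto intro!: mult_nonneg_nonneg)
qed

definition "noise k \<omega> = hvec b k \<omega> \<bullet> (G k \<omega> - g k \<omega>) + b\<^sup>2 * (c1 * (err k \<omega>)\<^sup>2 + c2 * err k \<omega>)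
      + indicator (unsafe k) \<omega> * (b * kap_dq1 P A C b
          + b\<^sup>2 * (V * kap_d C * (1 + 1/2 * kap_H C * kap_d C) * ((kap_g C)\<^sup>2 + (err k \<omega>)\<^sup>2)))
      + indicator (bad_event P A R k) \<omega> * (b * (V * (kap_g C * kap_d C * err k \<omega>)))"

text \<open>The linear term vanishes. Unsafe iterations are charged to decreases of the parameter at
  rate \<open>1 / p_tau\<close>, and the bad event is contained in such a decrease, so one
  probability controls every term of order \<open>b\<close>.\<close>

lemma noise_integral:
  assumes k: "k \<le> kmax"
  shows "integrable ME (noise k)"
    and "(\<integral>\<omega>. noise k \<omega> \<partial>ME) \<le> b\<^sup>2 * M_bar P A C b
      + ((b * kap_dq1 P A C b + b\<^sup>2 * kap_dq2 P A C b) / p_tau C + b * kap_E3 P A C b) * measure ME (decr k)"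
proof -
  interpret prob_space ME by (rule prob_space_ME)
  let ?T = "1 + 1/2 * kap_H C * kap_d C"
  define W where "W = V * kap_d C * ?T"
  have W: "0 \<le> W" unfolding W_def using V_nonneg constsD by (intro mult_nonneg_nonneg) auto
  have k2: "kap_dq2 P A C b = W * (M_var C + (kap_g C)\<^sup>2)"
    and k3: "kap_E3 P A C b = V * kap_g C * kap_d C * M_tau C"
    unfolding kap_dq2_def kap_E3_def V_def W_def by simp_all
  define F where "F \<omega> = hvec b k \<omega> \<bullet> (G k \<omega> - g k \<omega>) + (b\<^sup>2 * c1 * (err k \<omega>)\<^sup>2 + b\<^sup>2 * c2 * err k \<omega>)
      + ((b * kap_dq1 P A C b + b\<^sup>2 * W * (kap_g C)\<^sup>2) * indicator (unsafe k) \<omega>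
          + b\<^sup>2 * W * (indicator (unsafe k) \<omega> * (err k \<omega>)\<^sup>2))
      + b * V * kap_g C * kap_d C * (indicator (bad_event P A R k) \<omega> * err k \<omega>)" for \<omega>
  have noise_eq: "noise k = F"
    unfolding noise_def F_def W_def[symmetric] by (auto simp: fun_eq_iff algebra_simps)
  note I = hvec_integral[OF k] err_integral[OF k] err_sq_integral[OF k sets_run(1)[OF k]] bad_integral[OF k]
  have Iu: "integrable ME (indicator (unsafe k) :: _ \<Rightarrow> real)"
    using sets_run(2)[OF k] by (intro integrable_real_indicator) (auto simp: less_top[symmetric])
  have Iu': "(\<integral>\<omega>. indicator (unsafe k) \<omega> \<partial>ME) = measure ME (unsafe k)"
    using sets_run(2)[OF k] by simp
  show "integrable ME (noise k)"
    unfolding noise_eq F_def using I Iu by simp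
  have "(\<integral>\<omega>. F \<omega> \<partial>ME) = b\<^sup>2 * c1 * (\<integral>\<omega>. (err k \<omega>)\<^sup>2 \<partial>ME) + b\<^sup>2 * c2 * (\<integral>\<omega>. err k \<omega> \<partial>ME)
      + ((b * kap_dq1 P A C b + b\<^sup>2 * W * (kap_g C)\<^sup>2) * measure ME (unsafe k)
          + b\<^sup>2 * W * (\<integral>\<omega>. indicator (unsafe k) \<omega> * (err k \<omega>)\<^sup>2 \<partial>ME))
      + b * V * kap_g C * kap_d C * (\<integral>\<omega>. indicator (bad_event P A R k) \<omega> * err k \<omega> \<partial>ME)"
    unfolding F_def using I Iu by (simp add: Iu' del: Bochner_Integration.integral_indicator)
  also have "\<dots> \<le> b\<^sup>2 * c1 * M_var C + b\<^sup>2 * c2 * sqrt (M_var C)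
      + ((b * kap_dq1 P A C b + b\<^sup>2 * W * (kap_g C)\<^sup>2) * measure ME (unsafe k)
          + b\<^sup>2 * W * (M_var C * measure ME (unsafe k)))
      + b * V * kap_g C * kap_d C * (M_tau C * measure ME (decr k))"
  proof (intro add_mono mult_left_mono order_refl)
    have "measure ME (bad_event P A R k) \<le> measure ME (decr k)"
      using bad_subset_decr sets_run(3)[OF k] by (intro finite_measure_mono) auto
    then have "M_tau C * measure ME (bad_event P A R k) \<le> M_tau C * measure ME (decr k)"
      using constsD(7) by (intro mult_left_mono) auto
    then show "(\<integral>\<omega>. indicator (bad_event P A R k) \<omega> * err k \<omega> \<partial>ME) \<le> M_tau C * measure ME (decr k)"
      using bad_integral(2)[OF k] by linarith
    have "0 \<le> c1" "0 \<le> c2"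
      unfolding c1_def c2_def using A_up_pos tau_min_le_init constsD paramsD
      by (auto intro!: add_nonneg_nonneg mult_nonneg_nonneg divide_nonneg_nonneg)
    then show "0 \<le> b\<^sup>2 * c1" "0 \<le> b\<^sup>2 * c2" by auto
    show "0 \<le> b\<^sup>2 * W" using W by simp
    then show "0 \<le> b * kap_dq1 P A C b + b\<^sup>2 * W * (kap_g C)\<^sup>2"
      using kap_nonneg b_pos W by (intro add_nonneg_nonneg mult_nonneg_nonneg) auto
    show "0 \<le> b * V * kap_g C * kap_d C" using b_pos V_nonneg constsD by (intro mult_nonneg_nonneg) auto
  qed (use I in auto)
  also have "\<dots> = b\<^sup>2 * (c1 * M_var C + c2 * sqrt (M_var C))
      + (b * kap_dq1 P A C b + b\<^sup>2 * kap_dq2 P A C b) * measure ME (unsafe k)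
      + b * kap_E3 P A C b * measure ME (decr k)"
    by (simp add: k2 k3 algebra_simps)
  also have "\<dots> \<le> b\<^sup>2 * M_bar P A C b
      + (b * kap_dq1 P A C b + b\<^sup>2 * kap_dq2 P A C b) * (measure ME (decr k) / p_tau C)
      + b * kap_E3 P A C b * measure ME (decr k)"
  proof (intro add_mono mult_left_mono order_refl)
    show "measure ME (unsafe k) \<le> measure ME (decr k) / p_tau C"
      using unsafe_prob[OF k] constsD(8) by (simp add: pos_le_divide_eq mult.commute)
  qed (use c1_c2_le_M_bar b_pos kap_nonneg in auto)
  also have "\<dots> = b\<^sup>2 * M_bar P A C b
      + ((b * kap_dq1 P A C b + b\<^sup>2 * kap_dq2 P A C b) / p_tau C + b * kap_E3 P A C b) * measure ME (decr k)"
    by (simp add: distrib_right)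
  finally show "(\<integral>\<omega>. noise k \<omega> \<partial>ME) \<le> b\<^sup>2 * M_bar P A C b
      + ((b * kap_dq1 P A C b + b\<^sup>2 * kap_dq2 P A C b) / p_tau C + b * kap_E3 P A C b) * measure ME (decr k)"
    unfolding noise_eq .
qed

lemma sum_Z_integral_le:
  "1/2 * A_min P A C * b * \<eta> * (\<Sum>k\<le>kmax. \<integral>\<omega>. Z k \<omega> \<partial>ME)
    \<le> merit (tau_init A) (x_init A) + (real kmax + 1) * (b\<^sup>2 * M_bar P A C b)
      + ((b * kap_dq1 P A C b + b\<^sup>2 * kap_dq2 P A C b) / p_tau C + b * kap_E3 P A C b)
        * (\<Sum>k\<le>kmax. measure ME (decr k))"
proof -
  interpret prob_space ME by (rule prob_space_ME)
  let ?a = "1/2 * A_min P A C * b * \<eta>"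
  let ?B = "(b * kap_dq1 P A C b + b\<^sup>2 * kap_dq2 P A C b) / p_tau C + b * kap_E3 P A C b"
  have intZ: "integrable ME (\<lambda>\<omega>. \<Sum>k\<le>kmax. ?a * Z k \<omega>)"
    using Z_integrable by (intro Bochner_Integration.integrable_sum integrable_mult_right) auto
  have intN: "integrable ME (\<lambda>\<omega>. \<Sum>k\<le>kmax. noise k \<omega>)"
    using noise_integral(1) by (intro Bochner_Integration.integrable_sum) auto
  have "?a * (\<Sum>k\<le>kmax. \<integral>\<omega>. Z k \<omega> \<partial>ME) = (\<integral>\<omega>. (\<Sum>k\<le>kmax. ?a * Z k \<omega>) \<partial>ME)"
    using Z_integrable by (subst Bochner_Integration.integral_sum) (auto simp: sum_distrib_left)
  also have "\<dots> \<le> (\<integral>\<omega>. merit (tau_init A) (x_init A) + (\<Sum>k\<le>kmax. noise k \<omega>) \<partial>ME)"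
  proof (rule integral_mono_AE[OF intZ])
    show "AE \<omega> in ME. (\<Sum>k\<le>kmax. ?a * Z k \<omega>) \<le> merit (tau_init A) (x_init A) + (\<Sum>k\<le>kmax. noise k \<omega>)"
      using AE_ME
    proof eventually_elim
      fix \<omega> assume \<omega>: "\<omega> \<in> E"
      have "(\<Sum>k\<le>kmax. ?a * Z k \<omega>)
        \<le> (\<Sum>k\<le>kmax. (merit (\<tau> k \<omega>) (X k \<omega>) - merit (\<tau> k \<omega>) (X (Suc k) \<omega>)) + noise k \<omega>)"
        using step_bound[OF \<omega>] by (intro sum_mono) (simp add: noise_def mult.assoc add.assoc)
      also have "\<dots> \<le> merit (tau_init A) (x_init A) + (\<Sum>k\<le>kmax. noise k \<omega>)"
        unfolding sum.distrib using sum_merit_le[OF \<omega>] by simp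
      finally show "(\<Sum>k\<le>kmax. ?a * Z k \<omega>) \<le> merit (tau_init A) (x_init A) + (\<Sum>k\<le>kmax. noise k \<omega>)" .
    qed
  qed (use intN in simp)
  also have "\<dots> = merit (tau_init A) (x_init A) + (\<Sum>k\<le>kmax. \<integral>\<omega>. noise k \<omega> \<partial>ME)"
    using intN noise_integral(1) prob_space by (simp add: Bochner_Integration.integral_sum)
  also have "(\<Sum>k\<le>kmax. \<integral>\<omega>. noise k \<omega> \<partial>ME) \<le> (\<Sum>k\<le>kmax. b\<^sup>2 * M_bar P A C b + ?B * measure ME (decr k))"
    using noise_integral(2) by (intro sum_mono) auto
  also have "\<dots> = (real kmax + 1) * (b\<^sup>2 * M_bar P A C b) + ?B * (\<Sum>k\<le>kmax. measure ME (decr k))"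
    by (simp add: sum.distrib sum_distrib_left add.commute)
  finally show ?thesis by simp
qed

end

subsection \<open>The complexity bound\<close>

context sqp
begin

definition "Z_avg = (\<Sum>k\<le>kmax. \<integral>\<omega>. Z k \<omega> \<partial>ME) / (real kmax + 1)"

definition "decr_sum = (\<Sum>k\<le>kmax. measure ME (decr k))"

lemma decr_sum_nonneg: "0 \<le> decr_sum"
  unfolding decr_sum_def by (intro sum_nonneg) simp

lemma cond_mean_Z_le: "cond_mean P A C kmax smax R Z \<le> Z_avg"
  unfolding Z_avg_def by (rule cond_mean_le[OF Z_hist Z_integrable Z_nonneg])

lemma Z_avg_bounded:
  assumes "\<And>x. x \<in> region P \<Longrightarrow> norm1 (con P x) \<le> K"
  shows "Z_avg \<le> (kap_d C * kap_g C)\<^sup>2 + K"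
proof -
  interpret prob_space ME by (rule prob_space_ME)
  have "(\<integral>\<omega>. Z k \<omega> \<partial>ME) \<le> (kap_d C * kap_g C)\<^sup>2 + K" if "k \<le> kmax" for k
    using Z_bounded[OF assms _ that] Z_integrable[OF that] by (intro integral_le_const) (auto intro!: AE_I2)
  then have "(\<Sum>k\<le>kmax. \<integral>\<omega>. Z k \<omega> \<partial>ME) \<le> (\<Sum>k\<le>kmax. (kap_d C * kap_g C)\<^sup>2 + K)"
    by (intro sum_mono) auto
  then show ?thesis unfolding Z_avg_def by (simp add: divide_le_eq mult.commute add.commute)
qed

lemma cond_mean_stationarity_le:
  "\<bar>cond_mean P A C kmax smax R (\<lambda>k \<omega>. (stationarity P R k \<omega>)^2 + infeasibility P R k \<omega>)\<bar>
    \<le> max 1 ((kap_H C)\<^sup>2) * Z_avg"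
proof -
  let ?m = "max 1 ((kap_H C)\<^sup>2)"
  define W where "W k \<omega> = (stationarity P R k \<omega>)^2 + infeasibility P R k \<omega>" for k \<omega>
  have nonneg: "0 \<le> W k \<omega>" for k \<omega>
    unfolding W_def infeasibility_def by (intro add_nonneg_nonneg norm1_nonneg) auto
  have le: "W k \<omega> \<le> ?m * Z k \<omega>" for k \<omega>
  proof -
    have "(stationarity P R k \<omega>)\<^sup>2 = (kap_H C)\<^sup>2 * ((stationarity P R k \<omega>)\<^sup>2 / (kap_H C)\<^sup>2)"
      using constsD(2) by simp
    also have "\<dots> \<le> ?m * ((stationarity P R k \<omega>)\<^sup>2 / (kap_H C)\<^sup>2)"
      by (intro mult_right_mono) auto
    finally have "(stationarity P R k \<omega>)\<^sup>2 \<le> ?m * ((stationarity P R k \<omega>)\<^sup>2 / (kap_H C)\<^sup>2)" .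
    moreover have "1 * infeasibility P R k \<omega> \<le> ?m * infeasibility P R k \<omega>"
      by (intro mult_right_mono) (auto simp: infeasibility_def norm1_nonneg)
    ultimately show ?thesis unfolding W_def Z_def distrib_left by linarith
  qed
  have meas: "W k \<in> borel_measurable (hist R (Suc kmax))" if "k \<le> kmax" for k
    using stationarity_infeasibility_hist[OF that, measurable] unfolding W_def by measurable
  have int: "integrable ME (W k)" if k: "k \<le> kmax" for k
  proof (rule Bochner_Integration.integrable_bound)
    show "integrable ME (\<lambda>\<omega>. ?m * Z k \<omega>)" using Z_integrable[OF k] by simp
    show "W k \<in> borel_measurable ME" using borel_measurable_of_hist(2)[OF meas[OF k]] by simp
    show "AE \<omega> in ME. norm (W k \<omega>) \<le> norm (?m * Z k \<omega>)"
      using le nonneg Z_nonneg by (intro AE_I2) (auto simp: abs_mult)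
  qed
  have "cond_mean P A C kmax smax R W \<le> (\<Sum>k\<le>kmax. \<integral>\<omega>. W k \<omega> \<partial>ME) / (real kmax + 1)"
    by (rule cond_mean_le[OF meas int nonneg])
  also have "\<dots> \<le> (\<Sum>k\<le>kmax. \<integral>\<omega>. ?m * Z k \<omega> \<partial>ME) / (real kmax + 1)"
    using int Z_integrable le by (intro divide_right_mono sum_mono integral_mono) auto
  also have "\<dots> = ?m * Z_avg"
    unfolding Z_avg_def by (simp add: sum_distrib_left)
  finally have "cond_mean P A C kmax smax R W \<le> ?m * Z_avg" .
  moreover have "0 \<le> cond_mean P A C kmax smax R W"
    unfolding cond_mean_def by (intro Bochner_Integration.integral_nonneg nonneg)
  ultimately show ?thesis unfolding W_def by simp
qed

lemma merit_init_nonneg: "0 \<le> merit (tau_init A) (x_init A)"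
proof -
  obtain \<omega> where "\<omega> \<in> space M" using event_E_nonempty event_ED(1) by blast
  then have "x_init A \<in> region P" using settingD(9)[of \<omega> 0] run_zero by simp
  then show ?thesis
    unfolding merit_def using smooth_problemD(6)[OF smooth] paramsD(1)
    by (intro add_nonneg_nonneg mult_nonneg_nonneg norm1_nonneg) auto
qed

end

lemma (in sqp_const_step) Z_avg_le:
  "Z_avg \<le> 2 * (kap_Psi C + 1) / (kap_q C * tau_min C * A_min P A C * (b * (real kmax + 1))) *
    (merit (tau_init A) (x_init A) + (real kmax + 1) * b\<^sup>2 * M_bar P A C b
      + ((b * kap_dq1 P A C b + b\<^sup>2 * kap_dq2 P A C b) / p_tau C + b * kap_E3 P A C b) * decr_sum)"
proof -
  define T where "T = merit (tau_init A) (x_init A) + (real kmax + 1) * b\<^sup>2 * M_bar P A C b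
      + ((b * kap_dq1 P A C b + b\<^sup>2 * kap_dq2 P A C b) / p_tau C + b * kap_E3 P A C b) * decr_sum"
  define S where "S = (\<Sum>k\<le>kmax. \<integral>\<omega>. Z k \<omega> \<partial>ME)"
  have "1/2 * A_min P A C * b * \<eta> * S \<le> T"
    using sum_Z_integral_le unfolding S_def T_def decr_sum_def by (simp add: mult.assoc)
  moreover have pos: "0 < 1/2 * A_min P A C * b * \<eta>" using A_min_pos b_pos \<eta>_pos by simp
  ultimately have "S \<le> T / (1/2 * A_min P A C * b * \<eta>)"
    by (subst pos_le_divide_eq[OF pos]) (simp add: mult.commute)
  then have "Z_avg \<le> T / (1/2 * A_min P A C * b * \<eta>) / (real kmax + 1)"
    unfolding Z_avg_def S_def[symmetric] by (intro divide_right_mono) auto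
  also have "\<dots> = 2 * (kap_Psi C + 1) / (kap_q C * tau_min C * A_min P A C * (b * (real kmax + 1))) * T"
    unfolding \<eta>_def by (simp add: mult_ac)
  finally show ?thesis unfolding T_def .
qed

text \<open>The binomial sum contains the term 1 at \<open>j = 0\<close>.\<close>

lemma delta_hat_bounds:
  assumes "0 < \<delta>" "\<delta> < 1"
  shows "0 < delta_hat kmax smax \<delta>" "delta_hat kmax smax \<delta> < 1"
proof -
  have "1 = (\<Sum>j\<in>{0::nat}. real (kmax choose j))" by simp
  also have "\<dots> \<le> (\<Sum>j=0..smax - 1. real (kmax choose j))" by (intro sum_mono2) auto
  finally have "1 \<le> (\<Sum>j=0..smax - 1. real (kmax choose j))" .
  then show "0 < delta_hat kmax smax \<delta>" "delta_hat kmax smax \<delta> < 1"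
    using assms unfolding delta_hat_def by (auto simp: divide_less_eq)
qed

text \<open>Lets \<open>ell\<close> stand in for \<open>smax\<close>, the bound on the expected
  number of decreases; its further summands are nonnegative.\<close>

lemma ell_ge:
  assumes "0 < \<delta>" "\<delta> \<le> 1"
  shows "real s \<le> ell s \<delta>"
proof -
  have "0 \<le> ln (1 / \<delta>)" using assms by (intro ln_ge_zero) simp
  then show ?thesis unfolding ell_def by simp
qed

lemma (in sqp_const_step) Z_avg_explicit_bound:
  assumes b: "b = \<gamma> / sqrt (real kmax + 1)" and \<gamma>: "0 < \<gamma>" and l: "real smax \<le> l"
  shows "Z_avg \<le> 2 * (kap_Psi C + 1) *
              ((tau_init A * (obj P (x_init A) - f_low P) + norm1 (con P (x_init A))
                + M_bar P A C b * \<gamma>^2)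
               / (kap_q C * tau_min C * A_min P A C * \<gamma> * sqrt (real kmax + 1)))
            + 2 * (kap_Psi C + 1) *
              ((kap_E3 P A C b * \<gamma> * (l + 1))
               / (kap_q C * tau_min C * A_min P A C * \<gamma> * sqrt (real kmax + 1)))
            + (kap_Psi C + 1) *
              (2 * (kap_dq1 P A C b * \<gamma> + kap_dq2 P A C b * \<gamma>^2 / sqrt (real kmax + 1))
               / (kap_q C * tau_min C * A_min P A C * \<gamma> * (real kmax + 1)))
              * real_of_int \<lceil>(l + 1) / p_tau C\<rceil>"
    (is "_ \<le> ?X")
proof -
  define T where "T = sqrt (real kmax + 1)"
  have T: "1 \<le> T" "real kmax + 1 = T\<^sup>2" by (simp_all add: T_def)
  have \<gamma>_eq: "\<gamma> = b * T" using b T by (simp add: T_def[symmetric])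
  have b_le: "b \<le> \<gamma>" using \<gamma>_eq T b_pos by simp
  define q0 where "q0 = kap_q C * tau_min C * A_min P A C"
  have q0: "0 < q0" unfolding q0_def using constsD A_min_pos by simp
  define cl where "cl = real_of_int \<lceil>(l + 1) / p_tau C\<rceil>"
  define F where "F = merit (tau_init A) (x_init A) + M_bar P A C b * \<gamma>\<^sup>2 + kap_E3 P A C b * \<gamma> * (l + 1)
    + (b * kap_dq1 P A C b + b\<^sup>2 * kap_dq2 P A C b) * cl"
  have X_eq: "?X = 2 * (kap_Psi C + 1) / (q0 * (b * T\<^sup>2)) * F"
    unfolding F_def merit_def T_def[symmetric] T(2) q0_def[symmetric] cl_def[symmetric] \<gamma>_eq
    using q0 b_pos T(1) by (simp add: field_simps power2_eq_square)
  have N: "decr_sum \<le> l" using sum_decr_prob(1) l unfolding decr_sum_def by linarith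
  \<comment> \<open>The target charges \<open>\<gamma>\<close> here where the estimate has only
    \<open>b\<close>.\<close>
  have "b * kap_E3 P A C b * decr_sum \<le> \<gamma> * kap_E3 P A C b * (l + 1)"
    using b_le b_pos kap_nonneg N decr_sum_nonneg \<gamma> by (intro mult_mono mult_nonneg_nonneg) auto
  moreover have "(b * kap_dq1 P A C b + b\<^sup>2 * kap_dq2 P A C b) * (decr_sum / p_tau C)
      \<le> (b * kap_dq1 P A C b + b\<^sup>2 * kap_dq2 P A C b) * cl"
  proof (intro mult_left_mono add_nonneg_nonneg mult_nonneg_nonneg)
    have "decr_sum / p_tau C \<le> (l + 1) / p_tau C" using N constsD(8) by (intro divide_right_mono) auto
    also have "\<dots> \<le> cl" unfolding cl_def by (rule le_of_int_ceiling)
    finally show "decr_sum / p_tau C \<le> cl" .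
  qed (use b_pos kap_nonneg in auto)
  ultimately have "merit (tau_init A) (x_init A) + (real kmax + 1) * b\<^sup>2 * M_bar P A C b
      + ((b * kap_dq1 P A C b + b\<^sup>2 * kap_dq2 P A C b) / p_tau C + b * kap_E3 P A C b) * decr_sum \<le> F"
  proof -
    assume le: "b * kap_E3 P A C b * decr_sum \<le> \<gamma> * kap_E3 P A C b * (l + 1)"
      "(b * kap_dq1 P A C b + b\<^sup>2 * kap_dq2 P A C b) * (decr_sum / p_tau C)
      \<le> (b * kap_dq1 P A C b + b\<^sup>2 * kap_dq2 P A C b) * cl"
    have "((b * kap_dq1 P A C b + b\<^sup>2 * kap_dq2 P A C b) / p_tau C + b * kap_E3 P A C b) * decr_sum
      = (b * kap_dq1 P A C b + b\<^sup>2 * kap_dq2 P A C b) * (decr_sum / p_tau C) + b * kap_E3 P A C b * decr_sum"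
      by (simp add: distrib_right)
    moreover have "(real kmax + 1) * b\<^sup>2 * M_bar P A C b = M_bar P A C b * \<gamma>\<^sup>2"
      unfolding T(2) \<gamma>_eq by (simp add: power_mult_distrib)
    moreover have "\<gamma> * kap_E3 P A C b * (l + 1) = kap_E3 P A C b * \<gamma> * (l + 1)" by simp
    ultimately show ?thesis unfolding F_def using le by linarith
  qed
  then have "2 * (kap_Psi C + 1) / (q0 * (b * T\<^sup>2)) * (merit (tau_init A) (x_init A) + (real kmax + 1) * b\<^sup>2 * M_bar P A C b
      + ((b * kap_dq1 P A C b + b\<^sup>2 * kap_dq2 P A C b) / p_tau C + b * kap_E3 P A C b) * decr_sum)
      \<le> 2 * (kap_Psi C + 1) / (q0 * (b * T\<^sup>2)) * F"
    using constsD q0 b_pos T(1) by (intro mult_left_mono) auto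
  then show ?thesis
    unfolding X_eq using Z_avg_le unfolding q0_def[symmetric] T(2) by linarith
qed

text \<open>The constants grow with the step parameter, so evaluating them at
  \<open>\<gamma>\<close> instead of \<open>b\<close> frees them from \<open>kmax\<close>, as a
  uniform rate requires.\<close>

lemma (in sqp_const_step) Z_avg_rate:
  assumes b: "b = \<gamma> / sqrt (real kmax + 1)" and \<gamma>: "0 < \<gamma>"
  shows "Z_avg \<le> 2 * (kap_Psi C + 1) / (kap_q C * tau_min C * A_min P A C * \<gamma>) / sqrt (real kmax + 1) *
    (merit (tau_init A) (x_init A) + M_bar P A C \<gamma> * \<gamma>\<^sup>2
      + ((\<gamma> * kap_dq1 P A C \<gamma> + \<gamma>\<^sup>2 * kap_dq2 P A C \<gamma>) / p_tau C + \<gamma> * kap_E3 P A C \<gamma>) * decr_sum)"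
proof -
  define T where "T = sqrt (real kmax + 1)"
  have T: "1 \<le> T" "real kmax + 1 = T\<^sup>2" by (simp_all add: T_def)
  have \<gamma>_eq: "\<gamma> = b * T" using b T by (simp add: T_def[symmetric])
  have b_le: "b \<le> \<gamma>" using \<gamma>_eq T b_pos by simp
  define q0 where "q0 = kap_q C * tau_min C * A_min P A C"
  have q0: "0 < q0" unfolding q0_def using constsD A_min_pos by simp
  have up: "A_up \<le> A_max P A + theta A * \<gamma>" using b_le paramsD(9) by (simp add: mult_left_mono)
  have V_up: "V \<le> (A_max P A + theta A * \<gamma>) * tau_init A - A_min P A C * tau_min C"
    unfolding V_def using up paramsD(1) by (simp add: mult_right_mono)
  have fac: "0 \<le> 1 + 1/2 * kap_H C * kap_d C" "0 \<le> M_var C + (kap_g C)\<^sup>2" using constsD by auto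
  have k1: "kap_dq1 P A C b \<le> kap_dq1 P A C \<gamma>" and k2: "kap_dq2 P A C b \<le> kap_dq2 P A C \<gamma>"
    and k3: "kap_E3 P A C b \<le> kap_E3 P A C \<gamma>"
    unfolding kap_dq1_def kap_dq2_def kap_E3_def V_def[symmetric] using V_up constsD fac
    by (intro mult_right_mono; simp)+
  have M: "M_bar P A C b \<le> M_bar P A C \<gamma>"
    unfolding M_bar_def
    using up tau_min_le_init constsD
    using b_le paramsD(1,9)
    by (intro add_mono mult_right_mono mult_left_mono order_refl) (auto intro!: mult_nonneg_nonneg add_nonneg_nonneg)
  have "merit (tau_init A) (x_init A) + (real kmax + 1) * b\<^sup>2 * M_bar P A C b
      + ((b * kap_dq1 P A C b + b\<^sup>2 * kap_dq2 P A C b) / p_tau C + b * kap_E3 P A C b) * decr_sum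
    \<le> merit (tau_init A) (x_init A) + M_bar P A C \<gamma> * \<gamma>\<^sup>2
      + ((\<gamma> * kap_dq1 P A C \<gamma> + \<gamma>\<^sup>2 * kap_dq2 P A C \<gamma>) / p_tau C + \<gamma> * kap_E3 P A C \<gamma>) * decr_sum"
  proof (intro add_mono mult_right_mono divide_right_mono order_refl decr_sum_nonneg)
    have "(real kmax + 1) * b\<^sup>2 = \<gamma>\<^sup>2" unfolding T(2) \<gamma>_eq by (simp add: power_mult_distrib)
    then show "(real kmax + 1) * b\<^sup>2 * M_bar P A C b \<le> M_bar P A C \<gamma> * \<gamma>\<^sup>2"
      using mult_right_mono[OF M, of "\<gamma>\<^sup>2"] by (simp add: mult.commute)
    show "b * kap_dq1 P A C b \<le> \<gamma> * kap_dq1 P A C \<gamma>" "b * kap_E3 P A C b \<le> \<gamma> * kap_E3 P A C \<gamma>"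
      using k1 k3 b_le b_pos \<gamma> kap_nonneg by (auto intro!: mult_mono)
    show "b\<^sup>2 * kap_dq2 P A C b \<le> \<gamma>\<^sup>2 * kap_dq2 P A C \<gamma>"
      using k2 b_le b_pos \<gamma> kap_nonneg by (auto intro!: mult_mono power_mono)
  qed (use constsD(8) in auto)
  then have "2 * (kap_Psi C + 1) / (q0 * (b * T\<^sup>2)) * (merit (tau_init A) (x_init A) + (real kmax + 1) * b\<^sup>2 * M_bar P A C b
      + ((b * kap_dq1 P A C b + b\<^sup>2 * kap_dq2 P A C b) / p_tau C + b * kap_E3 P A C b) * decr_sum)
    \<le> 2 * (kap_Psi C + 1) / (q0 * (b * T\<^sup>2)) * (merit (tau_init A) (x_init A) + M_bar P A C \<gamma> * \<gamma>\<^sup>2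
      + ((\<gamma> * kap_dq1 P A C \<gamma> + \<gamma>\<^sup>2 * kap_dq2 P A C \<gamma>) / p_tau C + \<gamma> * kap_E3 P A C \<gamma>) * decr_sum)"
    using constsD q0 b_pos T(1) by (intro mult_left_mono) auto
  then have le: "2 * (kap_Psi C + 1) / (q0 * (b * T\<^sup>2)) * (merit (tau_init A) (x_init A) + T\<^sup>2 * b\<^sup>2 * M_bar P A C b
      + ((b * kap_dq1 P A C b + b\<^sup>2 * kap_dq2 P A C b) / p_tau C + b * kap_E3 P A C b) * decr_sum)
    \<le> 2 * (kap_Psi C + 1) / (q0 * (b * T\<^sup>2)) * (merit (tau_init A) (x_init A) + M_bar P A C \<gamma> * \<gamma>\<^sup>2
      + ((\<gamma> * kap_dq1 P A C \<gamma> + \<gamma>\<^sup>2 * kap_dq2 P A C \<gamma>) / p_tau C + \<gamma> * kap_E3 P A C \<gamma>) * decr_sum)"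
    unfolding T(2) .
  have eq: "2 * (kap_Psi C + 1) / (q0 * (b * T\<^sup>2)) = 2 * (kap_Psi C + 1) / (q0 * \<gamma>) / T"
    unfolding \<gamma>_eq by (simp add: power2_eq_square mult_ac)
  show ?thesis
    using order_trans[OF Z_avg_le[unfolded q0_def[symmetric] T(2)] le]
    unfolding eq q0_def[symmetric] T_def[symmetric] .
qed

lemma (in sqp) const_step:
  assumes "0 < \<gamma>" "\<gamma> \<le> A_min P A C / (A_max P A + theta A)"
    and b: "b = \<gamma> / sqrt (real kmax + 1)" "\<And>k. k \<le> kmax \<Longrightarrow> \<beta> k = b"
    and "unit_step_interval P A C kmax smax \<beta> R"
  shows "sqp_const_step P A C kmax smax \<beta> R b"
proof
  have b_le: "b \<le> \<gamma>"
    using b(1) assms(1) by (simp add: divide_le_eq)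
  have b01: "0 < b" "b \<le> 1" using settingD(6)[of 0] b(2)[of 0] by auto
  have pos: "0 < A_max P A" using A_min_pos A_min_le_max by linarith
  have "(A_max P A + theta A * b) * b \<le> (A_max P A + theta A) * \<gamma>"
    using b01 b_le pos paramsD(9) by (intro mult_mono add_mono) (auto simp: mult_left_le)
  also have "\<dots> \<le> A_min P A C"
    using assms(2) pos paramsD(9) by (subst (asm) pos_le_divide_eq) (auto simp: mult.commute)
  finally show "(A_max P A + theta A * b) * b \<le> A_min P A C" .
qed (use assms in auto)

text \<open>On the event the left end is \<open>\<beta> k * A_fun (\<tau> k \<omega>)\<close>, and
  \<open>A_fun\<close> never exceeds \<open>A_max\<close>.\<close>

lemma (in sqp) unit_step_interval_eventually:
  assumes \<beta>: "\<And>k. k \<le> kmax \<Longrightarrow> \<beta> k = \<gamma> / sqrt (real kmax + 1)"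
    and large: "\<gamma> * A_max P A \<le> sqrt (real kmax + 1)"
  shows "unit_step_interval P A C kmax smax \<beta> R"
  unfolding unit_step_interval_def
proof (intro ballI allI impI)
  fix \<omega> k assume \<omega>: "\<omega> \<in> E" and k: "k \<le> kmax"
  have "\<beta> k * rXi R k \<omega> * \<tau> k \<omega> / (\<tau> k \<omega> * L + Gam A) = \<beta> k * A_fun (\<tau> k \<omega>)"
    using event_ED(4)[OF \<omega> k] by (simp add: A_fun_def)
  also have "\<dots> \<le> \<beta> k * A_max P A"
    using A_fun_le_max[of "\<tau> k \<omega>"] tau_bounds[OF \<omega> k] settingD(6)[OF k] by (intro mult_left_mono) auto
  also have "\<dots> \<le> 1"
    using large by (simp add: \<beta>[OF k] divide_le_eq add_pos_pos)
  finally show "\<beta> k * rXi R k \<omega> * \<tau> k \<omega> / (\<tau> k \<omega> * L + Gam A) \<le> 1" .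
qed

theorem corollary1:
  fixes P :: "('n::finite, 'm::finite) sqp_problem"
    and A :: "'n sqp_params"
    and C :: sqp_consts
    and S :: "'s measure"
    and F :: "real ^ 'n \<Rightarrow> 's \<Rightarrow> real"
    and \<gamma> :: real
  assumes "CARD('m) \<le> CARD('n)"
    and "stochastic_objective S F (obj P)"
    and "smooth_problem P"
    and "admissible_params P A"
    and "admissible_consts C"
    and "0 < \<gamma>" and "\<gamma> \<le> A_min P A C / (A_max P A + theta A)"
  shows
    "(\<forall>(R :: ('w, 'n, 'm) sqp_process) kmax smax \<beta> b \<delta>.
        1 \<le> smax \<and> sqp_setting P A C kmax smax \<beta> R \<and>
        unit_step_interval P A C kmax smax \<beta> R \<and>
        b = \<gamma> / sqrt (real kmax + 1) \<and> (\<forall>k\<le>kmax. \<beta> k = b) \<and> 0 < \<delta> \<and> \<delta> < 1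
        \<longrightarrow>
        measure (pspace R) {\<omega> \<in> space (pspace R).
          cond_mean P A C kmax smax R
            (\<lambda>k \<omega>. (stationarity P R k \<omega>)^2 / (kap_H C)^2 + infeasibility P R k \<omega>)
          \<le> 2 * (kap_Psi C + 1) *
              ((tau_init A * (obj P (x_init A) - f_low P) + norm1 (con P (x_init A))
                + M_bar P A C b * \<gamma>^2)
               / (kap_q C * tau_min C * A_min P A C * \<gamma> * sqrt (real kmax + 1)))
            + 2 * (kap_Psi C + 1) *
              ((kap_E3 P A C b * \<gamma> * (ell smax (delta_hat kmax smax \<delta> / 2) + 1))
               / (kap_q C * tau_min C * A_min P A C * \<gamma> * sqrt (real kmax + 1)))
            + (kap_Psi C + 1) *
              (2 * (kap_dq1 P A C b * \<gamma> + kap_dq2 P A C b * \<gamma>^2 / sqrt (real kmax + 1))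
               / (kap_q C * tau_min C * A_min P A C * \<gamma> * (real kmax + 1)))
              * real_of_int \<lceil>(ell smax (delta_hat kmax smax \<delta> / 2) + 1) / p_tau C\<rceil>}
        \<ge> 1 - \<delta>)
     \<and>
     (\<exists>K>0. \<forall>(R :: ('w, 'n, 'm) sqp_process) kmax smax \<beta> \<delta>.
        2 \<le> kmax \<and> 1 \<le> smax \<and> sqp_setting P A C kmax smax \<beta> R \<and>
        (\<forall>k\<le>kmax. \<beta> k = \<gamma> / sqrt (real kmax + 1)) \<and> 0 < \<delta> \<and> \<delta> < 1
        \<longrightarrow>
        measure (pspace R) {\<omega> \<in> space (pspace R).
          \<bar>cond_mean P A C kmax smax R
            (\<lambda>k \<omega>. (stationarity P R k \<omega>)^2 + infeasibility P R k \<omega>)\<bar>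
          \<le> K *
            ((tau_init A * (obj P (x_init A) - f_low P) + norm1 (con P (x_init A)) + M_var C)
               / sqrt (real kmax + 1)
             + (tau_init A - tau_min C) * (real smax * ln (real kmax) + ln (1/\<delta>))
               / sqrt (real kmax + 1))}
        \<ge> 1 - \<delta>)"
proof (intro conjI allI impI, elim conjE)
  fix R :: "('w, 'n, 'm) sqp_process" and kmax smax :: nat and \<beta> :: "nat \<Rightarrow> real" and b \<delta> :: real
  assume smax: "1 \<le> smax" and setting: "sqp_setting P A C kmax smax \<beta> R"
    and unit: "unit_step_interval P A C kmax smax \<beta> R"
    and b: "b = \<gamma> / sqrt (real kmax + 1)" and \<beta>: "\<forall>k\<le>kmax. \<beta> k = b" and \<delta>: "0 < \<delta>" "\<delta> < 1"
  interpret sqp P A C kmax smax \<beta> R using assms(3-5) setting by unfold_locales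
  interpret prob_space M by (rule settingD(1))
  interpret sqp_const_step P A C kmax smax \<beta> R b
    by (rule const_step[OF assms(6,7) b _ unit]) (use \<beta> in blast)
  have "real smax \<le> ell smax (delta_hat kmax smax \<delta> / 2)"
    using delta_hat_bounds[OF \<delta>, of kmax smax] by (intro ell_ge) auto
  note le = order_trans[OF cond_mean_Z_le[unfolded Z_def[abs_def]] Z_avg_explicit_bound[OF b assms(6) this]]
  show "1 - \<delta> \<le> measure M {\<omega> \<in> space M. cond_mean P A C kmax smax R
            (\<lambda>k \<omega>. (stationarity P R k \<omega>)^2 / (kap_H C)^2 + infeasibility P R k \<omega>)
          \<le> 2 * (kap_Psi C + 1) *
              ((tau_init A * (obj P (x_init A) - f_low P) + norm1 (con P (x_init A))
                + M_bar P A C b * \<gamma>^2)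
               / (kap_q C * tau_min C * A_min P A C * \<gamma> * sqrt (real kmax + 1)))
            + 2 * (kap_Psi C + 1) *
              ((kap_E3 P A C b * \<gamma> * (ell smax (delta_hat kmax smax \<delta> / 2) + 1))
               / (kap_q C * tau_min C * A_min P A C * \<gamma> * sqrt (real kmax + 1)))
            + (kap_Psi C + 1) *
              (2 * (kap_dq1 P A C b * \<gamma> + kap_dq2 P A C b * \<gamma>^2 / sqrt (real kmax + 1))
               / (kap_q C * tau_min C * A_min P A C * \<gamma> * (real kmax + 1)))
              * real_of_int \<lceil>(ell smax (delta_hat kmax smax \<delta> / 2) + 1) / p_tau C\<rceil>}"
    \<comment> \<open>The inequality does not involve the sample point, so the set is the whole
      space and has probability one.\<close>
    using le \<delta> prob_space by simp
next
  obtain Kc where Kc: "0 \<le> Kc" "\<And>x. x \<in> region P \<Longrightarrow> norm1 (con P x) \<le> Kc"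
    using norm1_con_bounded[OF assms(3)] by blast
  define m where "m = max 1 ((kap_H C)\<^sup>2)"
  define \<Delta> where "\<Delta> = tau_init A - tau_min C"
  define D where "D = 2 * (kap_Psi C + 1) / (kap_q C * tau_min C * A_min P A C * \<gamma>)"
  define W where "W = (\<gamma> * kap_dq1 P A C \<gamma> + \<gamma>\<^sup>2 * kap_dq2 P A C \<gamma>) / p_tau C + \<gamma> * kap_E3 P A C \<gamma>"
  \<comment> \<open>The constant must be fixed before \<open>kmax\<close>, \<open>smax\<close> and
    \<open>\<delta>\<close>. Dividing by \<open>M_var\<close> lets the variance term of the rate
    absorb \<open>M_bar\<close>; dividing by \<open>\<Delta> * ln 2\<close> lets its logarithmic
    term absorb \<open>W * smax\<close>, as \<open>ln 2 \<le> ln kmax\<close>.\<close>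
  define K1 where "K1 = m * D * (1 + \<bar>M_bar P A C \<gamma>\<bar> * \<gamma>\<^sup>2 / M_var C + \<bar>W\<bar> / (\<Delta> * ln 2))"
  define K2 where "K2 = m * ((kap_d C * kap_g C)\<^sup>2 + Kc) * (\<gamma> * A_max P A) / M_var C"
  define K where "K = \<bar>K1\<bar> + \<bar>K2\<bar> + 1"
  have m: "1 \<le> m" by (simp add: m_def)
  have bound: "\<bar>cond_mean P A C kmax smax R
            (\<lambda>k \<omega>. (stationarity P R k \<omega>)^2 + infeasibility P R k \<omega>)\<bar>
          \<le> K *
            ((tau_init A * (obj P (x_init A) - f_low P) + norm1 (con P (x_init A)) + M_var C)
               / sqrt (real kmax + 1)
             + (tau_init A - tau_min C) * (real smax * ln (real kmax) + ln (1/\<delta>))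
               / sqrt (real kmax + 1))"
    if kmax: "2 \<le> kmax" and smax: "1 \<le> smax" and setting: "sqp_setting P A C kmax smax \<beta> R"
      and \<beta>: "\<forall>k\<le>kmax. \<beta> k = \<gamma> / sqrt (real kmax + 1)" and \<delta>: "0 < \<delta>" "\<delta> < 1"
    for R :: "('w, 'n, 'm) sqp_process" and kmax smax \<beta> \<delta>
  proof -
    interpret sqp P A C kmax smax \<beta> R using assms(3-5) setting by unfold_locales
    define T where "T = sqrt (real kmax + 1)"
    have T: "0 < T" by (simp add: T_def)
    define \<Phi> where "\<Phi> = tau_init A * (obj P (x_init A) - f_low P) + norm1 (con P (x_init A))"
    have \<Phi>: "\<Phi> = merit (tau_init A) (x_init A)" "0 \<le> \<Phi>"
      using merit_init_nonneg by (simp_all add: \<Phi>_def merit_def)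
    have \<Delta>: "0 \<le> \<Delta>" using tau_min_le_init by (simp add: \<Delta>_def)
    define Y where "Y = real smax * ln (real kmax) + ln (1/\<delta>)"
    have "ln 2 \<le> ln (real kmax)" using kmax by simp
    then have "real smax * ln 2 \<le> real smax * ln (real kmax)" by (rule mult_left_mono) simp
    moreover have "0 \<le> ln (1/\<delta>)" using \<delta> by (intro ln_ge_zero) simp
    ultimately have Y: "real smax * ln 2 \<le> Y" by (simp add: Y_def)
    then have Y0: "0 \<le> Y" by (rule order_trans[rotated]) simp
    have rhs: "0 \<le> \<Phi> + M_var C + \<Delta> * Y" "M_var C \<le> \<Phi> + M_var C + \<Delta> * Y"
      using \<Phi> constsD(6) \<Delta> Y0 by auto
    have "m * Z_avg \<le> K / T * (\<Phi> + M_var C + \<Delta> * Y)"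
    proof (cases "\<gamma> * A_max P A \<le> sqrt (real kmax + 1)")
      case True
      interpret sqp_const_step P A C kmax smax \<beta> R "\<gamma> / sqrt (real kmax + 1)"
        by (rule const_step[OF assms(6,7) refl _ unit_step_interval_eventually[OF _ True]]) (use \<beta> in blast)+
      have D: "0 \<le> D" unfolding D_def using constsD A_min_pos assms(6) by simp
      have "W * decr_sum \<le> \<bar>W\<bar> / (\<Delta> * ln 2) * (\<Delta> * Y)"
      \<comment> \<open>If the two parameters agree, the quotient is \<open>0\<close> by convention,
        and it suffices that no decrease occurs.\<close>
      proof (cases "\<Delta> = 0")
        case True
        then have "decr_sum = 0" using sum_decr_prob(2) by (simp add: \<Delta>_def decr_sum_def)
        then show ?thesis using True by simp
      next
        case False
        have "W * decr_sum \<le> \<bar>W\<bar> * real smax"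
          using sum_decr_prob(1) decr_sum_nonneg unfolding decr_sum_def by (intro mult_mono) auto
        also have "\<dots> = \<bar>W\<bar> / (\<Delta> * ln 2) * (\<Delta> * (real smax * ln 2))" using False by simp
        also have "\<dots> \<le> \<bar>W\<bar> / (\<Delta> * ln 2) * (\<Delta> * Y)"
          using Y \<Delta> by (intro mult_left_mono divide_nonneg_nonneg) auto
        finally show ?thesis .
      qed
      also have "\<dots> \<le> \<bar>W\<bar> / (\<Delta> * ln 2) * (\<Phi> + M_var C + \<Delta> * Y)"
        using \<Phi> constsD(6) \<Delta> by (intro mult_left_mono divide_nonneg_nonneg) auto
      finally have 1: "W * decr_sum \<le> \<bar>W\<bar> / (\<Delta> * ln 2) * (\<Phi> + M_var C + \<Delta> * Y)" .
      have "M_bar P A C \<gamma> * \<gamma>\<^sup>2 \<le> \<bar>M_bar P A C \<gamma>\<bar> * \<gamma>\<^sup>2" by (intro mult_right_mono) auto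
      also have "\<dots> = \<bar>M_bar P A C \<gamma>\<bar> * \<gamma>\<^sup>2 / M_var C * M_var C" using constsD(6) by simp
      also have "\<dots> \<le> \<bar>M_bar P A C \<gamma>\<bar> * \<gamma>\<^sup>2 / M_var C * (\<Phi> + M_var C + \<Delta> * Y)"
        using rhs constsD(6) by (intro mult_left_mono divide_nonneg_nonneg mult_nonneg_nonneg) auto
      finally have 2: "M_bar P A C \<gamma> * \<gamma>\<^sup>2 \<le> \<bar>M_bar P A C \<gamma>\<bar> * \<gamma>\<^sup>2 / M_var C * (\<Phi> + M_var C + \<Delta> * Y)" .
      have 3: "\<Phi> \<le> 1 * (\<Phi> + M_var C + \<Delta> * Y)" using \<Delta> Y0 constsD(6) by simp
      have "Z_avg \<le> D / T * (\<Phi> + M_bar P A C \<gamma> * \<gamma>\<^sup>2 + W * decr_sum)"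
        using Z_avg_rate[OF refl assms(6)] unfolding D_def T_def W_def \<Phi>(1) .
      also have "\<dots> \<le> D / T * ((1 + \<bar>M_bar P A C \<gamma>\<bar> * \<gamma>\<^sup>2 / M_var C + \<bar>W\<bar> / (\<Delta> * ln 2)) * (\<Phi> + M_var C + \<Delta> * Y))"
        unfolding distrib_right[of _ _ "\<Phi> + M_var C + \<Delta> * Y"]
        using D T 1 2 3 by (intro mult_left_mono add_mono) auto
      finally have "m * Z_avg \<le> m * (D / T * ((1 + \<bar>M_bar P A C \<gamma>\<bar> * \<gamma>\<^sup>2 / M_var C + \<bar>W\<bar> / (\<Delta> * ln 2)) * (\<Phi> + M_var C + \<Delta> * Y)))"
        using m by (intro mult_left_mono) auto
      also have "\<dots> = K1 / T * (\<Phi> + M_var C + \<Delta> * Y)" by (simp add: K1_def)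
      also have "\<dots> \<le> K / T * (\<Phi> + M_var C + \<Delta> * Y)"
        using T rhs by (intro mult_right_mono divide_right_mono) (auto simp: K_def)
      finally show ?thesis .
    next
      case False
      then have large: "1 \<le> \<gamma> * A_max P A / T" using T by (simp add: T_def)
      \<comment> \<open>Here \<open>T\<close> is below the fixed number
        \<open>\<gamma> * A_max\<close>, so a bound without decay is as good as one over
        \<open>T\<close>, up to that factor.\<close>
      let ?B = "m * ((kap_d C * kap_g C)\<^sup>2 + Kc)"
      have "m * Z_avg \<le> ?B" using Z_avg_bounded[OF Kc(2)] m by (intro mult_left_mono) auto
      also have "?B * 1 \<le> ?B * (\<gamma> * A_max P A / T)"
        using large m Kc(1) by (intro mult_left_mono mult_nonneg_nonneg add_nonneg_nonneg) auto
      also have "\<dots> = K2 / T * M_var C" using constsD(6) by (simp add: K2_def)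
      also have "\<dots> \<le> K / T * M_var C"
        using T constsD(6) by (intro mult_right_mono divide_right_mono) (auto simp: K_def)
      also have "\<dots> \<le> K / T * (\<Phi> + M_var C + \<Delta> * Y)"
        using T rhs by (intro mult_left_mono) (auto simp: K_def)
      finally show ?thesis by simp
    qed
    also have "\<dots> = K * ((\<Phi> + M_var C) / T + \<Delta> * Y / T)"
      by (simp add: algebra_simps add_divide_distrib)
    finally show ?thesis
      using cond_mean_stationarity_le unfolding m_def \<Phi>_def Y_def T_def \<Delta>_def by linarith
  qed
  show "\<exists>K>0. \<forall>(R :: ('w, 'n, 'm) sqp_process) kmax smax \<beta> \<delta>.
        2 \<le> kmax \<and> 1 \<le> smax \<and> sqp_setting P A C kmax smax \<beta> R \<and>
        (\<forall>k\<le>kmax. \<beta> k = \<gamma> / sqrt (real kmax + 1)) \<and> 0 < \<delta> \<and> \<delta> < 1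
        \<longrightarrow>
        measure (pspace R) {\<omega> \<in> space (pspace R).
          \<bar>cond_mean P A C kmax smax R
            (\<lambda>k \<omega>. (stationarity P R k \<omega>)^2 + infeasibility P R k \<omega>)\<bar>
          \<le> K *
            ((tau_init A * (obj P (x_init A) - f_low P) + norm1 (con P (x_init A)) + M_var C)
               / sqrt (real kmax + 1)
             + (tau_init A - tau_min C) * (real smax * ln (real kmax) + ln (1/\<delta>))
               / sqrt (real kmax + 1))}
        \<ge> 1 - \<delta>"
  proof (intro exI[of _ K] conjI allI impI)
    show "0 < K" by (simp add: K_def)
    fix R :: "('w, 'n, 'm) sqp_process" and kmax smax :: nat and \<beta> :: "nat \<Rightarrow> real" and \<delta> :: real
    assume "2 \<le> kmax \<and> 1 \<le> smax \<and> sqp_setting P A C kmax smax \<beta> R \<and>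
      (\<forall>k\<le>kmax. \<beta> k = \<gamma> / sqrt (real kmax + 1)) \<and> 0 < \<delta> \<and> \<delta> < 1"
    then have *: "2 \<le> kmax" "1 \<le> smax" "sqp_setting P A C kmax smax \<beta> R"
      "\<forall>k\<le>kmax. \<beta> k = \<gamma> / sqrt (real kmax + 1)" "0 < \<delta>" "\<delta> < 1" by auto
    interpret prob_space "pspace R"
      using *(3) unfolding sqp_setting_def sqp_process_spec_def by blast
    show "1 - \<delta> \<le> measure (pspace R) {\<omega> \<in> space (pspace R).
          \<bar>cond_mean P A C kmax smax R
            (\<lambda>k \<omega>. (stationarity P R k \<omega>)^2 + infeasibility P R k \<omega>)\<bar>
          \<le> K *
            ((tau_init A * (obj P (x_init A) - f_low P) + norm1 (con P (x_init A)) + M_var C)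
               / sqrt (real kmax + 1)
             + (tau_init A - tau_min C) * (real smax * ln (real kmax) + ln (1/\<delta>))
               / sqrt (real kmax + 1))}"
      using bound[OF *] *(5) prob_space by simp
  qed
qed

end
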